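(* Suppose $m\geq 27$ and let $X(0)\in\mathbb N^{m-1}\setminus\{0\}$ be a fixed initial state. Then, as $t\to+\infty$, $$X(t)=e^{t}\xi v_1\big(1+\varepsilon_1(t)\big)+2\Re\big(e^{\lambda_2 t}Wv_2\big)\big(1+\varepsilon_2(t)\big)+\boldsymbol\varepsilon_3(t),$$ where: $\xi$ is a positive Gamma-distributed random variable with expectation $N_0=u_1(X(0))$; $W$ is a complex-valued random variable admitting moments of all orders $p\ge1$ with $\mathbb E W=u_2(X(0))$; the real-valued random variables $\varepsilon_1(t),\varepsilon_2(t)$ tend to $0$ as $t\to+\infty$, almost surely and in every $L^p$, $p\ge1$; and the random vector $\boldsymbol\varepsilon_3(t)$ is $o(e^{\lambda_2 t})$ as $t\to+\infty$, almost surely and in every $L^p$, $p\ge1$.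
   Context: Let $m\geq 2$ be an integer and write $l_k(x_1,\dots,x_{m-1})=x_k$. For $1\le k\le m-2$ let $w_k\in\mathbb R^{m-1}$ have $-1$ in coordinate $k$, $+1$ in coordinate $k+1$ and $0$ elsewhere; let $w_{m-1}$ have $m$ in coordinate $1$, $-1$ in coordinate $m-1$ and $0$ elsewhere. $(X(t))_{t\ge0}$ is the right-continuous continuous-time Markov process on $\mathbb N^{m-1}\setminus\{0\}$ with infinitesimal generator $Gf(v)=\sum_{k=1}^{m-1}k\,l_k(v)[f(v+w_k)-f(v)]$ (a multitype branching process: a particle of colour $k$ lives an exponential time of parameter $k$ and at death is replaced by one particle of colour $k+1$ if $k\le m-2$, or by $m$ particles of colour $1$ if $k=m-1$). Let $\chi(\lambda)=\prod_{k=1}^{m-1}(\lambda+k)-m!$; its roots are simple, $1$ is the root of largest real part, and $\lambda_2$ denotes the root with the second largest real part and positive imaginary part. Notation: $\binom{z}{n}=z(z-1)\cdots(z-n+1)/n!$, $H_m(z)=\sum_{k=1}^{m-1}\frac1{z+k}$, $u_1(x)=\sum_{k=1}^{m-1}kx_k$, $u_2(x)=\sum_{k=1}^{m-1}\binom{\lambda_2+k-1}{k-1}x_k$, $v_1=\frac1{H_m(1)}\big(\frac1{k(k+1)}\big)_{1\le k\le m-1}$, $v_2=\frac1{H_m(\lambda_2)}\Big(\frac1{k\binom{\lambda_2+k}{k}}\Big)_{1\le k\le m-1}$. *)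

theory Defs
  imports "HOL-Probability.Probability"
begin

text \<open>States are vectors in N^(m-1), represented as functions nat => nat whose
  relevant coordinates are 1..m-1 (all other coordinates are 0).\<close>

definition chi :: "nat \<Rightarrow> complex \<Rightarrow> complex" where
  "chi m z = (\<Prod>k=1..m-1. z + of_nat k) - of_nat (fact m)"

definition Hm :: "nat \<Rightarrow> complex \<Rightarrow> complex" where
  "Hm m z = (\<Sum>k=1..m-1. 1 / (z + of_nat k))"

definition u1 :: "nat \<Rightarrow> (nat \<Rightarrow> nat) \<Rightarrow> real" where
  "u1 m x = (\<Sum>k=1..m-1. real k * real (x k))"

definition u2 :: "nat \<Rightarrow> complex \<Rightarrow> (nat \<Rightarrow> nat) \<Rightarrow> complex" where
  "u2 m lam2 x = (\<Sum>k=1..m-1. ((lam2 + of_nat k - 1) gchoose (k - 1)) * of_nat (x k))"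

definition v1 :: "nat \<Rightarrow> nat \<Rightarrow> real" where
  "v1 m k = (1 / Re (Hm m 1)) * (1 / (real k * (real k + 1)))"

definition v2 :: "nat \<Rightarrow> complex \<Rightarrow> nat \<Rightarrow> complex" where
  "v2 m lam2 k = (1 / Hm m lam2) * (1 / (of_nat k * ((lam2 + of_nat k) gchoose k)))"

definition wvec :: "nat \<Rightarrow> nat \<Rightarrow> nat \<Rightarrow> int" where
  "wvec m k i =
     (if k \<le> m - 2 then (if i = k then -1 else if i = k + 1 then 1 else 0)
      else (if i = 1 then int m else 0) + (if i = m - 1 then -1 else 0))"

definition shift :: "nat \<Rightarrow> nat \<Rightarrow> (nat \<Rightarrow> nat) \<Rightarrow> (nat \<Rightarrow> nat)" where
  "shift m k v = (\<lambda>i. nat (int (v i) + wvec m k i))"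

definition rate :: "nat \<Rightarrow> (nat \<Rightarrow> nat) \<Rightarrow> real" where
  "rate m v = (\<Sum>k=1..m-1. real k * real (v k))"

definition jump_prob :: "nat \<Rightarrow> (nat \<Rightarrow> nat) \<Rightarrow> (nat \<Rightarrow> nat) \<Rightarrow> real" where
  "jump_prob m v v' =
     (\<Sum>k=1..m-1. if v' = shift m k v then real k * real (v k) else 0) / rate m v"

text \<open>X is the continuous-time Markov process with generator
  G f(v) = sum_k k l_k(v) (f(v + w_k) - f(v)) started at x0, described via its
  jump chain Y and holding times S (jump-chain/holding-time characterisation):
  the joint law of (Y_0..Y_n, S_0..S_(n-1)) is the one of a chain with
  transition matrix jump_prob and exponential holding times of rate q(Y_j),
  and X(t) = Y_n on [S_0+..+S_(n-1), S_0+..+S_n).\<close>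
definition is_branching_process ::
  "nat \<Rightarrow> (nat \<Rightarrow> nat) \<Rightarrow> 'a measure \<Rightarrow> (real \<Rightarrow> 'a \<Rightarrow> (nat \<Rightarrow> nat)) \<Rightarrow> bool" where
  "is_branching_process m x0 M X \<longleftrightarrow>
     (\<forall>t\<ge>0. X t \<in> measurable M (count_space UNIV)) \<and>
     (\<exists>Y S.
        (\<forall>j. Y j \<in> measurable M (count_space UNIV)) \<and>
        (\<forall>j. S j \<in> borel_measurable M) \<and>
        (\<forall>n (ys :: nat \<Rightarrow> (nat \<Rightarrow> nat)) (ss :: nat \<Rightarrow> real).
           (\<forall>j<n. ss j \<ge> 0) \<longrightarrow>
           measure M {\<omega> \<in> space M. (\<forall>j\<le>n. Y j \<omega> = ys j) \<and> (\<forall>j<n. S j \<omega> > ss j)} =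
           (if ys 0 = x0 then 1 else 0) *
           (\<Prod>j<n. jump_prob m (ys j) (ys (Suc j)) * exp (- rate m (ys j) * ss j))) \<and>
        (AE \<omega> in M. \<forall>t\<ge>0. \<exists>n. (\<Sum>j<n. S j \<omega>) \<le> t \<and> t < (\<Sum>j<Suc n. S j \<omega>) \<and>
                                 X t \<omega> = Y n \<omega>))"

definition gamma_density :: "real \<Rightarrow> real \<Rightarrow> real \<Rightarrow> ennreal" where
  "gamma_density a \<theta> x =
     ennreal (if x \<le> 0 then 0 else x powr (a - 1) * exp (- x / \<theta>) / (Gamma a * \<theta> powr a))"

end

theory Submission
  imports Defs "HOL-Computational_Algebra.Fundamental_Theorem_Algebra"
begin

text \<open>
  The functional \<open>u\<^sub>1\<close> increases by exactly one at each jump, so after \<open>n\<close> jumps the total rate is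
  \<open>N\<^sub>0 + n\<close> whatever the path: the jump chain \<open>Y\<close> is an urn independent of the holding times, and
  \<open>u\<^sub>1(X)\<close> is a Yule process. For the holding times, \<open>(N\<^sub>0 + n) exp(-T\<^sub>n)\<close> converges to a Gamma variable
  \<open>\<xi>\<close>, and by the same result for the shifted clocks the error is of order \<open>sqrt n\<close> in every \<open>L\<^sup>p\<close>.
  For the urn, \<open>u\<^sub>\<lambda>(Y\<^sub>n)\<close> divided by \<open>\<gamma>\<^sub>n(\<lambda>) = \<Prod>j<n. (1 + \<lambda> / (N\<^sub>0 + j))\<close>, of order \<open>n\<^sup>\<lambda>\<close>, is a martingale with bounded numerator
  increments; Azuma-type exponential bounds give its convergence if \<open>Re \<lambda> > 1/2\<close>, and
  \<open>u\<^sub>\<lambda>(Y\<^sub>n) = o(n\<^sup>\<sigma>)\<close> for every \<open>\<sigma> > max (1/2) (Re \<lambda>)\<close>. All errors are dominated by a single random variable with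
  finite moments, so almost sure convergence implies convergence in \<open>L\<^sup>p\<close>. For \<open>m \<ge> 27\<close> one has
  \<open>Re \<lambda>\<^sub>2 > 1/2\<close>, so \<open>\<epsilon>\<^sub>1 = \<epsilon>\<^sub>2 = 0\<close> is a valid choice: the fluctuations, of order \<open>exp(t/2)\<close>, of \<open>u\<^sub>1(X)\<close> are absorbed by \<open>\<epsilon>\<^sub>3\<close>.
\<close>

section \<open>Roots of the characteristic polynomial\<close>

text \<open>Convergence of \<open>exp (-t) u1(X(t))\<close> alone would leave an error
  \<open>o(exp t)\<close>, far too large for the second term. The rate comes from an exact law:
  restarting the clocks at the n-th jump changes the limit into \<open>exp (T n) * \<xi>\<close>,
  which is therefore Gamma with parameter \<open>N0 + n\<close> and standard deviation
  \<open>sqrt (N0 + n)\<close>. The two halves of the process meet in one product: the Pochhammer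
  ratio \<open>(N0 + z)_n / (N0)_n\<close> is the urn normalisation at the eigenvalue z and also the
  reciprocal of the Laplace transform of \<open>T n\<close> at z. Hence
  \<open>u2(Y n) * exp (-z T n)\<close> has constant mean, which yields \<open>E W\<close>, and
  \<open>W\<close> is the urn limit times a constant times \<xi> to the power z. Since the chain has
  finitely many states after n jumps, every expectation is a finite sum over paths, and iterated
  one-step exponential bounds take the place of conditional expectations. A state is recovered from
  its functionals \<open>u2 m z\<close>, z over all roots, by Lagrange interpolation; this requires
  simple roots, that is \<open>Hm\<close> nonzero at each of them.\<close>

definition arg_sum :: "nat set \<Rightarrow> real \<Rightarrow> real \<Rightarrow> real" where
  "arg_sum I x y = (\<Sum>k\<in>I. arctan (y / (x + real k)))"

lemma Complex_polar_right_half: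
  assumes "a > 0"
  shows "Complex a y = of_real (sqrt (a\<^sup>2 + y\<^sup>2)) * cis (arctan (y / a))"
proof -
  have s: "sqrt (1 + (y / a)\<^sup>2) = sqrt (a\<^sup>2 + y\<^sup>2) / a"
  proof -
    have "1 + (y/a)\<^sup>2 = (a\<^sup>2 + y\<^sup>2) / a\<^sup>2" using assms by (simp add: field_simps)
    then show ?thesis using assms by (simp add: real_sqrt_divide)
  qed
  have "sqrt (a\<^sup>2 + y\<^sup>2) > 0" using assms by (simp add: add_pos_nonneg)
  then show ?thesis
    using assms by (simp add: complex_eq_iff cos_arctan sin_arctan s)
qed

text \<open>Each factor lies in the open right half plane, where its argument is an arctangent. The
  arguments are added without reduction modulo \<open>2 * pi\<close>, so \<open>arg_sum\<close> is a
  continuous branch that counts full turns.\<close>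

lemma prod_polar:
  assumes "finite I" "\<And>k. k \<in> I \<Longrightarrow> x + real k > 0"
  shows "(\<Prod>k\<in>I. Complex x y + of_nat k) =
           of_real (\<Prod>k\<in>I. sqrt ((x + real k)\<^sup>2 + y\<^sup>2)) * cis (arg_sum I x y)"
  using assms
proof (induction I)
  case empty
  then show ?case by (simp add: arg_sum_def)
next
  case (insert k I)
  have "Complex x y + of_nat k = Complex (x + real k) y"
    by (simp add: complex_eq_iff)
  also have "\<dots> = of_real (sqrt ((x + real k)\<^sup>2 + y\<^sup>2)) * cis (arctan (y / (x + real k)))"
    using insert by (intro Complex_polar_right_half) auto
  finally show ?case
    using insert by (simp add: arg_sum_def cis_mult[symmetric] mult_ac)
qed

text \<open>Replaces a numerical estimate of arctangents by exact arithmetic: a sum of positive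
  angles that stays in \<open>(0, pi]\<close> would have a nonnegative sine, hence a product with
  nonnegative imaginary part.\<close>

lemma arg_sum_gt_pi:
  assumes "finite I" "I \<noteq> {}" "\<And>k. k \<in> I \<Longrightarrow> x + real k > 0" "y > 0"
    and "Im (\<Prod>k\<in>I. Complex x y + of_nat k) < 0"
  shows "arg_sum I x y > pi"
proof (rule ccontr)
  assume "\<not> ?thesis"
  moreover have "arg_sum I x y > 0"
    unfolding arg_sum_def using assms by (intro sum_pos) auto
  ultimately have "sin (arg_sum I x y) \<ge> 0" by (intro sin_ge_zero) auto
  then have "Im (\<Prod>k\<in>I. Complex x y + of_nat k) \<ge> 0"
    using assms(1,3)
    by (subst prod_polar)
       (auto simp del: of_real_prod simp: Im_complex_of_real Im_divide_of_real intro!: mult_nonneg_nonneg prod_nonneg)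
  with assms(5) show False by simp
qed

lemma Complex_add_of_nat: "Complex x y + of_nat k = Complex (x + real k) y"
  by (simp add: complex_eq_iff)

lemma Complex_times_Complex: "Complex a b * Complex c d = Complex (a * c - b * d) (a * d + b * c)"
  by (simp add: complex_eq_iff)

text \<open>At real part \<open>1/2\<close> and \<open>m = 27\<close> the height \<open>11/5\<close> lies just below the curve \<open>|\<Prod>(z + k)| = m!\<close>; it stays
  below for larger \<open>m\<close> because \<open>(11/5)\<^sup>2 \<le> m + 3/4\<close>. The index range is split so that each part has argument
  sum slightly above \<open>\<pi>\<close>, which the sign of the imaginary part of its product detects.\<close>
lemma arg_sum_27: "arg_sum {1..26} (1/2) (11/5) > 2 * pi"
proof -
  have E1: "{6..25::nat} = {6,7,8,9,10,11,12,13,14,15,16,17,18,19,20,21,22,23,24,25}"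
    by (simp add: atLeastAtMostSuc_conv eval_nat_numeral) auto
  have E2: "{1..5::nat} \<union> {26} = {1,2,3,4,5,26}" by auto
  have "arg_sum {6..25} (1/2) (11/5) > pi"
  proof (rule arg_sum_gt_pi)
    show "Im (\<Prod>k\<in>{6..25}. Complex (1/2) (11/5) + of_nat k) < 0"
      unfolding E1 Complex_add_of_nat
      by (simp add: Complex_times_Complex del: times_complex.sel)
  qed auto
  moreover have "arg_sum ({1..5} \<union> {26}) (1/2) (11/5) > pi"
  proof (rule arg_sum_gt_pi)
    show "Im (\<Prod>k\<in>{1..5}\<union>{26}. Complex (1/2) (11/5) + of_nat k) < 0"
      unfolding E2 Complex_add_of_nat
      by (simp add: Complex_times_Complex del: times_complex.sel)
  qed auto
  moreover have "{1..26::nat} = {6..25} \<union> ({1..5} \<union> {26})" by auto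
  then have "arg_sum {1..26} (1/2) (11/5) =
     arg_sum {6..25} (1/2) (11/5) + arg_sum ({1..5} \<union> {26}) (1/2) (11/5)"
    unfolding arg_sum_def by (simp only:) (rule sum.union_disjoint, auto)
  ultimately show ?thesis by simp
qed

lemma prod_Suc_eq_fact:
  assumes "m \<ge> 1"
  shows "(\<Prod>k=1..m-1. 1 + real k) = fact m"
proof -
  have "(\<Prod>k=1..j. 1 + real k) = fact (Suc j)" for j
    by (induction j) (auto simp: algebra_simps)
  from this[of "m - 1"] show ?thesis using assms by simp
qed

text \<open>The squared modulus of the product of \<open>x + k + i y\<close>, kept as a square so
  that comparisons at rational points are rational. At \<open>(1, 0)\<close> it is
  \<open>(n + 1)!\<close> squared, so for \<open>n = m - 1\<close> equality with
  \<open>modsq n 1 0\<close> describes the curve on which the product has modulus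
  \<open>m!\<close>.\<close>

definition modsq :: "nat \<Rightarrow> real \<Rightarrow> real \<Rightarrow> real" where
  "modsq n x y = (\<Prod>k=1..n. (x + real k)\<^sup>2 + y\<^sup>2)"

lemma sqrt_prod: "sqrt (\<Prod>k\<in>I. f k) = (\<Prod>k\<in>I. sqrt (f k))"
  by (induction I rule: infinite_finite_induct) (auto simp: real_sqrt_mult)

lemma modsq_27_le:
  assumes "n \<ge> 26"
  shows "modsq n (1/2) (11/5) \<le> modsq n 1 0"
  using assms
proof (induction n rule: dec_induct)
  case base
  have E1: "{1..26::nat} = {1,2,3,4,5,6,7,8,9,10,11,12,13,14,15,16,17,18,19,20,21,22,23,24,25,26}"
    by (simp add: atLeastAtMostSuc_conv eval_nat_numeral) auto
  show ?case unfolding modsq_def E1 by (simp add: power2_eq_square)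
next
  case (step n)
  have *: "((1/2 + real (Suc n))\<^sup>2 + (11/5)\<^sup>2) \<le> (1 + real (Suc n))\<^sup>2 + 0\<^sup>2"
    using step(1) by (simp add: power2_eq_square algebra_simps)
  have "modsq n (1/2) (11/5) * ((1/2 + real (Suc n))\<^sup>2 + (11/5)\<^sup>2) \<le>
        modsq n 1 0 * ((1 + real (Suc n))\<^sup>2 + 0\<^sup>2)"
    using step * by (intro mult_mono) (auto simp: modsq_def intro!: prod_nonneg)
  then show ?case by (simp add: modsq_def)
qed

lemma arg_sum_27_le:
  assumes "n \<ge> 26"
  shows "arg_sum {1..n} (1/2) (11/5) > 2 * pi"
proof -
  have "arg_sum {1..26} (1/2) (11/5) \<le> arg_sum {1..n} (1/2) (11/5)"
    unfolding arg_sum_def using assms by (intro sum_mono2) auto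
  with arg_sum_27 show ?thesis by linarith
qed

lemma modsq_strict_mono:
  assumes "n > 0" "x > 0" "0 \<le> y" "y < y'"
  shows "modsq n x y < modsq n x y'"
  unfolding modsq_def using assms
  by (intro prod_mono_strict) (auto intro!: power_strict_mono add_pos_nonneg)

lemma arg_sum_mono:
  assumes "x > 0" "y \<le> y'"
  shows "arg_sum I x y \<le> arg_sum I x y'"
  unfolding arg_sum_def using assms
  by (intro sum_mono) (auto simp: arctan_le_iff intro!: divide_right_mono)

lemma modsq_level_curve:
  assumes "n > 0" "1/2 \<le> x" "x \<le> 1"
  shows "\<exists>y. 0 \<le> y \<and> y \<le> real n + 1 \<and> modsq n x y = modsq n 1 0"
proof (rule IVT')
  show "modsq n x 0 \<le> modsq n 1 0"
    unfolding modsq_def using assms by (intro prod_mono) (auto intro!: power_mono)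
  show "modsq n 1 0 \<le> modsq n x (real n + 1)"
    unfolding modsq_def using assms
  proof (intro prod_mono conjI)
    fix k assume "k \<in> {1..n}"
    then have "(1 + real k)\<^sup>2 \<le> (real n + 1)\<^sup>2" by (intro power_mono) auto
    then show "(1 + real k)\<^sup>2 + 0\<^sup>2 \<le> (x + real k)\<^sup>2 + (real n + 1)\<^sup>2"
      by (simp add: add_increasing)
  qed auto
  show "continuous_on {0..real n + 1} (modsq n x)"
    unfolding modsq_def by (intro continuous_intros)
qed auto

text \<open>On the curve \<open>|\<Prod>(z + k)| = m!\<close> the argument of the product decreases continuously
  to \<open>0\<close> as \<open>z\<close> moves right to \<open>1\<close>; at the real part \<open>1/2\<close> it exceeds \<open>2\<pi>\<close>.\<close>
lemma ex_root_Re_gt_half: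
  assumes "m \<ge> 27"
  shows "\<exists>z. chi m z = 0 \<and> z \<noteq> 1 \<and> Re z > 1/2"
proof -
  define n where "n = m - 1"
  have n: "n \<ge> 26" "n > 0" using assms by (auto simp: n_def)
  obtain y where y: "\<And>x. x \<in> {1/2..1} \<Longrightarrow> 0 \<le> y x \<and> y x \<le> real n + 1 \<and> modsq n x (y x) = modsq n 1 0"
    using modsq_level_curve[OF n(2)] by (metis atLeastAtMost_iff)
  have uniq: "y' = y x" if "x \<in> {1/2..1}" "0 \<le> y'" "modsq n x y' = modsq n 1 0" for x y'
    using that y[of x] modsq_strict_mono[OF n(2), of x y' "y x"] modsq_strict_mono[OF n(2), of x "y x" y']
    by (cases y' "y x" rule: linorder_cases) auto
  \<comment> \<open>The height \<open>y x\<close> is defined implicitly; uniqueness identifies its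
    graph with a closed subset of a compact box, and a closed graph with compact range gives
    continuity.\<close>
  have graph: "(\<lambda>x. (x, y x)) ` {1/2..1} =
      {p \<in> {1/2..1} \<times> {0..real n + 1}. modsq n (fst p) (snd p) = modsq n 1 0}"
    using y uniq by (force simp: image_iff)
  have "continuous_on {1/2..1} y"
  proof (rule continuous_from_closed_graph)
    show "compact {0..real n + 1}" by simp
    show "y \<in> {1/2..1} \<rightarrow> {0..real n + 1}" using y by auto
    show "closed ((\<lambda>x. (x, y x)) ` {1/2..1})"
      unfolding graph modsq_def
      by (intro continuous_closed_preimage_constant continuous_intros closed_Times closed_atLeastAtMost)
  qed
  then have "continuous_on {1/2..1} (\<lambda>x. arg_sum {1..n} x (y x))"
    unfolding arg_sum_def by (intro continuous_intros) auto
  moreover have "y 1 = 0" using uniq[of 1 0] by simp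
  then have "arg_sum {1..n} 1 (y 1) = 0" by (simp add: arg_sum_def)
  moreover have "11/5 \<le> y (1/2)"
  proof (rule ccontr)
    assume "\<not> ?thesis"
    then have "modsq n (1/2) (y (1/2)) < modsq n (1/2) (11/5)"
      using y[of "1/2"] by (intro modsq_strict_mono n) auto
    with modsq_27_le[OF n(1)] y[of "1/2"] show False by simp
  qed
  then have gt: "arg_sum {1..n} (1/2) (y (1/2)) > 2 * pi"
    using arg_sum_27_le[OF n(1)] arg_sum_mono[of "1/2" "11/5" "y (1/2)" "{1..n}"] by simp
  \<comment> \<open>The value \<open>2 * pi\<close> makes the product real and positive, hence equal
    to \<open>m!\<close>. Argument \<open>0\<close> would only return the root \<open>1\<close>;
    here the nonzero argument sum forces \<open>y x \<noteq> 0\<close>.\<close>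
  ultimately obtain x where x: "1/2 \<le> x" "x \<le> 1" "arg_sum {1..n} x (y x) = 2 * pi"
    using IVT2'[of "\<lambda>x. arg_sum {1..n} x (y x)" 1 "2 * pi" "1/2"] by auto
  have "(\<Prod>k=1..n. sqrt ((x + real k)\<^sup>2 + (y x)\<^sup>2)) = sqrt (modsq n x (y x))"
    by (simp add: modsq_def sqrt_prod)
  also have "\<dots> = sqrt (modsq n 1 0)" using y[of x] x by simp
  also have "\<dots> = (\<Prod>k=1..n. 1 + real k)" by (simp add: modsq_def sqrt_prod)
  also have "\<dots> = fact m" using assms prod_Suc_eq_fact[of m] by (simp add: n_def)
  finally have "(\<Prod>k=1..n. Complex x (y x) + of_nat k) = of_nat (fact m)"
    using x by (subst prod_polar) (auto simp del: of_real_prod)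
  then have "chi m (Complex x (y x)) = 0" by (simp add: chi_def n_def)
  moreover have "x \<noteq> 1/2"
  proof
    assume "x = 1/2"
    with gt x(3) show False by simp
  qed
  moreover have "y x \<noteq> 0" using x(3) by (auto simp: arg_sum_def)
  ultimately show ?thesis using x by (intro exI[of _ "Complex x (y x)"]) (auto simp: complex_eq_iff)
qed

section \<open>Location of the roots\<close>

lemma chi_root_iff: "chi m z = 0 \<longleftrightarrow> (\<Prod>k=1..m-1. z + of_nat k) = of_nat (fact m)"
  by (simp add: chi_def)

lemma chi_1: "m \<ge> 1 \<Longrightarrow> chi m 1 = 0"
proof -
  assume "m \<ge> 1"
  then have "complex_of_real (\<Prod>k=1..m-1. 1 + real k) = of_real (fact m)"
    by (simp only: prod_Suc_eq_fact)
  then show ?thesis by (simp add: chi_root_iff)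
qed

lemma chi_cnj: "chi m (cnj z) = cnj (chi m z)"
  by (simp add: chi_def)

lemma norm_prod_root:
  assumes "chi m z = 0"
  shows "(\<Prod>k=1..m-1. norm (z + of_nat k)) = fact m"
proof -
  have "norm (\<Prod>k=1..m-1. z + of_nat k) = norm (of_nat (fact m) :: complex)"
    using assms by (simp only: chi_root_iff)
  then show ?thesis by (simp add: prod_norm)
qed

text \<open>For \<open>Re z \<ge> 1\<close> and \<open>z \<noteq> 1\<close> every factor has modulus
  larger than \<open>1 + k\<close>, while the moduli must multiply to \<open>m!\<close>.\<close>

lemma chi_root_Re_less_1:
  assumes "chi m z = 0" "z \<noteq> 1" "m \<ge> 2"
  shows "Re z < 1"
proof (rule ccontr)
  assume "\<not> ?thesis"
  then have r: "Re z \<ge> 1" by simp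
  have gt: "norm (z + of_nat k) > 1 + real k" for k
  proof -
    have "Re z > 1 \<or> Im z \<noteq> 0" using assms(2) r by (auto simp: complex_eq_iff)
    then have "(Re z + real k)\<^sup>2 + (Im z)\<^sup>2 > (1 + real k)\<^sup>2"
    proof
      assume "Re z > 1"
      then have "(Re z + real k)\<^sup>2 > (1 + real k)\<^sup>2" by (intro power_strict_mono) auto
      then show ?thesis by (simp add: add_strict_increasing2 add.commute)
    next
      assume "Im z \<noteq> 0"
      moreover have "(Re z + real k)\<^sup>2 \<ge> (1 + real k)\<^sup>2" using r by (intro power_mono) auto
      ultimately show ?thesis by (simp add: add_strict_increasing add.commute)
    qed
    then show ?thesis by (simp add: norm_complex_def real_less_rsqrt)
  qed
  have "z + of_nat k \<noteq> 0" for k using gt[of k] by auto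
  then have "(\<Prod>k=1..m-1. 1 + real k) < (\<Prod>k=1..m-1. norm (z + of_nat k))"
    using assms(3) gt by (intro prod_mono_strict) (auto intro: less_imp_le)
  then show False using norm_prod_root[OF assms(1)] prod_Suc_eq_fact[of m] assms(3) by simp
qed

text \<open>On a vertical line to the right of \<open>-1\<close> the modulus of the product grows
  strictly with the modulus of the imaginary part, and it is prescribed at a root.\<close>

lemma chi_roots_same_Re:
  assumes "chi m z = 0" "chi m w = 0" "Re z = Re w" "Re z > -1" "m \<ge> 2"
  shows "w = z \<or> w = cnj z"
proof -
  have *: "\<bar>Im z\<bar> \<le> \<bar>Im w\<bar>" if "chi m z = 0" "chi m w = 0" "Re z = Re w" "Re z > -1" for z w
  proof (rule ccontr)
    assume "\<not> ?thesis"
    then have "(Im w)\<^sup>2 < (Im z)\<^sup>2" by (metis abs_le_square_iff not_le)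
    then have "(\<Prod>k=1..m-1. norm (w + of_nat k)) < (\<Prod>k=1..m-1. norm (z + of_nat k))"
      using assms(5) that by (intro prod_mono_strict) (auto simp: norm_complex_def intro!: add_pos_nonneg)
    then show False using that norm_prod_root by simp
  qed
  have "\<bar>Im z\<bar> = \<bar>Im w\<bar>" using *[of z w] *[of w z] assms by simp
  then show ?thesis using assms(3) by (auto simp: complex_eq_iff abs_eq_iff)
qed

section \<open>Simplicity of the roots and factorisation over them\<close>

definition chi_poly :: "nat \<Rightarrow> complex poly" where
  "chi_poly m = (\<Prod>k=1..m-1. [:of_nat k, 1:]) - [:of_nat (fact m):]"

lemma poly_chi_poly: "poly (chi_poly m) z = chi m z"
  by (simp add: chi_poly_def chi_def poly_prod add.commute)

lemma degree_prod_linear: "degree (\<Prod>k\<in>I. [:f k, 1:] :: complex poly) = card I"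
  by (simp add: degree_prod_eq_sum_degree)

lemma lead_coeff_prod_linear: "lead_coeff (\<Prod>k\<in>I. [:f k, 1:] :: complex poly) = 1"
  by (simp add: lead_coeff_prod)

lemma degree_chi_poly: "m \<ge> 2 \<Longrightarrow> degree (chi_poly m) = m - 1"
  unfolding chi_poly_def diff_conv_add_uminus
  by (subst degree_add_eq_left) (auto simp: degree_prod_linear)

lemma lead_coeff_chi_poly: "m \<ge> 2 \<Longrightarrow> lead_coeff (chi_poly m) = 1"
proof -
  assume m: "m \<ge> 2"
  have "coeff (\<Prod>k=1..m-1. [:of_nat k, 1:] :: complex poly) (m - 1) = 1"
    using lead_coeff_prod_linear[of of_nat "{1..m-1}"] by (simp add: degree_prod_linear)
  moreover have "coeff [:of_nat (fact m) :: complex:] (m - 1) = 0"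
    using m by (simp add: coeff_pCons split: nat.splits)
  ultimately show ?thesis using m by (simp add: degree_chi_poly) (simp add: chi_poly_def)
qed

lemma pderiv_chi_poly:
  assumes "\<And>k. k \<in> {1..m-1} \<Longrightarrow> z + of_nat k \<noteq> 0"
  shows "poly (pderiv (chi_poly m)) z = (\<Prod>k=1..m-1. z + of_nat k) * Hm m z"
proof -
  have "poly (pderiv (chi_poly m)) z = (\<Sum>k=1..m-1. \<Prod>j\<in>{1..m-1}-{k}. z + of_nat j)"
    by (simp add: chi_poly_def pderiv_diff pderiv_prod poly_sum poly_prod pderiv_pCons add.commute)
  also have "\<dots> = (\<Sum>k=1..m-1. (\<Prod>k=1..m-1. z + of_nat k) * (1 / (z + of_nat k)))"
  proof (intro sum.cong refl)
    fix k assume k: "k \<in> {1..m-1}"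
    then show "(\<Prod>j\<in>{1..m-1}-{k}. z + of_nat j) = (\<Prod>k=1..m-1. z + of_nat k) * (1 / (z + of_nat k))"
      using assms[OF k] by (subst prod.remove[OF _ k]) auto
  qed
  finally show ?thesis by (simp add: Hm_def sum_distrib_left)
qed

lemma chi_root_nonzero_factor:
  assumes "chi m z = 0" "k \<in> {1..m-1}"
  shows "z + of_nat k \<noteq> 0"
proof
  assume "z + of_nat k = 0"
  then have "(\<Prod>k=1..m-1. z + of_nat k) = 0" using assms(2) by (intro prod_zero) auto
  with assms(1) show False by (simp add: chi_root_iff)
qed

text \<open>All terms of \<open>Hm\<close> have an imaginary part of the sign opposite to
  \<open>Im z\<close>, so a zero of \<open>Hm\<close> must be real.\<close>

lemma Im_Hm: "Im (Hm m z) = - Im z * (\<Sum>k=1..m-1. 1 / (norm (z + of_nat k))\<^sup>2)"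
  by (simp add: Hm_def Im_divide cmod_power2 sum_distrib_left)

lemma fact_mult_fact_le: "fact i * fact j \<le> (fact (i + j) :: nat)"
  by (intro dvd_imp_le fact_fact_dvd_fact) simp

text \<open>Split at the integer part j of a: the factors up to j are at most
  \<open>j + 1 - k\<close> in modulus, the later ones at most \<open>k - j\<close>, and
  \<open>j! * (n - j)! \<le> n!\<close>.\<close>

lemma abs_prod_shift_less:
  fixes a :: real
  assumes "1 \<le> a" "a \<le> real n" 
  shows "\<bar>\<Prod>k=1..n. real k - a\<bar> \<le> fact n"
proof -
  define j where "j = nat \<lfloor>a\<rfloor>"
  have j: "real j \<le> a" "a < real j + 1" "j \<le> n" using assms by (auto simp: j_def) linarith+
  have "{1..n} = {1..j} \<union> {j+1..n}" using j by auto
  then have "\<bar>\<Prod>k=1..n. real k - a\<bar> = (\<Prod>k=1..j. \<bar>real k - a\<bar>) * (\<Prod>k=j+1..n. \<bar>real k - a\<bar>)"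
    by (simp add: prod.union_disjoint abs_mult flip: abs_prod)
  also have "\<dots> \<le> (\<Prod>k=1..j. real (j + 1 - k)) * (\<Prod>k=j+1..n. real (k - j))"
    using j by (intro mult_mono prod_mono prod_nonneg) (auto simp: of_nat_diff)
  also have "(\<Prod>k=1..j. real (j + 1 - k)) = fact j"
    unfolding fact_prod of_nat_prod
    by (intro prod.reindex_bij_witness[of _ "\<lambda>k. j + 1 - k" "\<lambda>k. j + 1 - k"]) auto
  also have "(\<Prod>k=j+1..n. real (k - j)) = fact (n - j)"
    unfolding fact_prod of_nat_prod using j
    by (intro prod.reindex_bij_witness[of _ "\<lambda>k. k + j" "\<lambda>k. k - j"]) auto
  also have "fact j * fact (n - j) \<le> (fact n :: real)"
  proof -
    have "real (fact j * fact (n - j)) \<le> real (fact n)"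
      using fact_mult_fact_le[of j "n - j"] j by (subst of_nat_le_iff) simp
    then show ?thesis by simp
  qed
  finally show ?thesis .
qed

text \<open>By the signs of its terms a zero of \<open>Hm\<close> is real and lies between
  \<open>-(m - 1)\<close> and \<open>-1\<close>. There the product is at most
  \<open>(m - 1)!\<close> in modulus, too small for a root.\<close>

lemma Hm_nonzero_at_root:
  assumes "chi m z = 0" "m \<ge> 2"
  shows "Hm m z \<noteq> 0"
proof
  assume H: "Hm m z = 0"
  note nz = chi_root_nonzero_factor[OF assms(1)]
  have "(\<Sum>k=1..m-1. 1 / (norm (z + of_nat k))\<^sup>2) > 0"
    using assms(2) nz by (intro sum_pos) auto
  moreover have "Im z * (\<Sum>k=1..m-1. 1 / (norm (z + of_nat k))\<^sup>2) = 0"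
    using H Im_Hm[of m z] by simp
  ultimately have "Im z = 0" by simp
  then obtain x where z: "z = of_real x" by (auto simp: complex_eq_iff intro: that[of "Re z"])
  have "complex_of_real (\<Sum>k=1..m-1. 1 / (x + real k)) = 0" using H by (simp add: Hm_def z)
  then have S: "(\<Sum>k=1..m-1. 1 / (x + real k)) = 0" by (simp only: of_real_eq_0_iff)
  have nx: "x + real k \<noteq> 0" if "k \<in> {1..m-1}" for k
  proof
    assume "x + real k = 0"
    then have "complex_of_real (x + real k) = 0" by simp
    with nz[OF that] show False by (simp add: z)
  qed
  have "x < -1"
  proof (rule ccontr)
    assume "\<not> ?thesis"
    then have "x + real k > 0" if "k \<in> {1..m-1}" for k
      using nx[OF that] that by (simp add: less_le) linarith
    then have "(\<Sum>k=1..m-1. 1 / (x + real k)) > 0" using assms(2) by (intro sum_pos) auto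
    with S show False by simp
  qed
  moreover have "- x \<le> real (m - 1)"
  proof (rule ccontr)
    assume "\<not> ?thesis"
    then have "x + real k < 0" if "k \<in> {1..m-1}" for k using that by auto
    then have "(\<Sum>k=1..m-1. - (1 / (x + real k))) > 0"
      using assms(2) by (intro sum_pos) (auto simp: divide_neg_pos)
    with S show False by (simp add: sum_negf)
  qed
  ultimately have "\<bar>\<Prod>k=1..m-1. real k - (-x)\<bar> \<le> fact (m - 1)"
    by (intro abs_prod_shift_less) auto
  moreover have "\<bar>\<Prod>k=1..m-1. real k - (-x)\<bar> = fact m"
  proof -
    have "norm (z + of_nat k) = \<bar>real k - (-x)\<bar>" for k
      unfolding z by (metis (no_types) add.commute diff_minus_eq_add norm_of_real of_real_add of_real_of_nat_eq)
    with norm_prod_root[OF assms(1)] show ?thesis by (simp add: abs_prod)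
  qed
  moreover have "(fact (m - 1) :: real) < fact m" using assms(2) by (intro fact_less_mono) auto
  ultimately show False by simp
qed

lemma pderiv_chi_poly_root:
  assumes "chi m z = 0"
  shows "poly (pderiv (chi_poly m)) z = of_nat (fact m) * Hm m z"
  using assms chi_root_nonzero_factor[OF assms]
  by (subst pderiv_chi_poly) (auto simp: chi_root_iff)

definition chi_roots :: "nat \<Rightarrow> complex set" where
  "chi_roots m = {z. chi m z = 0}"

lemma chi_poly_nonzero: "m \<ge> 2 \<Longrightarrow> chi_poly m \<noteq> 0"
  using lead_coeff_chi_poly[of m] by auto

lemma finite_chi_roots: "m \<ge> 2 \<Longrightarrow> finite (chi_roots m)"
  unfolding chi_roots_def using poly_roots_finite[OF chi_poly_nonzero] by (simp add: poly_chi_poly)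

lemma chi_poly_factor:
  assumes "m \<ge> 2"
  shows "chi_poly m = (\<Prod>z\<in>chi_roots m. [:- z, 1:])"
proof -
  have "rsquarefree (chi_poly m)"
    using assms Hm_nonzero_at_root
    by (auto simp: rsquarefree_roots poly_chi_poly pderiv_chi_poly_root)
  then have o: "order z (chi_poly m) = 1" if "chi m z = 0" for z
  proof -
    have "order z (chi_poly m) \<noteq> 0"
      using that chi_poly_nonzero[OF assms] by (simp add: order_root flip: poly_chi_poly)
    moreover have "order z (chi_poly m) = 0 \<or> order z (chi_poly m) = 1"
      using \<open>rsquarefree (chi_poly m)\<close> by (auto simp: rsquarefree_def)
    ultimately show ?thesis by linarith
  qed
  have "chi_poly m = smult (lead_coeff (chi_poly m)) (\<Prod>z | poly (chi_poly m) z = 0. [:- z, 1:] ^ order z (chi_poly m))"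
    by (rule complex_poly_decompose[symmetric])
  also have "\<dots> = (\<Prod>z\<in>chi_roots m. [:- z, 1:])"
    using o assms by (auto simp: lead_coeff_chi_poly poly_chi_poly chi_roots_def intro!: prod.cong)
  finally show ?thesis .
qed

lemma card_chi_roots: "m \<ge> 2 \<Longrightarrow> card (chi_roots m) = m - 1"
  using degree_chi_poly[of m] chi_poly_factor[of m] degree_prod_linear[of uminus "chi_roots m"] by simp

text \<open>Comparing top coefficients in Lagrange's interpolation formula.\<close>
lemma sum_over_roots:
  fixes R :: "complex set" and p :: "complex poly"
  assumes "finite R" "degree p < card R"
  shows "(\<Sum>z\<in>R. poly p z / (\<Prod>w\<in>R-{z}. z - w)) = coeff p (card R - 1)"
proof -
  define L where "L = (\<Sum>z\<in>R. smult (poly p z / (\<Prod>w\<in>R-{z}. z - w)) (\<Prod>w\<in>R-{z}. [:-w, 1:]))"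
  have c: "card (R - {z}) = card R - 1" if "z \<in> R" for z using that assms(1) by simp
  have "degree L \<le> card R - 1"
    unfolding L_def
  proof (rule degree_sum_le[OF assms(1)])
    fix z assume "z \<in> R"
    then show "degree (smult (poly p z / (\<Prod>w\<in>R-{z}. z - w)) (\<Prod>w\<in>R-{z}. [:-w, 1:])) \<le> card R - 1"
      using degree_prod_linear[of uminus "R - {z}"] c by (metis degree_smult_le)
  qed
  then have dL: "degree L < card R" using assms by (cases "card R") auto
  have "poly L x = poly p x" if x: "x \<in> R" for x
  proof -
    have nz: "(\<Prod>w\<in>R-{x}. x - w) \<noteq> 0" using assms(1) by simp
    have "poly L x = (\<Sum>z\<in>R. (poly p z / (\<Prod>w\<in>R-{z}. z - w)) * (\<Prod>w\<in>R-{z}. x - w))"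
      by (simp add: L_def poly_sum poly_prod)
    also have "\<dots> = (\<Sum>z\<in>R. if z = x then poly p x else 0)"
      using assms(1) x nz by (intro sum.cong) (auto intro!: prod_zero)
    finally show ?thesis using x assms(1) by simp
  qed
  then have "p = L"
    by (intro poly_eqI_degree[of R]) (use assms dL in auto)
  then have "coeff p (card R - 1) = coeff L (card R - 1)" by simp
  also have "\<dots> = (\<Sum>z\<in>R. poly p z / (\<Prod>w\<in>R-{z}. z - w))"
    unfolding L_def coeff_sum
  proof (rule sum.cong[OF refl])
    fix z assume "z \<in> R"
    then have "coeff (\<Prod>w\<in>R-{z}. [:-w, 1:] :: complex poly) (card R - 1) = 1"
      using lead_coeff_prod_linear[of uminus "R - {z}"] degree_prod_linear[of uminus "R - {z}"] c by simp
    then show "coeff (smult (poly p z / (\<Prod>w\<in>R-{z}. z - w)) (\<Prod>w\<in>R-{z}. [:-w, 1:])) (card R - 1)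
        = poly p z / (\<Prod>w\<in>R-{z}. z - w)" by simp
  qed
  finally show ?thesis ..
qed

text \<open>Lagrange's denominators over the root set are the values of the derivative of
  \<open>chi_poly\<close>, which at a root are \<open>m! * Hm\<close>.\<close>

lemma sum_over_chi_roots:
  assumes "m \<ge> 2" "degree p < m - 1"
  shows "(\<Sum>z\<in>chi_roots m. poly p z / (of_nat (fact m) * Hm m z)) = coeff p (m - 2)"
proof -
  have "(\<Prod>w\<in>chi_roots m-{z}. z - w) = of_nat (fact m) * Hm m z" if z: "z \<in> chi_roots m" for z
  proof -
    have "pderiv (chi_poly m) = (\<Sum>w\<in>chi_roots m. \<Prod>v\<in>chi_roots m - {w}. [:-v, 1:])"
      by (subst chi_poly_factor[OF assms(1)]) (simp add: pderiv_prod pderiv_pCons)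
    then have "poly (pderiv (chi_poly m)) z = (\<Sum>w\<in>chi_roots m. \<Prod>v\<in>chi_roots m - {w}. z - v)"
      by (simp add: poly_sum poly_prod)
    also have "\<dots> = (\<Sum>w\<in>chi_roots m. if w = z then (\<Prod>v\<in>chi_roots m-{z}. z - v) else 0)"
      using finite_chi_roots[OF assms(1)] z by (intro sum.cong) (auto intro!: prod_zero)
    also have "\<dots> = (\<Prod>v\<in>chi_roots m-{z}. z - v)"
      using finite_chi_roots[OF assms(1)] z by simp
    finally show ?thesis using z by (simp add: pderiv_chi_poly_root chi_roots_def)
  qed
  then show ?thesis
    using sum_over_roots[of "chi_roots m" p] assms finite_chi_roots card_chi_roots
    by (simp add: numeral_2_eq_2 Suc_diff_Suc)
qed

section \<open>Expansion of a state over all roots\<close>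

definition ucoef :: "complex \<Rightarrow> nat \<Rightarrow> complex" where
  "ucoef z k = (z + of_nat k - 1) gchoose (k - 1)"

lemma u2_eq: "u2 m z x = (\<Sum>k=1..m-1. ucoef z k * of_nat (x k))"
  by (simp add: u2_def ucoef_def)

lemma ucoef_1 [simp]: "ucoef z (Suc 0) = 1"
  by (simp add: ucoef_def)

lemma gchoose_eq_prod: "(z + of_nat n) gchoose n = (\<Prod>i=1..n. z + of_nat i) / (fact n :: complex)"
proof -
  have "(\<Prod>i=0..<n. z + of_nat n - of_nat i) = (\<Prod>i=1..n. z + of_nat i)"
    by (intro prod.reindex_bij_witness[of _ "\<lambda>i. n - i" "\<lambda>i. n - i"]) (auto simp: of_nat_diff)
  then show ?thesis by (simp add: gbinomial_prod_rev)
qed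

lemma ucoef_eq_prod: "k \<ge> 1 \<Longrightarrow> ucoef z k = (\<Prod>i=1..k-1. z + of_nat i) / fact (k - 1)"
  using gchoose_eq_prod[of z "k - 1"] by (simp add: ucoef_def of_nat_diff algebra_simps)

text \<open>At a root, the product up to k in the denominator is \<open>m!\<close> divided by the
  complementary product. Each coordinate of \<open>v2\<close> thus becomes a polynomial in z over
  the Lagrange denominator.\<close>

lemma v2_eq_prod:
  assumes "chi m z = 0" "k \<in> {1..m-1}"
  shows "v2 m z k = fact (k - 1) * (\<Prod>i=k+1..m-1. z + of_nat i) / (of_nat (fact m) * Hm m z)"
proof -
  have nz: "(\<Prod>i=1..k. z + of_nat i) \<noteq> 0"
    using chi_root_nonzero_factor[OF assms(1)] assms(2) by auto
  have nz': "(\<Prod>i=k+1..m-1. z + of_nat i) \<noteq> 0"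
    using chi_root_nonzero_factor[OF assms(1)] assms(2) by auto
  have "{1..m-1} = {1..k} \<union> {k+1..m-1}" using assms(2) by auto
  then have "of_nat (fact m) = (\<Prod>i=1..k. z + of_nat i) * (\<Prod>i=k+1..m-1. z + of_nat i)"
    using assms(1) by (simp add: chi_root_iff prod.union_disjoint)
  moreover have "(fact k :: complex) = of_nat k * fact (k - 1)"
    using assms(2) by (simp add: fact_reduce)
  ultimately show ?thesis
    using nz nz' assms(2) unfolding v2_def gchoose_eq_prod
    by (simp add: field_simps)
qed

text \<open>At the root \<open>1\<close> the general pair \<open>u2\<close>, \<open>v2\<close>
  specialises to \<open>u1\<close>, \<open>v1\<close>, so that one expansion over the roots covers
  the leading term too.\<close>

lemma v2_1: "m \<ge> 2 \<Longrightarrow> v2 m 1 k = of_real (v1 m k)"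
proof -
  assume "m \<ge> 2"
  have "(1 + of_nat k) gchoose k = (1 + of_nat k :: complex)"
  proof -
    have "((of_nat (Suc k) :: complex) gchoose k) = of_nat (Suc k choose k)" 
      by (simp only: binomial_gbinomial)
    then show ?thesis by simp
  qed
  moreover have "Hm m 1 = of_real (Re (Hm m 1))"
    by (simp add: Hm_def complex_eq_iff Im_divide)
  ultimately show ?thesis
    unfolding v2_def v1_def by (simp add: add.commute)
qed

lemma u2_1: "u2 m 1 x = of_real (u1 m x)"
proof -
  have "ucoef 1 k = of_nat k" if "k \<ge> 1" for k
  proof -
    obtain j where k: "k = Suc j" using \<open>k \<ge> 1\<close> by (cases k) auto
    have "((of_nat (Suc j) :: complex) gchoose j) = of_nat (Suc j choose j)" 
      by (simp only: binomial_gbinomial)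
    then show ?thesis by (simp add: ucoef_def k add.commute)
  qed
  then show ?thesis unfolding u2_eq u1_def by simp
qed

text \<open>The summands are polynomials over Lagrange denominators, so the sum is a coefficient of
  index \<open>m - 2\<close>. For \<open>j \<le> k\<close> the polynomial has degree
  \<open>m - 2 - (k - j)\<close>, which reaches \<open>m - 2\<close> only at \<open>j = k\<close>.
  For \<open>j > k\<close> the two index ranges overlap and the root equation replaces a full
  product by \<open>m!\<close>, which lowers the degree below \<open>m - 2\<close>.\<close>

lemma spectral_biorthogonality:
  assumes "m \<ge> 2" "j \<in> {1..m-1}" "k \<in> {1..m-1}"
  shows "(\<Sum>z\<in>chi_roots m. ucoef z j * v2 m z k) = (if j = k then 1 else 0)"
proof -
  define f where "f I = (\<Prod>i\<in>I. [:of_nat i, 1:] :: complex poly)" for I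
  have pf: "poly (f I) z = (\<Prod>i\<in>I. z + of_nat i)" for I z
    by (simp add: f_def poly_prod add.commute)
  have df: "degree (f I) = card I" for I by (simp add: f_def degree_prod_linear)
  define c :: complex where "c = fact (k - 1) / fact (j - 1)"
  have eq: "(\<Sum>z\<in>chi_roots m. ucoef z j * v2 m z k) = coeff p (m - 2)"
    if "degree p < m - 1" "\<And>z. chi m z = 0 \<Longrightarrow>
       poly p z = c * ((\<Prod>i=1..j-1. z + of_nat i) * (\<Prod>i=k+1..m-1. z + of_nat i))" for p
  proof -
    have "(\<Sum>z\<in>chi_roots m. ucoef z j * v2 m z k) = (\<Sum>z\<in>chi_roots m. poly p z / (of_nat (fact m) * Hm m z))"
      using assms(2,3) that(2) by (intro sum.cong) (auto simp: ucoef_eq_prod v2_eq_prod chi_roots_def c_def)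
    then show ?thesis using sum_over_chi_roots[OF assms(1) that(1)] by simp
  qed
  show ?thesis
  proof (cases "j \<le> k")
    case True
    define p where "p = smult c (f ({1..j-1} \<union> {k+1..m-1}))"
    have card: "card ({1..j-1} \<union> {k+1..m-1}) = (j - 1) + (m - 1 - k)"
      using True by (subst card_Un_disjoint) auto
    have "c \<noteq> 0" by (simp add: c_def)
    then have dp: "degree p = (j - 1) + (m - 1 - k)"
      unfolding p_def using card by (simp add: df)
    have "(\<Sum>z\<in>chi_roots m. ucoef z j * v2 m z k) = coeff p (m - 2)"
    proof (rule eq)
      show "degree p < m - 1" using dp True assms by auto
      show "poly p z = c * ((\<Prod>i=1..j-1. z + of_nat i) * (\<Prod>i=k+1..m-1. z + of_nat i))" for z
        unfolding p_def poly_smult pf using True by (subst prod.union_disjoint) auto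
    qed
    also have "\<dots> = (if j = k then 1 else 0)"
    proof (cases "j = k")
      case True
      then have "m - 2 = degree p" using dp assms by auto
      moreover have "lead_coeff p = 1" unfolding p_def f_def
        using True by (simp add: lead_coeff_smult lead_coeff_prod_linear c_def)
      ultimately show ?thesis using True by simp
    next
      case False
      then have "degree p < m - 2" using dp assms True by auto
      then show ?thesis using False by (simp add: coeff_eq_0)
    qed
    finally show ?thesis .
  next
    case False
    define p where "p = smult (c * of_nat (fact m)) (f {k+1..j-1})"
    have dp: "degree p \<le> j - 1 - k" unfolding p_def using df[of "{k+1..j-1}"] by simp
    have "(\<Sum>z\<in>chi_roots m. ucoef z j * v2 m z k) = coeff p (m - 2)"
    proof (rule eq)
      show "degree p < m - 1" using dp False assms by auto
      fix z assume z: "chi m z = 0"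
      have e1: "{1..j-1} = {1..k} \<union> {k+1..j-1}" and e2: "{1..m-1} = {1..k} \<union> {k+1..m-1}"
        using False assms by auto
      have "(\<Prod>i=1..j-1. z + of_nat i) = (\<Prod>i=1..k. z + of_nat i) * (\<Prod>i=k+1..j-1. z + of_nat i)"
        by (subst e1, subst prod.union_disjoint) auto
      moreover have "of_nat (fact m) = (\<Prod>i=1..k. z + of_nat i) * (\<Prod>i=k+1..m-1. z + of_nat i)"
        using z unfolding chi_root_iff by (subst (asm) e2, subst (asm) prod.union_disjoint) auto
      ultimately show "poly p z = c * ((\<Prod>i=1..j-1. z + of_nat i) * (\<Prod>i=k+1..m-1. z + of_nat i))"
        unfolding p_def poly_smult pf by (simp add: mult_ac)
    qed
    also have "\<dots> = 0" using dp False assms by (intro coeff_eq_0) auto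
    finally show ?thesis using False by simp
  qed
qed

lemma spectral_decomposition:
  assumes "m \<ge> 2" "k \<in> {1..m-1}"
  shows "(\<Sum>z\<in>chi_roots m. u2 m z x * v2 m z k) = of_nat (x k)"
proof -
  have "(\<Sum>z\<in>chi_roots m. u2 m z x * v2 m z k) =
        (\<Sum>z\<in>chi_roots m. \<Sum>j=1..m-1. of_nat (x j) * (ucoef z j * v2 m z k))"
    by (simp add: u2_eq sum_distrib_left mult_ac)
  also have "\<dots> = (\<Sum>j=1..m-1. of_nat (x j) * (\<Sum>z\<in>chi_roots m. ucoef z j * v2 m z k))"
    by (subst sum.swap) (simp add: sum_distrib_left)
  also have "\<dots> = (\<Sum>j=1..m-1. if j = k then of_nat (x j) else 0)"
    using assms by (intro sum.cong) (auto simp: spectral_biorthogonality)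
  finally show ?thesis using assms(2) by simp
qed

section \<open>Moments and almost sure convergence\<close>

text \<open>The class of dominating variables: it is closed under sums, products and powers with
  exponent in \<open>[0, 1]\<close>, from which the final bound is assembled.\<close>

definition all_moments :: "'a measure \<Rightarrow> ('a \<Rightarrow> real) \<Rightarrow> bool" where
  "all_moments M f \<longleftrightarrow> f \<in> borel_measurable M \<and> (\<forall>n::nat. integrable M (\<lambda>\<omega>. \<bar>f \<omega>\<bar> ^ n))"

lemma all_moments_bound:
  assumes "all_moments M f" "g \<in> borel_measurable M" "AE \<omega> in M. \<bar>g \<omega>\<bar> \<le> f \<omega>"
  shows "all_moments M g"
  unfolding all_moments_def
proof (intro conjI allI assms(2))
  fix n :: nat
  show "integrable M (\<lambda>\<omega>. \<bar>g \<omega>\<bar> ^ n)"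
  proof (rule Bochner_Integration.integrable_bound)
    show "integrable M (\<lambda>\<omega>. \<bar>f \<omega>\<bar> ^ n)" using assms(1) by (simp add: all_moments_def)
    show "(\<lambda>\<omega>. \<bar>g \<omega>\<bar> ^ n) \<in> borel_measurable M" using assms(2) by measurable
    show "AE \<omega> in M. norm (\<bar>g \<omega>\<bar> ^ n) \<le> norm (\<bar>f \<omega>\<bar> ^ n)"
      using assms(3) by eventually_elim (unfold real_norm_def, subst (1 2) abs_of_nonneg, auto intro!: power_mono)
  qed
qed

lemma all_moments_abs: "all_moments M f \<Longrightarrow> all_moments M (\<lambda>\<omega>. \<bar>f \<omega>\<bar>)"
  by (auto simp: all_moments_def)

lemma all_moments_mult:
  assumes "all_moments M f" "all_moments M g"
  shows "all_moments M (\<lambda>\<omega>. f \<omega> * g \<omega>)"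
  unfolding all_moments_def
proof (intro conjI allI)
  have [measurable]: "f \<in> borel_measurable M" "g \<in> borel_measurable M"
    using assms by (auto simp: all_moments_def)
  show "(\<lambda>\<omega>. f \<omega> * g \<omega>) \<in> borel_measurable M" by measurable
  fix n :: nat
  show "integrable M (\<lambda>\<omega>. \<bar>f \<omega> * g \<omega>\<bar> ^ n)"
  proof (rule Bochner_Integration.integrable_bound)
    show "integrable M (\<lambda>\<omega>. \<bar>f \<omega>\<bar> ^ (2 * n) + \<bar>g \<omega>\<bar> ^ (2 * n))"
      using assms unfolding all_moments_def by (intro Bochner_Integration.integrable_add) auto
    show "(\<lambda>\<omega>. \<bar>f \<omega> * g \<omega>\<bar> ^ n) \<in> borel_measurable M" by measurable
    have "\<bar>a * b\<bar> ^ n \<le> \<bar>a\<bar> ^ (2 * n) + \<bar>b\<bar> ^ (2 * n)" for a b :: real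
    proof -
      have "2 * (\<bar>a\<bar> ^ n * \<bar>b\<bar> ^ n) \<le> (\<bar>a\<bar> ^ n)\<^sup>2 + (\<bar>b\<bar> ^ n)\<^sup>2"
        using sum_squares_bound[of "\<bar>a\<bar> ^ n" "\<bar>b\<bar> ^ n"] by simp
      moreover have "0 \<le> \<bar>a\<bar> ^ n * \<bar>b\<bar> ^ n" by simp
      ultimately have "\<bar>a\<bar> ^ n * \<bar>b\<bar> ^ n \<le> (\<bar>a\<bar> ^ n)\<^sup>2 + (\<bar>b\<bar> ^ n)\<^sup>2" by linarith
      then show ?thesis
        by (simp add: abs_mult power_mult_distrib power_even_eq)
    qed
    then show "AE \<omega> in M. norm (\<bar>f \<omega> * g \<omega>\<bar> ^ n) \<le> norm (\<bar>f \<omega>\<bar> ^ (2 * n) + \<bar>g \<omega>\<bar> ^ (2 * n))"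
      by (intro AE_I2) (simp add: abs_of_nonneg del: abs_mult)
  qed
qed

lemma all_moments_add:
  assumes "all_moments M f" "all_moments M g"
  shows "all_moments M (\<lambda>\<omega>. f \<omega> + g \<omega>)"
  unfolding all_moments_def
proof (intro conjI allI)
  have [measurable]: "f \<in> borel_measurable M" "g \<in> borel_measurable M"
    using assms by (auto simp: all_moments_def)
  show "(\<lambda>\<omega>. f \<omega> + g \<omega>) \<in> borel_measurable M" by measurable
  fix n :: nat
  show "integrable M (\<lambda>\<omega>. \<bar>f \<omega> + g \<omega>\<bar> ^ n)"
  proof (rule Bochner_Integration.integrable_bound)
    show "integrable M (\<lambda>\<omega>. 2 ^ n * (\<bar>f \<omega>\<bar> ^ n + \<bar>g \<omega>\<bar> ^ n))"
      using assms unfolding all_moments_def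
      by (intro Bochner_Integration.integrable_add integrable_mult_right) auto
    show "(\<lambda>\<omega>. \<bar>f \<omega> + g \<omega>\<bar> ^ n) \<in> borel_measurable M" by measurable
    have "\<bar>a + b\<bar> ^ n \<le> 2 ^ n * (\<bar>a\<bar> ^ n + \<bar>b\<bar> ^ n)" for a b :: real
    proof -
      have "\<bar>a + b\<bar> ^ n \<le> (2 * max \<bar>a\<bar> \<bar>b\<bar>) ^ n" by (intro power_mono) auto
      also have "\<dots> = 2 ^ n * max \<bar>a\<bar> \<bar>b\<bar> ^ n" by (simp add: power_mult_distrib)
      also have "max \<bar>a\<bar> \<bar>b\<bar> ^ n \<le> \<bar>a\<bar> ^ n + \<bar>b\<bar> ^ n" by (auto simp: max_def)
      finally show ?thesis by simp
    qed
    then show "AE \<omega> in M. norm (\<bar>f \<omega> + g \<omega>\<bar> ^ n) \<le> norm (2 ^ n * (\<bar>f \<omega>\<bar> ^ n + \<bar>g \<omega>\<bar> ^ n))"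
      by (intro AE_I2) (simp add: abs_of_nonneg)
  qed
qed

lemma (in prob_space) all_moments_const: "all_moments M (\<lambda>_. c)"
  by (simp add: all_moments_def)

text \<open>On a probability space high even powers control all lower ones; the threshold
  \<open>q0\<close> is there because moments of a sequence become summable only for large
  \<open>q\<close>.\<close>

lemma (in prob_space) all_momentsI_even:
  assumes [measurable]: "f \<in> borel_measurable M"
    and "\<And>q. q \<ge> q0 \<Longrightarrow> integrable M (\<lambda>\<omega>. f \<omega> ^ (2 * q))"
  shows "all_moments M f"
  unfolding all_moments_def
proof (intro conjI allI assms(1))
  fix n :: nat
  define q where "q = max q0 n"
  show "integrable M (\<lambda>\<omega>. \<bar>f \<omega>\<bar> ^ n)"
  proof (rule Bochner_Integration.integrable_bound)
    show "integrable M (\<lambda>\<omega>. 1 + f \<omega> ^ (2 * q))"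
      by (intro Bochner_Integration.integrable_add assms) (auto simp: q_def)
    have "\<bar>a\<bar> ^ n \<le> 1 + a ^ (2 * q)" for a :: real
    proof (cases "\<bar>a\<bar> \<le> 1")
      case True
      then have "\<bar>a\<bar> ^ n \<le> 1" by (intro power_le_one) auto
      then show ?thesis by (simp add: add_increasing2 power_mult)
    next
      case False
      then have "\<bar>a\<bar> ^ n \<le> \<bar>a\<bar> ^ (2 * q)" by (intro power_increasing) (auto simp: q_def)
      then show ?thesis by (simp add: power_mult)
    qed
    then show "AE \<omega> in M. norm (\<bar>f \<omega>\<bar> ^ n) \<le> norm (1 + f \<omega> ^ (2 * q))"
      by (intro AE_I2) (auto simp: power_mult add_nonneg_nonneg)
  qed measurable
qed

lemma (in prob_space) all_moments_powr:
  assumes "all_moments M f" "0 \<le> s" "s \<le> 1"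
  shows "all_moments M (\<lambda>\<omega>. \<bar>f \<omega>\<bar> powr s)"
proof (rule all_moments_bound)
  have [measurable]: "f \<in> borel_measurable M" using assms by (auto simp: all_moments_def)
  show "all_moments M (\<lambda>\<omega>. 1 + \<bar>f \<omega>\<bar>)"
    by (intro all_moments_add all_moments_const all_moments_abs assms)
  show "(\<lambda>\<omega>. \<bar>f \<omega>\<bar> powr s) \<in> borel_measurable M" by measurable
  have "x powr s \<le> 1 + x" if "x \<ge> 0" for x :: real
  proof (cases "x \<le> 1")
    case True
    then have "x powr s \<le> 1" using that assms by (intro powr_le1) auto
    then show ?thesis using that by simp
  next
    case False
    then have "x powr s \<le> x powr 1" using assms by (intro powr_mono) auto
    then show ?thesis using False by simp
  qed
  then show "AE \<omega> in M. \<bar>\<bar>f \<omega>\<bar> powr s\<bar> \<le> 1 + \<bar>f \<omega>\<bar>" by simp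
qed

lemma (in prob_space) all_moments_integrable_powr:
  assumes "all_moments M f" "p \<ge> 0"
  shows "integrable M (\<lambda>\<omega>. \<bar>f \<omega>\<bar> powr p)"
proof (rule Bochner_Integration.integrable_bound)
  have [measurable]: "f \<in> borel_measurable M" using assms by (auto simp: all_moments_def)
  define n where "n = nat \<lceil>p\<rceil>"
  show "integrable M (\<lambda>\<omega>. 1 + \<bar>f \<omega>\<bar> ^ n)"
    using assms by (intro Bochner_Integration.integrable_add) (auto simp: all_moments_def)
  show "(\<lambda>\<omega>. \<bar>f \<omega>\<bar> powr p) \<in> borel_measurable M" by measurable
  have "x powr p \<le> 1 + x ^ n" if "x \<ge> 0" for x :: real
  proof (cases "x \<le> 1")
    case True
    then have "x powr p \<le> 1" using that assms by (intro powr_le1) auto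
    then show ?thesis using that by (simp add: add_increasing2)
  next
    case False
    then have "x powr p \<le> x powr real n" unfolding n_def by (intro powr_mono) (auto, linarith)
    then show ?thesis using False by (simp add: powr_realpow)
  qed
  then show "AE \<omega> in M. norm (\<bar>f \<omega>\<bar> powr p) \<le> norm (1 + \<bar>f \<omega>\<bar> ^ n)"
    by (intro AE_I2) (simp add: add_nonneg_nonneg)
qed

text \<open>A limit at real infinity is tested along sequences, where dominated convergence applies;
  one \<open>D\<close> with all moments serves every p.\<close>

lemma (in prob_space) tendsto_nn_integral_powr:
  fixes R :: "real \<Rightarrow> 'a \<Rightarrow> real"
  assumes [measurable]: "\<And>t. R t \<in> borel_measurable M"
    and lim: "AE \<omega> in M. ((\<lambda>t. R t \<omega>) \<longlongrightarrow> 0) at_top"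
    and dom: "AE \<omega> in M. \<forall>t. \<bar>R t \<omega>\<bar> \<le> D \<omega>" and D: "all_moments M D" and p: "p \<ge> 1"
  shows "((\<lambda>t. \<integral>\<^sup>+\<omega>. ennreal (\<bar>R t \<omega>\<bar> powr p) \<partial>M) \<longlongrightarrow> 0) at_top"
proof (rule tendsto_at_topI_sequentially)
  fix X :: "nat \<Rightarrow> real" assume X: "filterlim X at_top sequentially"
  have [measurable]: "D \<in> borel_measurable M" using D by (auto simp: all_moments_def)
  have "(\<lambda>n. \<integral>\<^sup>+\<omega>. ennreal (\<bar>R (X n) \<omega>\<bar> powr p) \<partial>M) \<longlonglongrightarrow> (\<integral>\<^sup>+\<omega>. 0 \<partial>M)"
  proof (rule nn_integral_dominated_convergence[where w = "\<lambda>\<omega>. ennreal (\<bar>D \<omega>\<bar> powr p)"])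
    fix n
    show "AE \<omega> in M. ennreal (\<bar>R (X n) \<omega>\<bar> powr p) \<le> ennreal (\<bar>D \<omega>\<bar> powr p)"
      using dom
    proof eventually_elim
      case (elim \<omega>)
      then have "\<bar>R (X n) \<omega>\<bar> \<le> D \<omega>" by blast
      then show ?case using p by (intro ennreal_leI powr_mono2) auto
    qed
  next
    have "integrable M (\<lambda>\<omega>. \<bar>D \<omega>\<bar> powr p)" using D p by (intro all_moments_integrable_powr) auto
    then show "(\<integral>\<^sup>+\<omega>. ennreal (\<bar>D \<omega>\<bar> powr p) \<partial>M) < \<infinity>"
      by (subst nn_integral_eq_integral) auto
  next
    show "AE \<omega> in M. (\<lambda>n. ennreal (\<bar>R (X n) \<omega>\<bar> powr p)) \<longlonglongrightarrow> 0"
      using lim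
    proof eventually_elim
      case (elim \<omega>)
      then have "(\<lambda>n. \<bar>R (X n) \<omega>\<bar>) \<longlonglongrightarrow> 0"
        using X by (intro tendsto_rabs_zero) (rule filterlim_compose)
      then have "(\<lambda>n. \<bar>R (X n) \<omega>\<bar> powr p) \<longlonglongrightarrow> 0 powr p"
        using p by (intro tendsto_powr') auto
      then show ?case using tendsto_ennrealI by fastforce
    qed
  qed auto
  then show "(\<lambda>n. \<integral>\<^sup>+\<omega>. ennreal (\<bar>R (X n) \<omega>\<bar> powr p) \<partial>M) \<longlonglongrightarrow> 0" by simp
qed

section \<open>From exponential moments to rates and almost sure limits\<close>

lemma power_le_fact_exp:
  fixes x :: real
  assumes "x \<ge> 0"
  shows "x ^ n \<le> fact n * exp x"
proof -
  have "(\<Sum>k\<in>{n}. inverse (fact k) * x ^ k) \<le> (\<Sum>k. inverse (fact k) * x ^ k)"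
    using assms by (intro sum_le_suminf summable_exp) auto
  then have "x ^ n / fact n \<le> exp x" by (simp add: exp_def field_simps)
  then show ?thesis by (simp add: field_simps)
qed

lemma power_even_le_exp:
  fixes x s :: real
  assumes "s > 0"
  shows "x ^ (2 * q) \<le> fact (2 * q) / s ^ (2 * q) * (exp (s * x) + exp (- s * x))"
proof -
  have "(s * x) ^ (2 * q) = \<bar>s * x\<bar> ^ (2 * q)" by (simp add: power_even_abs)
  also have "\<dots> \<le> fact (2 * q) * exp \<bar>s * x\<bar>" by (intro power_le_fact_exp) auto
  also have "exp \<bar>s * x\<bar> \<le> exp (s * x) + exp (- s * x)" by (auto simp: abs_if)
  finally have "(s * x) ^ (2 * q) \<le> fact (2 * q) * (exp (s * x) + exp (- s * x))" by simp
  then show ?thesis using assms by (simp add: power_mult_distrib field_simps)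
qed

text \<open>One exponential bound at the scale s controls all even moments at once, with
  \<open>s ^ (2 * q)\<close> in the denominator; taking s as a power of n turns it into a
  rate.\<close>

lemma (in prob_space) moment_le_of_mgf:
  fixes Z :: "'a \<Rightarrow> real"
  assumes [measurable]: "Z \<in> borel_measurable M" and "s > 0"
    and "integrable M (\<lambda>\<omega>. exp (s * Z \<omega>))" "integrable M (\<lambda>\<omega>. exp (- s * Z \<omega>))"
    and "expectation (\<lambda>\<omega>. exp (s * Z \<omega>)) \<le> K" "expectation (\<lambda>\<omega>. exp (- s * Z \<omega>)) \<le> K"
  shows "integrable M (\<lambda>\<omega>. Z \<omega> ^ (2 * q))"
    and "expectation (\<lambda>\<omega>. Z \<omega> ^ (2 * q)) \<le> 2 * K * fact (2 * q) / s ^ (2 * q)"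
proof -
  define c where "c = fact (2 * q) / s ^ (2 * q)"
  have c: "c \<ge> 0" using assms by (simp add: c_def)
  have i: "integrable M (\<lambda>\<omega>. c * (exp (s * Z \<omega>) + exp (- s * Z \<omega>)))"
    using assms by (intro integrable_mult_right Bochner_Integration.integrable_add)
  show I: "integrable M (\<lambda>\<omega>. Z \<omega> ^ (2 * q))"
  proof (rule Bochner_Integration.integrable_bound[OF i])
    have "norm (Z \<omega> ^ (2 * q)) \<le> norm (c * (exp (s * Z \<omega>) + exp (- s * Z \<omega>)))" for \<omega>
      using power_even_le_exp[of s "Z \<omega>" q] assms(2) c
      by (subst (1 2) real_norm_def, subst (1 2) abs_of_nonneg) (auto simp: power_mult c_def)
    then show "AE \<omega> in M. norm (Z \<omega> ^ (2 * q)) \<le> norm (c * (exp (s * Z \<omega>) + exp (- s * Z \<omega>)))" by simp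
  qed measurable
  have "expectation (\<lambda>\<omega>. Z \<omega> ^ (2 * q)) \<le> expectation (\<lambda>\<omega>. c * (exp (s * Z \<omega>) + exp (- s * Z \<omega>)))"
    using power_even_le_exp[of s _ q] assms(2) by (intro integral_mono I i) (auto simp: c_def)
  also have "\<dots> = c * (expectation (\<lambda>\<omega>. exp (s * Z \<omega>)) + expectation (\<lambda>\<omega>. exp (- s * Z \<omega>)))"
    using assms by (subst Bochner_Integration.integral_mult_right_zero, subst Bochner_Integration.integral_add) auto
  also have "\<dots> \<le> c * (K + K)" using assms c by (intro mult_left_mono) auto
  finally show "expectation (\<lambda>\<omega>. Z \<omega> ^ (2 * q)) \<le> 2 * K * fact (2 * q) / s ^ (2 * q)"
    by (simp add: c_def field_simps)
qed

lemma cmod_power_even_le: "cmod z ^ (2 * q) \<le> 2 ^ q * (Re z ^ (2 * q) + Im z ^ (2 * q))"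
proof -
  define a b where "a = (Re z)\<^sup>2" and "b = (Im z)\<^sup>2"
  have ab: "a \<ge> 0" "b \<ge> 0" by (auto simp: a_def b_def)
  have "cmod z ^ (2 * q) = (a + b) ^ q" by (simp add: power_mult cmod_power2 a_def b_def)
  also have "\<dots> \<le> (2 * max a b) ^ q" using ab by (intro power_mono) auto
  also have "\<dots> = 2 ^ q * max a b ^ q" by (simp add: power_mult_distrib)
  also have "max a b ^ q \<le> a ^ q + b ^ q" using ab by (auto simp: max_def)
  finally show ?thesis by (simp add: a_def b_def power_mult)
qed

lemma (in prob_space) cmod_moment_le_of_mgf:
  fixes Z :: "'a \<Rightarrow> complex"
  assumes [measurable]: "Z \<in> borel_measurable M" and "s > 0"
    and i: "\<And>\<alpha>. cmod \<alpha> = s \<Longrightarrow> integrable M (\<lambda>\<omega>. exp (Re (\<alpha> * Z \<omega>)))"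
    and K: "\<And>\<alpha>. cmod \<alpha> = s \<Longrightarrow> expectation (\<lambda>\<omega>. exp (Re (\<alpha> * Z \<omega>))) \<le> K"
  shows "integrable M (\<lambda>\<omega>. cmod (Z \<omega>) ^ (2 * q))"
    and "expectation (\<lambda>\<omega>. cmod (Z \<omega>) ^ (2 * q)) \<le> 4 * 2 ^ q * K * fact (2 * q) / s ^ (2 * q)"
proof -
  \<comment> \<open>These four multipliers turn \<open>Re (\<alpha> * Z)\<close> into
    \<open>s * Re Z\<close>, \<open>- s * Re Z\<close>, \<open>s * Im Z\<close> and
    \<open>- s * Im Z\<close>.\<close>
  have n: "cmod (of_real s) = s" "cmod (- of_real s) = s" "cmod (- \<i> * of_real s) = s" "cmod (\<i> * of_real s) = s"
    using assms(2) by (auto simp: norm_mult)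
  note RE = moment_le_of_mgf[of "\<lambda>\<omega>. Re (Z \<omega>)" s K q]
  note IM = moment_le_of_mgf[of "\<lambda>\<omega>. Im (Z \<omega>)" s K q]
  have RE1: "integrable M (\<lambda>\<omega>. Re (Z \<omega>) ^ (2 * q))" 
    and RE2: "expectation (\<lambda>\<omega>. Re (Z \<omega>) ^ (2 * q)) \<le> 2 * K * fact (2 * q) / s ^ (2 * q)"
    using RE i[OF n(1)] i[OF n(2)] K[OF n(1)] K[OF n(2)] assms(2) by auto
  have IM1: "integrable M (\<lambda>\<omega>. Im (Z \<omega>) ^ (2 * q))" 
    and IM2: "expectation (\<lambda>\<omega>. Im (Z \<omega>) ^ (2 * q)) \<le> 2 * K * fact (2 * q) / s ^ (2 * q)"
    using IM i[OF n(3)] i[OF n(4)] K[OF n(3)] K[OF n(4)] assms(2) by auto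
  have i': "integrable M (\<lambda>\<omega>. 2 ^ q * (Re (Z \<omega>) ^ (2 * q) + Im (Z \<omega>) ^ (2 * q)))"
    using RE1 IM1 by simp
  show I: "integrable M (\<lambda>\<omega>. cmod (Z \<omega>) ^ (2 * q))"
  proof (rule Bochner_Integration.integrable_bound[OF i'])
    show "AE \<omega> in M. norm (cmod (Z \<omega>) ^ (2 * q)) \<le> norm (2 ^ q * (Re (Z \<omega>) ^ (2 * q) + Im (Z \<omega>) ^ (2 * q)))"
      using cmod_power_even_le[of _ q] by (intro AE_I2) (auto intro: order_trans[OF _ abs_ge_self])
  qed measurable
  have "expectation (\<lambda>\<omega>. cmod (Z \<omega>) ^ (2 * q)) \<le>
        expectation (\<lambda>\<omega>. 2 ^ q * (Re (Z \<omega>) ^ (2 * q) + Im (Z \<omega>) ^ (2 * q)))"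
    by (intro integral_mono I i' cmod_power_even_le)
  also have "\<dots> = 2 ^ q * (expectation (\<lambda>\<omega>. Re (Z \<omega>) ^ (2 * q)) + expectation (\<lambda>\<omega>. Im (Z \<omega>) ^ (2 * q)))"
    using RE1 IM1 by simp
  also have "\<dots> \<le> 2 ^ q * (2 * K * fact (2 * q) / s ^ (2 * q) + 2 * K * fact (2 * q) / s ^ (2 * q))"
    using RE2 IM2 by (intro mult_left_mono add_mono) auto
  finally show "expectation (\<lambda>\<omega>. cmod (Z \<omega>) ^ (2 * q)) \<le> 4 * 2 ^ q * K * fact (2 * q) / s ^ (2 * q)"
    by (simp add: field_simps)
qed

text \<open>Says that \<open>a n\<close> is of order \<open>n\<close> to the power
  \<open>- \<beta> / 2\<close> in every \<open>L^p\<close>; the index \<open>n + 1\<close> avoids a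
  negative power of zero.\<close>

definition moments_decay :: "'a measure \<Rightarrow> real \<Rightarrow> (nat \<Rightarrow> 'a \<Rightarrow> real) \<Rightarrow> bool" where
  "moments_decay M \<beta> a \<longleftrightarrow> (\<forall>n. a n \<in> borel_measurable M) \<and>
     (\<forall>q. \<exists>C. \<forall>n. integrable M (\<lambda>\<omega>. a n \<omega> ^ (2 * q)) \<and>
        (\<integral>\<omega>. a n \<omega> ^ (2 * q) \<partial>M) \<le> C * real (n + 1) powr (- (\<beta> * real q)))"

lemma AE_summable_of_summable_integral:
  fixes f :: "nat \<Rightarrow> 'a \<Rightarrow> real"
  assumes int: "\<And>n. integrable M (f n)" and nn: "\<And>n \<omega>. f n \<omega> \<ge> 0"
    and sm: "summable (\<lambda>n. \<integral>\<omega>. f n \<omega> \<partial>M)"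
  shows "AE \<omega> in M. summable (\<lambda>n. f n \<omega>)"
    and "(\<integral>\<^sup>+\<omega>. (\<Sum>n. ennreal (f n \<omega>)) \<partial>M) < \<infinity>"
proof -
  have [measurable]: "f n \<in> borel_measurable M" for n using int[of n] by auto
  have "(\<integral>\<^sup>+\<omega>. (\<Sum>n. ennreal (f n \<omega>)) \<partial>M) = (\<Sum>n. \<integral>\<^sup>+\<omega>. ennreal (f n \<omega>) \<partial>M)"
    by (intro nn_integral_suminf) measurable
  also have "\<dots> = (\<Sum>n. ennreal (\<integral>\<omega>. f n \<omega> \<partial>M))"
    using int nn by (intro suminf_cong nn_integral_eq_integral) auto
  also have "\<dots> < \<infinity>"
    using sm nn by (subst suminf_ennreal2) (auto intro!: integral_nonneg_AE)
  finally show fin: "(\<integral>\<^sup>+\<omega>. (\<Sum>n. ennreal (f n \<omega>)) \<partial>M) < \<infinity>" .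
  have "AE \<omega> in M. (\<Sum>n. ennreal (f n \<omega>)) \<noteq> \<infinity>"
    using fin by (intro nn_integral_PInf_AE) auto
  then show "AE \<omega> in M. summable (\<lambda>n. f n \<omega>)"
    by eventually_elim (use nn in \<open>auto intro!: summable_suminf_not_top\<close>)
qed

lemma summable_decay: "e > 1 \<Longrightarrow> summable (\<lambda>n. C * real (n + 1) powr (- e))"
proof -
  assume "e > 1"
  then have "summable (\<lambda>n. real n powr (- e))" by (simp add: summable_real_powr_iff)
  then have "summable (\<lambda>n. real (n + 1) powr (- e))" by (subst summable_iff_shift)
  then show ?thesis by (rule summable_mult)
qed

text \<open>High moments summable in \<open>n\<close> replace both the Borel--Cantelli lemma and a maximal inequality.\<close>
lemma (in prob_space) moments_decay_imp_dominated:
  assumes dec: "moments_decay M \<beta> a" and "\<beta> > 0"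
  shows "AE \<omega> in M. (\<lambda>n. a n \<omega>) \<longlonglongrightarrow> 0"
    and "\<exists>D. all_moments M D \<and> (AE \<omega> in M. \<forall>n. \<bar>a n \<omega>\<bar> \<le> D \<omega>)"
proof -
  have [measurable]: "a n \<in> borel_measurable M" for n using dec by (auto simp: moments_decay_def)
  \<comment> \<open>Makes \<open>\<beta> * q \<ge> 2\<close>, so that the moment bounds of order
    \<open>2 * q\<close> are summable in n.\<close>
  define q0 where "q0 = nat \<lceil>2 / \<beta>\<rceil>"
  have q0: "\<beta> * real q > 1 \<and> q > 0" if "q \<ge> q0" for q
  proof -
    have "2 / \<beta> \<le> real q0" unfolding q0_def by linarith
    also have "\<dots> \<le> real q" using that by simp
    finally have "2 \<le> \<beta> * real q" using \<open>\<beta> > 0\<close> by (simp add: field_simps)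
    then show ?thesis by (cases q) auto
  qed
  have int: "integrable M (\<lambda>\<omega>. a n \<omega> ^ (2 * q))" for n q
    using dec unfolding moments_decay_def by blast
  have sm: "summable (\<lambda>n. \<integral>\<omega>. a n \<omega> ^ (2 * q) \<partial>M)" if "q \<ge> q0" for q
  proof -
    obtain C where C: "\<And>n. (\<integral>\<omega>. a n \<omega> ^ (2 * q) \<partial>M) \<le> C * real (n + 1) powr (- (\<beta> * real q))"
      using dec unfolding moments_decay_def by blast
    show ?thesis
    proof (rule summable_comparison_test)
      show "summable (\<lambda>n. C * real (n + 1) powr (- (\<beta> * real q)))"
        using q0[OF that] by (intro summable_decay) auto
      show "\<exists>N. \<forall>n\<ge>N. norm (\<integral>\<omega>. a n \<omega> ^ (2 * q) \<partial>M) \<le> C * real (n + 1) powr (- (\<beta> * real q))"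
        using C by (intro exI[of _ 0]) (auto simp: power_mult)
    qed
  qed
  have nn: "a n \<omega> ^ (2 * q) \<ge> 0" for n \<omega> q by (simp add: power_mult)
  note AEs = AE_summable_of_summable_integral[OF int nn sm]
  have AE_lim: "AE \<omega> in M. (\<lambda>n. a n \<omega> ^ (2 * q0)) \<longlonglongrightarrow> 0"
    using AEs(1)[OF order_refl] by (auto elim!: eventually_mono intro!: summable_LIMSEQ_zero)
  then show lim: "AE \<omega> in M. (\<lambda>n. a n \<omega>) \<longlonglongrightarrow> 0"
    using q0[of q0] by (simp add: power_tendsto_0_iff)
  \<comment> \<open>The supremum is taken in \<open>ennreal\<close>, where it exists and is
    measurable in any case; almost sure convergence then makes it finite.\<close>
  define D where "D \<omega> = enn2real (SUP n. ennreal \<bar>a n \<omega>\<bar>)" for \<omega>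
  have [measurable]: "D \<in> borel_measurable M" unfolding D_def by measurable
  have bd: "AE \<omega> in M. (SUP n. ennreal \<bar>a n \<omega>\<bar>) = ennreal (D \<omega>)"
    using lim
  proof eventually_elim
    case (elim \<omega>)
    then have "Bseq (\<lambda>n. a n \<omega>)" by (auto intro: convergent_imp_Bseq convergentI)
    then obtain K where "\<And>n. \<bar>a n \<omega>\<bar> \<le> K" unfolding Bseq_def real_norm_def by blast
    then have "(SUP n. ennreal \<bar>a n \<omega>\<bar>) \<le> ennreal K" by (intro SUP_least ennreal_leI)
    then show ?case unfolding D_def by (metis ennreal_enn2real ennreal_less_top le_less_trans)
  qed
  have Dn: "D \<omega> \<ge> 0" for \<omega> by (simp add: D_def)
  have le: "AE \<omega> in M. \<forall>n. \<bar>a n \<omega>\<bar> \<le> D \<omega>"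
    using bd
  proof eventually_elim
    case (elim \<omega>)
    show ?case
    proof
      fix n
      have "ennreal \<bar>a n \<omega>\<bar> \<le> ennreal (D \<omega>)" unfolding elim[symmetric] by (rule SUP_upper) simp
      then show "\<bar>a n \<omega>\<bar> \<le> D \<omega>" using Dn by (simp add: ennreal_le_iff)
    qed
  qed
  have "all_moments M D"
  proof (rule all_momentsI_even)
    fix q assume q: "q \<ge> q0"
    have "AE \<omega> in M. ennreal (D \<omega> ^ (2 * q)) \<le> (\<Sum>n. ennreal (a n \<omega> ^ (2 * q)))"
      using bd AEs(1)[OF q]
    proof eventually_elim
      case (elim \<omega>)
      then have s: "summable (\<lambda>n. a n \<omega> ^ (2 * q))" by simp
      define S where "S = (\<Sum>n. a n \<omega> ^ (2 * q))"
      have S: "S \<ge> 0" unfolding S_def using s by (intro suminf_nonneg) (auto simp: power_mult)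
      \<comment> \<open>The supremum is at most the \<open>2 * q\<close>-th root of the sum of the
        \<open>2 * q\<close>-th powers, whose integral is finite.\<close>
      have "\<bar>a n \<omega>\<bar> \<le> root (2 * q) S" for n
      proof -
        have "(\<Sum>i\<in>{n}. a i \<omega> ^ (2 * q)) \<le> S" unfolding S_def
          using s by (intro sum_le_suminf) (auto simp: power_mult)
        then have "\<bar>a n \<omega>\<bar> ^ (2 * q) \<le> S" by (simp add: power_mult)
        then have "root (2 * q) (\<bar>a n \<omega>\<bar> ^ (2 * q)) \<le> root (2 * q) S"
          using q0[OF q] by (intro real_root_le_mono) auto
        then show ?thesis using q0[OF q] by (simp add: real_root_power_cancel)
      qed
      then have "ennreal (D \<omega>) \<le> ennreal (root (2 * q) S)"
        unfolding elim(1)[symmetric] by (intro SUP_least ennreal_leI)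
      then have "D \<omega> \<le> root (2 * q) S" using S q0[OF q] by (simp add: ennreal_le_iff)
      then have "D \<omega> ^ (2 * q) \<le> root (2 * q) S ^ (2 * q)" using Dn by (intro power_mono) auto
      also have "\<dots> = S" using S q0[OF q] by (intro real_root_pow_pos2) auto
      finally have "ennreal (D \<omega> ^ (2 * q)) \<le> ennreal S" by (rule ennreal_leI)
      also have "\<dots> = (\<Sum>n. ennreal (a n \<omega> ^ (2 * q)))"
        unfolding S_def using s by (intro suminf_ennreal2[symmetric]) (auto simp: power_mult)
      finally show ?case .
    qed
    then have "(\<integral>\<^sup>+\<omega>. ennreal (D \<omega> ^ (2 * q)) \<partial>M) \<le> (\<integral>\<^sup>+\<omega>. (\<Sum>n. ennreal (a n \<omega> ^ (2 * q))) \<partial>M)"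
      by (rule nn_integral_mono_AE)
    also have "\<dots> < \<infinity>" using AEs(2)[OF q] by simp
    finally show "integrable M (\<lambda>\<omega>. D \<omega> ^ (2 * q))"
      using Dn by (intro integrableI_nonneg) auto
  qed measurable
  with le show "\<exists>D. all_moments M D \<and> (AE \<omega> in M. \<forall>n. \<bar>a n \<omega>\<bar> \<le> D \<omega>)" by blast
qed

lemma decay_factor:
  assumes "c > 0"
  shows "A / (c * real (n + 1) powr (\<beta> / 2)) ^ (2 * q) = A / c ^ (2 * q) * real (n + 1) powr (- (\<beta> * real q))"
proof -
  have "(real (n + 1) powr (\<beta> / 2)) ^ (2 * q) = real (n + 1) powr (\<beta> * real q)"
    by (simp add: powr_powr flip: powr_realpow)
  then show ?thesis by (simp add: power_mult_distrib powr_minus field_simps)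
qed

lemma (in prob_space) moments_decay_cmod_of_mgf:
  fixes Z :: "nat \<Rightarrow> 'a \<Rightarrow> complex"
  assumes meas[measurable]: "\<And>n. Z n \<in> borel_measurable M" and "c > 0"
    and mgf: "\<And>n \<alpha>. cmod \<alpha> = c * real (n + 1) powr (\<beta> / 2) \<Longrightarrow>
      integrable M (\<lambda>\<omega>. exp (Re (\<alpha> * Z n \<omega>))) \<and> expectation (\<lambda>\<omega>. exp (Re (\<alpha> * Z n \<omega>))) \<le> K"
  shows "moments_decay M \<beta> (\<lambda>n \<omega>. cmod (Z n \<omega>))"
  unfolding moments_decay_def
proof (intro conjI allI)
  fix q
  show "\<exists>C. \<forall>n. integrable M (\<lambda>\<omega>. cmod (Z n \<omega>) ^ (2 * q)) \<and>
        (\<integral>\<omega>. cmod (Z n \<omega>) ^ (2 * q) \<partial>M) \<le> C * real (n + 1) powr (- (\<beta> * real q))"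
  proof (intro exI allI)
    fix n
    define s where "s = c * real (n + 1) powr (\<beta> / 2)"
    have s: "s > 0" using assms(2) by (simp add: s_def)
    have m: "integrable M (\<lambda>\<omega>. exp (Re (\<alpha> * Z n \<omega>)))" "expectation (\<lambda>\<omega>. exp (Re (\<alpha> * Z n \<omega>))) \<le> K" 
      if "cmod \<alpha> = s" for \<alpha>
      using that mgf unfolding s_def by auto
    from cmod_moment_le_of_mgf[OF meas s m, of q]
    show "integrable M (\<lambda>\<omega>. cmod (Z n \<omega>) ^ (2 * q)) \<and>
        (\<integral>\<omega>. cmod (Z n \<omega>) ^ (2 * q) \<partial>M) \<le> (4 * 2 ^ q * K * fact (2 * q) / c ^ (2 * q)) * real (n + 1) powr (- (\<beta> * real q))"
      by (simp only: s_def decay_factor[OF assms(2)] simp_thms)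
  qed
qed measurable

text \<open>A substitute for martingale convergence that also gives the rate: it asks that
  \<open>Z k - Z n\<close> be of order \<open>n\<close> to the power \<open>- \<beta> / 2\<close>
  uniformly in \<open>k \<ge> n\<close>. The limit is taken along powers of two, where the
  increments are summable; Fatou's lemma carries the moment bounds to \<open>Z n - Zi\<close>, and
  their decay brings back the whole sequence.\<close>

lemma (in prob_space) AE_limit_of_mgf:
  fixes Z :: "nat \<Rightarrow> 'a \<Rightarrow> complex"
  assumes [measurable]: "\<And>n. Z n \<in> borel_measurable M" and "c > 0" "\<beta> > 0"
    and mgf: "\<And>n k \<alpha>. n \<le> k \<Longrightarrow> cmod \<alpha> = c * real (n + 1) powr (\<beta> / 2) \<Longrightarrow>
      integrable M (\<lambda>\<omega>. exp (Re (\<alpha> * (Z k \<omega> - Z n \<omega>)))) \<and>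
      expectation (\<lambda>\<omega>. exp (Re (\<alpha> * (Z k \<omega> - Z n \<omega>)))) \<le> K"
  shows "\<exists>Zi. Zi \<in> borel_measurable M \<and> (AE \<omega> in M. (\<lambda>n. Z n \<omega>) \<longlonglongrightarrow> Zi \<omega>) \<and>
           moments_decay M \<beta> (\<lambda>n \<omega>. cmod (Z n \<omega> - Zi \<omega>))"
proof -
  define A where "A q = 4 * 2 ^ q * K * fact (2 * q) / c ^ (2 * q)" for q :: nat
  have int: "integrable M (\<lambda>\<omega>. cmod (Z k \<omega> - Z n \<omega>) ^ (2 * q))"
    and bnd: "(\<integral>\<omega>. cmod (Z k \<omega> - Z n \<omega>) ^ (2 * q) \<partial>M) \<le> A q * real (n + 1) powr (- (\<beta> * real q))"
    if "n \<le> k" for n k q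
  proof -
    define s where "s = c * real (n + 1) powr (\<beta> / 2)"
    have s: "s > 0" using assms(2) by (simp add: s_def)
    have m: "integrable M (\<lambda>\<omega>. exp (Re (\<alpha> * (Z k \<omega> - Z n \<omega>))))" "expectation (\<lambda>\<omega>. exp (Re (\<alpha> * (Z k \<omega> - Z n \<omega>)))) \<le> K" 
      if "cmod \<alpha> = s" for \<alpha>
      using that mgf[OF \<open>n \<le> k\<close>] unfolding s_def by auto
    have "(\<lambda>\<omega>. Z k \<omega> - Z n \<omega>) \<in> borel_measurable M" by measurable
    from cmod_moment_le_of_mgf[OF this s m, of q]
    show "integrable M (\<lambda>\<omega>. cmod (Z k \<omega> - Z n \<omega>) ^ (2 * q))"
      and "(\<integral>\<omega>. cmod (Z k \<omega> - Z n \<omega>) ^ (2 * q) \<partial>M) \<le> A q * real (n + 1) powr (- (\<beta> * real q))"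
      by (simp_all only: s_def decay_factor[OF assms(2)] A_def)
  qed
  have K0: "A q \<ge> 0" for q
    using order_trans[OF integral_nonneg_AE bnd[of 0 0 q]] by auto
  \<comment> \<open>The order of the increment of \<open>Z\<close> from \<open>2 ^ k\<close> to
    \<open>2 ^ Suc k\<close>: its second moment is at most a constant times the square of
    \<open>\<epsilon> k\<close>.\<close>
  define \<epsilon> where "\<epsilon> k = 2 powr (- (\<beta> / 2) * real k)" for k
  have \<epsilon>: "\<epsilon> k > 0" for k by (simp add: \<epsilon>_def)
  have \<epsilon>s: "summable \<epsilon>"
  proof -
    have "\<epsilon> = (\<lambda>k. (2 powr (- (\<beta> / 2))) ^ k)"
      by (simp add: \<epsilon>_def powr_powr fun_eq_iff flip: powr_realpow)
    moreover have "2 powr (- (\<beta> / 2)) < (1::real)" using assms(3) by (intro powr_less_one) auto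
    ultimately show ?thesis by (simp add: summable_geometric)
  qed
  \<comment> \<open>Dominates the increment through \<open>x \<le> x ^ 2 / e + e\<close>, so that
    second moments yield summability of the increments themselves.\<close>
  define d where "d k \<omega> = cmod (Z (2 ^ Suc k) \<omega> - Z (2 ^ k) \<omega>) ^ (2 * 1) / \<epsilon> k + \<epsilon> k" for k \<omega>
  have d_int: "integrable M (d k)" for k
    unfolding d_def by (intro Bochner_Integration.integrable_add integrable_divide_zero int) auto
  have "AE \<omega> in M. summable (\<lambda>k. d k \<omega>)"
  proof (rule AE_summable_of_summable_integral)
    have "(\<integral>\<omega>. d k \<omega> \<partial>M) \<le> (A 1 + 1) * \<epsilon> k" for k
    proof -
      have "(\<integral>\<omega>. d k \<omega> \<partial>M) = (\<integral>\<omega>. cmod (Z (2 ^ Suc k) \<omega> - Z (2 ^ k) \<omega>) ^ (2 * 1) \<partial>M) / \<epsilon> k + \<epsilon> k"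
        unfolding d_def using int[of "2 ^ k" "2 ^ Suc k" 1]
        by (subst Bochner_Integration.integral_add) (auto simp: prob_space)
      also have "\<dots> \<le> A 1 * real (2 ^ k + 1) powr (- (\<beta> * real 1)) / \<epsilon> k + \<epsilon> k"
        using \<epsilon>[of k] by (intro add_mono divide_right_mono bnd) auto
      also have "\<dots> \<le> A 1 * (\<epsilon> k * \<epsilon> k) / \<epsilon> k + \<epsilon> k"
      proof (intro add_mono divide_right_mono mult_left_mono K0 order_refl)
        have "real (2 ^ k + 1) powr (- (\<beta> * real 1)) \<le> (2 ^ k) powr (- (\<beta> * real 1))"
          using assms(3) by (intro powr_mono2') auto
        also have "(2 ^ k) powr (- (\<beta> * real 1)) = \<epsilon> k * \<epsilon> k"
          by (simp add: \<epsilon>_def powr_powr mult.commute flip: powr_realpow powr_add)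
        finally show "real (2 ^ k + 1) powr (- (\<beta> * real 1)) \<le> \<epsilon> k * \<epsilon> k" .
      qed (use \<epsilon>[of k] in auto)
      finally show ?thesis using \<epsilon>[of k] by (simp add: algebra_simps)
    qed
    moreover have "(\<integral>\<omega>. d k \<omega> \<partial>M) \<ge> 0" for k
      using \<epsilon>[of k] by (intro integral_nonneg_AE AE_I2) (auto simp: d_def)
    ultimately show "summable (\<lambda>k. \<integral>\<omega>. d k \<omega> \<partial>M)"
      by (intro summable_comparison_test[OF _ summable_mult[OF \<epsilon>s, of "A 1 + 1"]]) auto
    show "d k \<omega> \<ge> 0" for k \<omega> using \<epsilon>[of k] by (auto simp: d_def)
  qed (rule d_int)
  then have conv: "AE \<omega> in M. convergent (\<lambda>k. Z (2 ^ k) \<omega>)"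
  proof eventually_elim
    case (elim \<omega>)
    have "norm (Z (2 ^ Suc k) \<omega> - Z (2 ^ k) \<omega>) \<le> d k \<omega>" for k
    proof -
      have "x \<le> x\<^sup>2 / e + e" if "e > 0" for x e :: real
      proof -
        have "0 \<le> (x - e / 2)\<^sup>2" by simp
        then have "x * e \<le> x\<^sup>2 + e\<^sup>2 / 4" by (simp add: power2_eq_square algebra_simps)
        also have "\<dots> \<le> x\<^sup>2 + e * e" by (simp add: power2_eq_square)
        finally show ?thesis using that by (simp add: field_simps)
      qed
      from this[OF \<epsilon>[of k]] show ?thesis by (simp add: d_def)
    qed
    then have "summable (\<lambda>k. Z (2 ^ Suc k) \<omega> - Z (2 ^ k) \<omega>)"
      by (intro summable_comparison_test[OF _ elim]) auto
    then have "convergent (\<lambda>n. \<Sum>k<n. Z (2 ^ Suc k) \<omega> - Z (2 ^ k) \<omega>)"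
      by (simp add: summable_iff_convergent)
    then have "convergent (\<lambda>n. Z (2 ^ n) \<omega> - Z (2 ^ 0) \<omega>)"
      by (simp only: sum_lessThan_telescope[of "\<lambda>k. Z (2 ^ k) \<omega>"])
    then show ?case by (simp add: convergent_diff_const_right_iff)
  qed
  define Zi where "Zi \<omega> = lim (\<lambda>k. Z (2 ^ k) \<omega>)" for \<omega>
  have Zi [measurable]: "Zi \<in> borel_measurable M"
    unfolding Zi_def by measurable
  have fatou: "(\<integral>\<^sup>+\<omega>. ennreal (cmod (Z n \<omega> - Zi \<omega>) ^ (2 * q)) \<partial>M) \<le> ennreal (A q * real (n + 1) powr (- (\<beta> * real q)))" for n q
  proof -
    have "(\<integral>\<^sup>+\<omega>. ennreal (cmod (Z n \<omega> - Zi \<omega>) ^ (2 * q)) \<partial>M) \<le>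
          (\<integral>\<^sup>+\<omega>. liminf (\<lambda>k. ennreal (cmod (Z (2 ^ k) \<omega> - Z n \<omega>) ^ (2 * q))) \<partial>M)"
    proof (rule nn_integral_mono_AE)
      show "AE \<omega> in M. ennreal (cmod (Z n \<omega> - Zi \<omega>) ^ (2 * q)) \<le> liminf (\<lambda>k. ennreal (cmod (Z (2 ^ k) \<omega> - Z n \<omega>) ^ (2 * q)))"
        using conv
      proof eventually_elim
        case (elim \<omega>)
        then have "(\<lambda>k. Z (2 ^ k) \<omega>) \<longlonglongrightarrow> Zi \<omega>" unfolding Zi_def by (simp add: convergent_LIMSEQ_iff)
        then have "(\<lambda>k. ennreal (cmod (Z (2 ^ k) \<omega> - Z n \<omega>) ^ (2 * q))) \<longlonglongrightarrow> ennreal (cmod (Zi \<omega> - Z n \<omega>) ^ (2 * q))"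
          by (intro tendsto_intros tendsto_ennrealI)
        from lim_imp_Liminf[OF sequentially_bot this] show ?case
          unfolding norm_minus_commute[of "Z n \<omega>" "Zi \<omega>"] by simp
      qed
    qed
    also have "\<dots> \<le> liminf (\<lambda>k. \<integral>\<^sup>+\<omega>. ennreal (cmod (Z (2 ^ k) \<omega> - Z n \<omega>) ^ (2 * q)) \<partial>M)"
      by (intro nn_integral_liminf) measurable
    also have "\<dots> \<le> ennreal (A q * real (n + 1) powr (- (\<beta> * real q)))"
    proof (rule Liminf_le)
      show "\<forall>\<^sub>F k in sequentially. (\<integral>\<^sup>+\<omega>. ennreal (cmod (Z (2 ^ k) \<omega> - Z n \<omega>) ^ (2 * q)) \<partial>M) \<le> ennreal (A q * real (n + 1) powr (- (\<beta> * real q)))"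
        using eventually_ge_at_top[of n]
      proof eventually_elim
        case (elim k)
        have "n \<le> 2 ^ k" using elim less_exp[of k] by linarith
        then show ?case using int bnd by (subst nn_integral_eq_integral) (auto intro!: ennreal_leI)
      qed
    qed simp
    finally show ?thesis .
  qed
  have dec: "moments_decay M \<beta> (\<lambda>n \<omega>. cmod (Z n \<omega> - Zi \<omega>))"
    unfolding moments_decay_def
  proof (intro conjI allI)
    fix q
    show "\<exists>C. \<forall>n. integrable M (\<lambda>\<omega>. cmod (Z n \<omega> - Zi \<omega>) ^ (2 * q)) \<and>
        (\<integral>\<omega>. cmod (Z n \<omega> - Zi \<omega>) ^ (2 * q) \<partial>M) \<le> C * real (n + 1) powr (- (\<beta> * real q))"
    proof (intro exI allI conjI)
      fix n
      show i: "integrable M (\<lambda>\<omega>. cmod (Z n \<omega> - Zi \<omega>) ^ (2 * q))"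
        using fatou[of n q] by (intro integrableI_nonneg) (auto intro: le_less_trans)
      show "(\<integral>\<omega>. cmod (Z n \<omega> - Zi \<omega>) ^ (2 * q) \<partial>M) \<le> A q * real (n + 1) powr (- (\<beta> * real q))"
        using fatou[of n q] K0 by (subst (asm) nn_integral_eq_integral[OF i]) (auto simp: ennreal_le_iff)
    qed
  qed measurable
  have "AE \<omega> in M. (\<lambda>n. Z n \<omega>) \<longlonglongrightarrow> Zi \<omega>"
    using moments_decay_imp_dominated(1)[OF dec assms(3)]
    by eventually_elim (simp add: tendsto_norm_zero_iff LIM_zero_iff)
  with Zi dec show ?thesis by blast
qed

section \<open>The embedded jump chain\<close>

definition mass :: "nat \<Rightarrow> (nat \<Rightarrow> nat) \<Rightarrow> nat" where
  "mass m v = (\<Sum>k=1..m-1. k * v k)"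

lemma rate_eq_mass: "rate m v = real (mass m v)"
  by (simp add: rate_def mass_def)

lemma u1_eq_mass: "u1 m v = real (mass m v)"
  by (simp add: u1_def mass_def)

text \<open>The mass increases by one at each jump, so after n jumps the chain lives in one such
  set; its finiteness is what makes expectations finite sums.\<close>

definition states :: "nat \<Rightarrow> nat \<Rightarrow> (nat \<Rightarrow> nat) set" where
  "states m N = {v. (\<forall>i. i \<notin> {1..m-1} \<longrightarrow> v i = 0) \<and> mass m v = N}"

lemma finite_states: "finite (states m N)"
proof (rule finite_subset)
  show "finite {v :: nat \<Rightarrow> nat. \<forall>i. (i \<in> {1..m-1} \<longrightarrow> v i \<in> {..N}) \<and> (i \<notin> {1..m-1} \<longrightarrow> v i = 0)}"
    by (rule finite_set_of_finite_funs) auto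
  show "states m N \<subseteq> {v. \<forall>i. (i \<in> {1..m-1} \<longrightarrow> v i \<in> {..N}) \<and> (i \<notin> {1..m-1} \<longrightarrow> v i = 0)}"
  proof safe
    fix v i assume v: "v \<in> states m N" and i: "i \<in> {1..m-1}"
    have "v i \<le> i * v i" using i by simp
    also have "\<dots> \<le> mass m v" unfolding mass_def using i by (intro member_le_sum) auto
    finally show "v i \<le> N" using v by (simp add: states_def)
  qed (auto simp: states_def)
qed

text \<open>The increment of the linear functional with coefficients \<open>c\<close> under a jump
  of colour k. The ring is left open for the integer mass and for the complex
  \<open>u2\<close>.\<close>

definition wdot :: "nat \<Rightarrow> (nat \<Rightarrow> 'b::ring_1) \<Rightarrow> nat \<Rightarrow> 'b" where
  "wdot m c k = (\<Sum>i=1..m-1. c i * of_int (wvec m k i))"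

lemma wdot_eq:
  assumes "m \<ge> 3" "k \<in> {1..m-1}"
  shows "wdot m c k = (if k \<le> m - 2 then c (Suc k) - c k else of_nat m * c 1 - c (m - 1))"
proof (cases "k \<le> m - 2")
  case True
  have "wdot m c k = (\<Sum>i=1..m-1. (if i = Suc k then c i else 0) - (if i = k then c i else 0))"
    unfolding wdot_def using True by (intro sum.cong) (auto simp: wvec_def)
  also have "\<dots> = c (Suc k) - c k"
    using True assms by (simp add: sum_subtractf) auto
  finally show ?thesis using True by simp
next
  case False
  have "wdot m c k = (\<Sum>i=1..m-1. (if i = 1 then of_nat m * c i else 0) - (if i = m - 1 then c i else 0))"
    unfolding wdot_def using False assms
    by (intro sum.cong) (auto simp: wvec_def mult_of_nat_commute)
  also have "\<dots> = of_nat m * c 1 - c (m - 1)"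
    using assms by (simp add: sum_subtractf)
  finally show ?thesis using False by simp
qed

text \<open>Only coordinate k can decrease, and by one, so the presence of a particle of colour k
  keeps the truncation by \<open>nat\<close> in \<open>shift\<close> from acting.\<close>

lemma of_nat_shift:
  assumes "v k > 0" "k \<in> {1..m-1}"
  shows "of_nat (shift m k v i) = (of_nat (v i) + of_int (wvec m k i) :: 'b::ring_1)"
proof -
  have "int (v i) + wvec m k i \<ge> 0" using assms by (auto simp: wvec_def)
  then have "int (shift m k v i) = int (v i) + wvec m k i" by (simp add: shift_def)
  then have "of_int (int (shift m k v i)) = (of_int (int (v i) + wvec m k i) :: 'b)" by simp
  then show ?thesis by simp
qed

lemma linear_shift:
  fixes c :: "nat \<Rightarrow> 'b::ring_1"
  assumes "v k > 0" "k \<in> {1..m-1}"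
  shows "(\<Sum>i=1..m-1. c i * of_nat (shift m k v i)) = (\<Sum>i=1..m-1. c i * of_nat (v i)) + wdot m c k"
  unfolding of_nat_shift[where k=k and v=v, OF assms] wdot_def by (simp only: distrib_left sum.distrib)

lemma shift_in_states:
  assumes "v \<in> states m N" "v k > 0" "k \<in> {1..m-1}" "m \<ge> 3"
  shows "shift m k v \<in> states m (Suc N)"
proof -
  have "int (mass m (shift m k v)) = (\<Sum>i=1..m-1. int i * int (shift m k v i))"
    by (simp add: mass_def)
  also have "\<dots> = (\<Sum>i=1..m-1. int i * int (v i)) + wdot m int k"
    using linear_shift[where k=k and v=v and c=int, OF assms(2,3)] by simp
  also have "wdot m int k = 1" using assms by (subst wdot_eq) auto
  also have "(\<Sum>i=1..m-1. int i * int (v i)) = int (mass m v)" by (simp add: mass_def)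
  finally have "mass m (shift m k v) = Suc N" using assms by (simp add: states_def)
  moreover have "shift m k v i = 0" if "i \<notin> {1..m-1}" for i
    using assms that by (auto simp: shift_def wvec_def states_def)
  ultimately show ?thesis by (simp add: states_def)
qed

text \<open>The transition operator of the jump chain. Colours with no particle have weight zero, so
  the truncated value of \<open>shift\<close> for them is harmless.\<close>

definition gen_step :: "nat \<Rightarrow> ((nat \<Rightarrow> nat) \<Rightarrow> 'b::real_normed_field) \<Rightarrow> (nat \<Rightarrow> nat) \<Rightarrow> 'b" where
  "gen_step m \<psi> b = (\<Sum>k=1..m-1. of_real (real k * real (b k) / rate m b) * \<psi> (shift m k b))"

lemma sum_jump_prob:
  assumes "b \<in> states m N" "m \<ge> 3"
  shows "(\<Sum>c\<in>states m (Suc N). of_real (jump_prob m b c) * \<psi> c) = gen_step m \<psi> b"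
proof -
  have "(\<Sum>c\<in>states m (Suc N). of_real (jump_prob m b c) * \<psi> c) =
        (\<Sum>c\<in>states m (Suc N). \<Sum>k=1..m-1.
            if c = shift m k b then of_real (real k * real (b k) / rate m b) * \<psi> c else 0)"
    unfolding jump_prob_def sum_divide_distrib of_real_sum sum_distrib_right
    by (intro sum.cong) auto
  also have "\<dots> = (\<Sum>k=1..m-1. \<Sum>c\<in>states m (Suc N).
            if c = shift m k b then of_real (real k * real (b k) / rate m b) * \<psi> c else 0)"
    by (rule sum.swap)
  also have "\<dots> = gen_step m \<psi> b"
    unfolding gen_step_def
  proof (intro sum.cong refl)
    fix k assume k: "k \<in> {1..m-1}"
    show "(\<Sum>c\<in>states m (Suc N). if c = shift m k b then of_real (real k * real (b k) / rate m b) * \<psi> c else 0)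
       = of_real (real k * real (b k) / rate m b) * \<psi> (shift m k b)"
    proof (cases "b k = 0")
      case False
      then have "shift m k b \<in> states m (Suc N)" using assms k by (intro shift_in_states) auto
      then show ?thesis using finite_states[of m "Suc N"] by simp
    next
      case True
      then show ?thesis by (intro trans[OF sum.neutral]) auto
    qed
  qed
  finally show ?thesis .
qed

lemma sum_weights:
  assumes "mass m b > 0"
  shows "(\<Sum>k=1..m-1. real k * real (b k) / rate m b) = 1"
proof -
  have "(\<Sum>k=1..m-1. real k * real (b k)) = rate m b" by (simp add: rate_def)
  then have "(\<Sum>k=1..m-1. real k * real (b k)) / rate m b = 1" using assms by (simp add: rate_eq_mass)
  then show ?thesis by (simp only: sum_divide_distrib)
qed

section \<open>Path space of the jump chain\<close>

locale urn_process = prob_space M for M :: "'a measure" +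
  fixes m :: nat and x0 :: "nat \<Rightarrow> nat"
    and Y :: "nat \<Rightarrow> 'a \<Rightarrow> nat \<Rightarrow> nat" and S :: "nat \<Rightarrow> 'a \<Rightarrow> real"
  assumes m3: "m \<ge> 3"
    and x0_support: "\<forall>i. i \<notin> {1..m-1} \<longrightarrow> x0 i = 0" and x0_nonzero: "x0 \<noteq> (\<lambda>_. 0)"
    and Y_measurable [measurable]: "\<And>j. Y j \<in> measurable M (count_space UNIV)"
    and S_measurable [measurable]: "\<And>j. S j \<in> borel_measurable M"
    and law: "\<And>n (ys :: nat \<Rightarrow> (nat \<Rightarrow> nat)) (ss :: nat \<Rightarrow> real).
           (\<forall>j<n. ss j \<ge> 0) \<Longrightarrow>
           measure M {\<omega> \<in> space M. (\<forall>j\<le>n. Y j \<omega> = ys j) \<and> (\<forall>j<n. S j \<omega> > ss j)} =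
           (if ys 0 = x0 then 1 else 0) *
           (\<Prod>j<n. jump_prob m (ys j) (ys (Suc j)) * exp (- rate m (ys j) * ss j))"
begin

definition N0 :: nat where "N0 = mass m x0"

lemma N0_pos: "N0 > 0"
proof -
  obtain i where i: "x0 i \<noteq> 0" using x0_nonzero by blast
  have "i \<in> {1..m-1}"
  proof (rule ccontr)
    assume "i \<notin> {1..m-1}"
    with x0_support have "x0 i = 0" by simp
    with i show False by contradiction
  qed
  then have "i * x0 i \<le> N0" unfolding N0_def mass_def by (intro member_le_sum) auto
  moreover have "0 < i * x0 i" using i \<open>i \<in> {1..m-1}\<close> by simp
  ultimately show ?thesis by linarith
qed

abbreviation A :: "nat \<Rightarrow> (nat \<Rightarrow> nat) set" where "A n \<equiv> states m (N0 + n)"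

lemma x0_in_A: "x0 \<in> A 0"
  using x0_support by (simp add: states_def N0_def)

lemma rate_A: "v \<in> A n \<Longrightarrow> rate m v = real (N0 + n)"
  by (simp add: rate_eq_mass states_def)

definition paths :: "nat \<Rightarrow> (nat \<Rightarrow> nat \<Rightarrow> nat) set" where
  "paths n = PiE {..n} A"

definition path_prob :: "nat \<Rightarrow> (nat \<Rightarrow> nat \<Rightarrow> nat) \<Rightarrow> real" where
  "path_prob n ys = (if ys 0 = x0 then 1 else 0) * (\<Prod>j<n. jump_prob m (ys j) (ys (Suc j)))"

lemma finite_paths: "finite (paths n)"
  unfolding paths_def by (intro finite_PiE finite_states) auto

lemma paths_in_A: "ys \<in> paths n \<Longrightarrow> j \<le> n \<Longrightarrow> ys j \<in> A j"
  by (auto simp: paths_def PiE_iff)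

lemma sum_paths_Suc:
  "(\<Sum>ys\<in>paths (Suc n). f ys) = (\<Sum>ys\<in>paths n. \<Sum>c\<in>A (Suc n). f (ys(Suc n := c)))"
proof -
  have e: "paths (Suc n) = (\<lambda>(y, g). g(Suc n := y)) ` (A (Suc n) \<times> paths n)"
    unfolding paths_def atMost_Suc by (rule PiE_insert_eq)
  have "(\<Sum>ys\<in>paths (Suc n). f ys) = (\<Sum>(y, g)\<in>A (Suc n) \<times> paths n. f (g(Suc n := y)))"
    by (subst e, unfold paths_def, subst sum.reindex[OF inj_combinator]) (auto simp: case_prod_unfold)
  also have "\<dots> = (\<Sum>c\<in>A (Suc n). \<Sum>ys\<in>paths n. f (ys(Suc n := c)))"
    by (simp add: sum.cartesian_product)
  also have "\<dots> = (\<Sum>ys\<in>paths n. \<Sum>c\<in>A (Suc n). f (ys(Suc n := c)))" by (rule sum.swap)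
  finally show ?thesis .
qed

lemma path_prob_Suc:
  "path_prob (Suc n) (ys(Suc n := c)) = path_prob n ys * jump_prob m (ys n) c"
  by (auto simp: path_prob_def intro!: prod.cong)

text \<open>The Markov property as an identity of finite sums: the last step is summed out, while
  \<open>g\<close> may depend on the path before it.\<close>

lemma sum_paths_step:
  fixes \<psi> :: "(nat \<Rightarrow> nat) \<Rightarrow> 'b::real_normed_field"
  assumes "\<And>ys c. g (ys(Suc n := c)) = g ys"
  shows "(\<Sum>ys\<in>paths (Suc n). of_real (path_prob (Suc n) ys) * (g ys * \<psi> (ys (Suc n)))) =
         (\<Sum>ys\<in>paths n. of_real (path_prob n ys) * (g ys * gen_step m \<psi> (ys n)))"
proof -
  have "(\<Sum>ys\<in>paths (Suc n). of_real (path_prob (Suc n) ys) * (g ys * \<psi> (ys (Suc n)))) =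
        (\<Sum>ys\<in>paths n. of_real (path_prob n ys) * (g ys * (\<Sum>c\<in>A (Suc n). of_real (jump_prob m (ys n) c) * \<psi> c)))"
    by (simp add: sum_paths_Suc path_prob_Suc assms sum_distrib_left mult_ac)
  also have "\<dots> = (\<Sum>ys\<in>paths n. of_real (path_prob n ys) * (g ys * gen_step m \<psi> (ys n)))"
    using sum_jump_prob[of _ m "N0 + n" \<psi>] paths_in_A[of _ n n] m3 by (intro sum.cong) auto
  finally show ?thesis .
qed

lemma gen_step_1: "b \<in> A n \<Longrightarrow> gen_step m (\<lambda>_. 1) b = (1 :: 'b::real_normed_field)"
proof -
  assume b: "b \<in> A n"
  have "gen_step m (\<lambda>_. 1) b = (of_real (\<Sum>k=1..m-1. real k * real (b k) / rate m b) :: 'b)"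
    by (simp add: gen_step_def)
  also have "\<dots> = 1" using b N0_pos by (subst sum_weights) (auto simp: states_def)
  finally show ?thesis .
qed

lemma sum_path_prob: "(\<Sum>ys\<in>paths n. path_prob n ys) = 1"
proof (induction n)
  case 0
  have "paths 0 = (\<lambda>v. (\<lambda>j\<in>{..0}. v)) ` A 0"
  proof safe
    fix ys assume "ys \<in> paths 0"
    then have "ys = (\<lambda>j\<in>{..0}. ys 0)" "ys 0 \<in> A 0" by (auto simp: paths_def PiE_iff extensional_def restrict_def)
    then show "ys \<in> (\<lambda>v. (\<lambda>j\<in>{..0}. v)) ` A 0" by blast
  qed (auto simp: paths_def)
  moreover have "inj_on (\<lambda>v. (\<lambda>j\<in>{..0::nat}. v)) (A 0)"
    by (rule inj_onI) (metis (mono_tags) atMost_iff le0 restrict_apply')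
  ultimately have "(\<Sum>ys\<in>paths 0. path_prob 0 ys) = (\<Sum>v\<in>A 0. if v = x0 then 1 else 0)"
    by (simp add: sum.reindex path_prob_def)
  then show ?case using x0_in_A finite_states by simp
next
  case (Suc n)
  have "(\<Sum>ys\<in>paths (Suc n). path_prob (Suc n) ys) =
        (\<Sum>ys\<in>paths n. path_prob n ys * gen_step m (\<lambda>_. 1) (ys n))"
    using sum_paths_step[of "\<lambda>_. 1" n "\<lambda>_. 1 :: real"] by simp
  also have "\<dots> = (\<Sum>ys\<in>paths n. path_prob n ys)"
    using paths_in_A[of _ n n] by (intro sum.cong) (auto simp: gen_step_1[of _ n])
  finally show ?case using Suc by simp
qed

text \<open>The rate after j jumps is \<open>N0 + j\<close> whatever the path, so the law splits
  into a path weight and a product of exponentials. This is where the independence of chain and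
  clocks comes from.\<close>

lemma exp_rate_path:
  assumes "ys \<in> paths n"
  shows "(if ys 0 = x0 then 1 else 0) * (\<Prod>j<n. jump_prob m (ys j) (ys (Suc j)) * exp (- rate m (ys j) * ss j)) =
    path_prob n ys * (\<Prod>j<n. exp (- real (N0 + j) * ss j))"
proof -
  have "(\<Prod>j<n. jump_prob m (ys j) (ys (Suc j)) * exp (- rate m (ys j) * ss j)) =
        (\<Prod>j<n. jump_prob m (ys j) (ys (Suc j)) * exp (- real (N0 + j) * ss j))"
    using rate_A[OF paths_in_A[OF assms]] by (intro prod.cong) auto
  then show ?thesis unfolding path_prob_def prod.distrib by (simp add: mult_ac)
qed

lemma disjoint_path_events:
  assumes E: "\<And>ys \<omega>. \<omega> \<in> E ys \<Longrightarrow> \<forall>j\<le>n. Y j \<omega> = ys j"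
  shows "disjoint_family_on E (paths n)"
  unfolding disjoint_family_on_def
proof (intro ballI impI)
  fix ys zs assume h: "ys \<in> paths n" "zs \<in> paths n" "ys \<noteq> zs"
  show "E ys \<inter> E zs = {}"
  proof (rule ccontr)
    assume "E ys \<inter> E zs \<noteq> {}"
    then obtain \<omega> where "\<omega> \<in> E ys" "\<omega> \<in> E zs" by blast
    then have "ys j = zs j" if "j \<in> {..n}" for j using E that by (metis atMost_iff)
    then have "ys = zs" using h(1,2) unfolding paths_def by (intro PiE_ext) auto
    with h show False by simp
  qed
qed

text \<open>The events belonging to admissible paths are disjoint and, with all thresholds zero,
  their probabilities already add up to one.\<close>

lemma AE_path_n: "AE \<omega> in M. (\<forall>j\<le>n. Y j \<omega> \<in> A j) \<and> (\<forall>j<n. S j \<omega> > 0)"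
proof -
  define E where "E ys = {\<omega> \<in> space M. (\<forall>j\<le>n. Y j \<omega> = ys j) \<and> (\<forall>j<n. S j \<omega> > 0)}" for ys
  have E_sets: "E ys \<in> sets M" for ys unfolding E_def by measurable
  have PE: "prob (E ys) = path_prob n ys" if "ys \<in> paths n" for ys
    using law[of n "\<lambda>_. 0" ys] exp_rate_path[OF that, of "\<lambda>_. 0"] by (simp add: E_def)
  have "disjoint_family_on E (paths n)" by (rule disjoint_path_events) (simp add: E_def)
  then have "prob (\<Union>ys\<in>paths n. E ys) = (\<Sum>ys\<in>paths n. prob (E ys))"
    using E_sets finite_paths by (intro finite_measure_finite_Union) auto
  also have "\<dots> = 1" using PE sum_path_prob by simp
  finally have "AE \<omega> in M. \<omega> \<in> (\<Union>ys\<in>paths n. E ys)"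
    using E_sets finite_paths by (subst (asm) prob_eq_1) auto
  then show ?thesis
    by eventually_elim (use paths_in_A in \<open>auto simp: E_def\<close>)
qed

lemma AE_path: "AE \<omega> in M. (\<forall>j. Y j \<omega> \<in> A j) \<and> (\<forall>j. S j \<omega> > 0)"
proof -
  have "AE \<omega> in M. \<forall>n. (\<forall>j\<le>n. Y j \<omega> \<in> A j) \<and> (\<forall>j<n. S j \<omega> > 0)"
    using AE_path_n by (simp add: AE_all_countable)
  then show ?thesis by eventually_elim blast
qed

lemma prob_sum_paths:
  assumes [measurable]: "F \<in> sets M"
  shows "prob F = (\<Sum>ys\<in>paths n. prob {\<omega> \<in> F. \<forall>j\<le>n. Y j \<omega> = ys j})"
proof -
  have F: "F \<subseteq> space M" using assms by (rule sets.sets_into_space)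
  define E where "E ys = {\<omega> \<in> F. \<forall>j\<le>n. Y j \<omega> = ys j}" for ys
  have E_eq: "E ys = F \<inter> {\<omega> \<in> space M. \<forall>j\<le>n. Y j \<omega> = ys j}" for ys
    using F by (auto simp: E_def)
  have E_sets: "E ys \<in> sets M" for ys unfolding E_eq by measurable
  have "disjoint_family_on E (paths n)" by (rule disjoint_path_events) (simp add: E_def)
  then have "prob (\<Union>ys\<in>paths n. E ys) = (\<Sum>ys\<in>paths n. prob (E ys))"
    using E_sets finite_paths by (intro finite_measure_finite_Union) auto
  moreover have "prob F = prob (\<Union>ys\<in>paths n. E ys)"
  proof (rule measure_eq_AE)
    show "AE \<omega> in M. (\<omega> \<in> F) = (\<omega> \<in> (\<Union>ys\<in>paths n. E ys))"
      using AE_path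
    proof eventually_elim
      case (elim \<omega>)
      have "restrict (\<lambda>j. Y j \<omega>) {..n} \<in> paths n" using elim by (auto simp: paths_def)
      moreover have "\<omega> \<in> F \<Longrightarrow> \<omega> \<in> E (restrict (\<lambda>j. Y j \<omega>) {..n})" by (simp add: E_def)
      ultimately have "\<omega> \<in> F \<Longrightarrow> \<omega> \<in> (\<Union>ys\<in>paths n. E ys)" by blast
      then show ?case by (auto simp: E_def)
    qed
    show "(\<Union>ys\<in>paths n. E ys) \<in> sets M" using E_sets finite_paths by auto
  qed measurable
  ultimately show ?thesis by (simp add: E_def)
qed

text \<open>The law is given for nonnegative thresholds; almost sure positivity of the holding times
  extends it to all real ones, as the independence criterion asks.\<close>

lemma prob_path_S:
  assumes ys: "ys \<in> paths n"
  shows "prob {\<omega> \<in> space M. (\<forall>j\<le>n. Y j \<omega> = ys j) \<and> (\<forall>j<n. S j \<omega> > s j)} =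
    path_prob n ys * (\<Prod>j<n. exp (- real (N0 + j) * max 0 (s j)))"
proof -
  have "prob {\<omega> \<in> space M. (\<forall>j\<le>n. Y j \<omega> = ys j) \<and> (\<forall>j<n. S j \<omega> > s j)} =
        prob {\<omega> \<in> space M. (\<forall>j\<le>n. Y j \<omega> = ys j) \<and> (\<forall>j<n. S j \<omega> > max 0 (s j))}"
  proof (rule measure_eq_AE)
    show "AE \<omega> in M. (\<omega> \<in> {\<omega> \<in> space M. (\<forall>j\<le>n. Y j \<omega> = ys j) \<and> (\<forall>j<n. S j \<omega> > s j)}) =
       (\<omega> \<in> {\<omega> \<in> space M. (\<forall>j\<le>n. Y j \<omega> = ys j) \<and> (\<forall>j<n. S j \<omega> > max 0 (s j))})"
      using AE_path by eventually_elim auto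
  qed measurable
  also have "\<dots> = path_prob n ys * (\<Prod>j<n. exp (- real (N0 + j) * max 0 (s j)))"
    using law[of n "\<lambda>j. max 0 (s j)" ys] exp_rate_path[OF ys, of "\<lambda>j. max 0 (s j)"] by simp
  finally show ?thesis .
qed

lemma prob_path: "ys \<in> paths n \<Longrightarrow> prob {\<omega> \<in> space M. \<forall>j\<le>n. Y j \<omega> = ys j} = path_prob n ys"
proof -
  assume ys: "ys \<in> paths n"
  have "prob {\<omega> \<in> space M. \<forall>j\<le>n. Y j \<omega> = ys j} =
        prob {\<omega> \<in> space M. (\<forall>j\<le>n. Y j \<omega> = ys j) \<and> (\<forall>j<n. S j \<omega> > -1)}"
  proof (rule measure_eq_AE)
    show "AE \<omega> in M. (\<omega> \<in> {\<omega> \<in> space M. \<forall>j\<le>n. Y j \<omega> = ys j}) =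
       (\<omega> \<in> {\<omega> \<in> space M. (\<forall>j\<le>n. Y j \<omega> = ys j) \<and> (\<forall>j<n. S j \<omega> > -1)})"
      using AE_path by eventually_elim (auto intro: order.strict_trans[of "-1" 0])
  qed measurable
  then show ?thesis using prob_path_S[OF ys, of "\<lambda>_. -1"] by simp
qed

lemma Y_pred [measurable]: "Measurable.pred M (\<lambda>\<omega>. Y n \<omega> \<in> B)"
  by (rule measurable_compose[OF Y_measurable]) simp

text \<open>Summing the factorised law over the paths that end in \<open>B\<close> shows that
  \<open>Y n\<close> is independent of the first n clocks.\<close>

lemma prob_Y_S:
  "prob {\<omega> \<in> space M. Y n \<omega> \<in> B \<and> (\<forall>j<n. S j \<omega> > s j)} =
   prob {\<omega> \<in> space M. Y n \<omega> \<in> B} * (\<Prod>j<n. exp (- real (N0 + j) * max 0 (s j)))"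
proof -
  have e1: "prob {\<omega> \<in> {\<omega> \<in> space M. Y n \<omega> \<in> B \<and> (\<forall>j<n. S j \<omega> > s j)}. \<forall>j\<le>n. Y j \<omega> = ys j} =
     (if ys n \<in> B then path_prob n ys else 0) * (\<Prod>j<n. exp (- real (N0 + j) * max 0 (s j)))"
    if "ys \<in> paths n" for ys
  proof -
    consider "ys n \<in> B" | "ys n \<notin> B" by blast
    then show ?thesis
    proof cases
      case 1
      have "Y n \<omega> \<in> B" if "\<forall>j\<le>n. Y j \<omega> = ys j" for \<omega>
        using that[rule_format, of n] 1 by simp
      then have "{\<omega> \<in> {\<omega> \<in> space M. Y n \<omega> \<in> B \<and> (\<forall>j<n. S j \<omega> > s j)}. \<forall>j\<le>n. Y j \<omega> = ys j} =
        {\<omega> \<in> space M. (\<forall>j\<le>n. Y j \<omega> = ys j) \<and> (\<forall>j<n. S j \<omega> > s j)}"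
        by blast
      then show ?thesis using prob_path_S[OF that, of s] 1 by (simp only: if_True)
    next
      case 2
      have "\<not> (Y n \<omega> \<in> B)" if "\<forall>j\<le>n. Y j \<omega> = ys j" for \<omega>
        using that[rule_format, of n] 2 by simp
      then have "{\<omega> \<in> {\<omega> \<in> space M. Y n \<omega> \<in> B \<and> (\<forall>j<n. S j \<omega> > s j)}. \<forall>j\<le>n. Y j \<omega> = ys j} = {}"
        by blast
      then show ?thesis using 2 by (simp only: if_False measure_empty mult_zero_left)
    qed
  qed
  have e2: "prob {\<omega> \<in> {\<omega> \<in> space M. Y n \<omega> \<in> B}. \<forall>j\<le>n. Y j \<omega> = ys j} = (if ys n \<in> B then path_prob n ys else 0)"
    if "ys \<in> paths n" for ys
  proof -
    consider "ys n \<in> B" | "ys n \<notin> B" by blast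
    then show ?thesis
    proof cases
      case 1
      have "Y n \<omega> \<in> B" if "\<forall>j\<le>n. Y j \<omega> = ys j" for \<omega>
        using that[rule_format, of n] 1 by simp
      then have "{\<omega> \<in> {\<omega> \<in> space M. Y n \<omega> \<in> B}. \<forall>j\<le>n. Y j \<omega> = ys j} =
        {\<omega> \<in> space M. \<forall>j\<le>n. Y j \<omega> = ys j}"
        by blast
      then show ?thesis using prob_path[OF that] 1 by (simp only: if_True)
    next
      case 2
      have "\<not> (Y n \<omega> \<in> B)" if "\<forall>j\<le>n. Y j \<omega> = ys j" for \<omega>
        using that[rule_format, of n] 2 by simp
      then have "{\<omega> \<in> {\<omega> \<in> space M. Y n \<omega> \<in> B}. \<forall>j\<le>n. Y j \<omega> = ys j} = {}"
        by blast
      then show ?thesis using 2 by (simp only: if_False measure_empty)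
    qed
  qed
  have "prob {\<omega> \<in> space M. Y n \<omega> \<in> B \<and> (\<forall>j<n. S j \<omega> > s j)} =
    (\<Sum>ys\<in>paths n. (if ys n \<in> B then path_prob n ys else 0) * (\<Prod>j<n. exp (- real (N0 + j) * max 0 (s j))))"
  proof -
    have "{\<omega> \<in> space M. Y n \<omega> \<in> B \<and> (\<forall>j<n. S j \<omega> > s j)} \<in> sets M" by measurable
    from prob_sum_paths[OF this, of n] show ?thesis using e1 by (simp only: cong: sum.cong)
  qed
  also have "\<dots> = (\<Sum>ys\<in>paths n. if ys n \<in> B then path_prob n ys else 0) * (\<Prod>j<n. exp (- real (N0 + j) * max 0 (s j)))"
    by (simp add: sum_distrib_right)
  also have "(\<Sum>ys\<in>paths n. if ys n \<in> B then path_prob n ys else 0) = prob {\<omega> \<in> space M. Y n \<omega> \<in> B}"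
  proof -
    have "{\<omega> \<in> space M. Y n \<omega> \<in> B} \<in> sets M" by measurable
    from prob_sum_paths[OF this, of n] show ?thesis using e2 by (simp only: cong: sum.cong)
  qed
  finally show ?thesis .
qed

text \<open>Two times are kept because later estimates concern increments between \<open>n0\<close>
  and \<open>n\<close>: \<open>\<phi>\<close> carries the state at the earlier time. Almost surely
  only finitely many values occur, so any pair of functions is integrable.\<close>

lemma expectation_path:
  fixes \<phi> \<psi> :: "(nat \<Rightarrow> nat) \<Rightarrow> 'b::{real_normed_field, banach, second_countable_topology}"
  assumes "n0 \<le> n"
  shows "integrable M (\<lambda>\<omega>. \<phi> (Y n0 \<omega>) * \<psi> (Y n \<omega>))"
    and "expectation (\<lambda>\<omega>. \<phi> (Y n0 \<omega>) * \<psi> (Y n \<omega>)) =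
           (\<Sum>ys\<in>paths n. of_real (path_prob n ys) * (\<phi> (ys n0) * \<psi> (ys n)))"
proof -
  define E where "E ys = {\<omega> \<in> space M. \<forall>j\<le>n. Y j \<omega> = ys j}" for ys
  have [measurable]: "E ys \<in> sets M" for ys unfolding E_def by measurable
  define h where "h \<omega> = (\<Sum>ys\<in>paths n. indicator (E ys) \<omega> *\<^sub>R (\<phi> (ys n0) * \<psi> (ys n)))" for \<omega>
  have hi: "integrable M (\<lambda>\<omega>. indicator (E ys) \<omega> *\<^sub>R c)" for ys and c :: 'b
    by (intro integrable_scaleR_left integrable_real_indicator) (auto simp: emeasure_eq_measure)
  have AEh: "AE \<omega> in M. h \<omega> = \<phi> (Y n0 \<omega>) * \<psi> (Y n \<omega>)"
    using AE_path AE_space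
  proof eventually_elim
    case (elim \<omega>)
    define y where "y = restrict (\<lambda>j. Y j \<omega>) {..n}"
    have y: "y \<in> paths n" using elim by (auto simp: paths_def y_def)
    have "indicator (E ys) \<omega> *\<^sub>R (\<phi> (ys n0) * \<psi> (ys n)) = (if ys = y then \<phi> (ys n0) * \<psi> (ys n) else 0)"
      if "ys \<in> paths n" for ys
    proof -
      have "\<omega> \<in> E ys \<longleftrightarrow> ys = y"
      proof
        assume "\<omega> \<in> E ys"
        then show "ys = y" using that y unfolding paths_def by (intro PiE_ext) (auto simp: E_def y_def)
      qed (use elim in \<open>auto simp: E_def y_def\<close>)
      then show ?thesis by (simp add: indicator_def)
    qed
    then have "h \<omega> = (\<Sum>ys\<in>paths n. if ys = y then \<phi> (ys n0) * \<psi> (ys n) else 0)"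
      unfolding h_def by (intro sum.cong) auto
    also have "\<dots> = \<phi> (y n0) * \<psi> (y n)" using y finite_paths by simp
    finally show ?case using assms by (simp add: y_def)
  qed
  have hint: "integrable M h" unfolding h_def by (intro Bochner_Integration.integrable_sum hi)
  have [measurable]: "(\<lambda>\<omega>. \<phi> (Y n0 \<omega>)) \<in> borel_measurable M" "(\<lambda>\<omega>. \<psi> (Y n \<omega>)) \<in> borel_measurable M"
    by (auto intro: measurable_compose[OF Y_measurable])
  show "integrable M (\<lambda>\<omega>. \<phi> (Y n0 \<omega>) * \<psi> (Y n \<omega>))"
    using integrable_cong_AE_imp[OF hint _ AEh] by simp
  have "expectation (\<lambda>\<omega>. \<phi> (Y n0 \<omega>) * \<psi> (Y n \<omega>)) = expectation h"
    using AEh hint by (intro integral_cong_AE) auto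
  also have "\<dots> = (\<Sum>ys\<in>paths n. prob (E ys) *\<^sub>R (\<phi> (ys n0) * \<psi> (ys n)))"
  proof -
    have "expectation (\<lambda>\<omega>. indicator (E ys) \<omega> *\<^sub>R c) = prob (E ys) *\<^sub>R c" for ys and c :: 'b
      by (subst integral_scaleR_left) (auto simp: emeasure_eq_measure)
    then show ?thesis unfolding h_def by (subst Bochner_Integration.integral_sum) (auto intro: hi)
  qed
  also have "\<dots> = (\<Sum>ys\<in>paths n. of_real (path_prob n ys) * (\<phi> (ys n0) * \<psi> (ys n)))"
    by (intro sum.cong) (auto simp: E_def prob_path scaleR_conv_of_real)
  finally show "expectation (\<lambda>\<omega>. \<phi> (Y n0 \<omega>) * \<psi> (Y n \<omega>)) =
           (\<Sum>ys\<in>paths n. of_real (path_prob n ys) * (\<phi> (ys n0) * \<psi> (ys n)))" .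
qed

lemma markov_step:
  fixes \<phi> \<psi> :: "(nat \<Rightarrow> nat) \<Rightarrow> 'b::{real_normed_field, banach, second_countable_topology}"
  assumes "n0 \<le> n"
  shows "expectation (\<lambda>\<omega>. \<phi> (Y n0 \<omega>) * \<psi> (Y (Suc n) \<omega>)) =
         expectation (\<lambda>\<omega>. \<phi> (Y n0 \<omega>) * gen_step m \<psi> (Y n \<omega>))"
  using assms sum_paths_step[of "\<lambda>ys. \<phi> (ys n0)" n \<psi>]
  by (simp add: expectation_path)

end

section \<open>Exponential moments of the linear functionals\<close>

text \<open>The eigenvector equation of the functional. For \<open>k \<le> m - 2\<close> it is the
  recursion of the binomial coefficients; the last colour closes the cycle, and there it is the
  equation \<open>chi m z = 0\<close>.\<close>

lemma wdot_ucoef: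
  assumes "chi m z = 0" "m \<ge> 3" "k \<in> {1..m-1}"
  shows "of_nat k * wdot m (ucoef z) k = z * ucoef z k"
proof (cases "k \<le> m - 2")
  case True
  obtain j where j: "k = Suc j" using assms(3) by (cases k) auto
  have "ucoef z (Suc k) = ucoef z k * (z + of_nat k) / of_nat k"
    using assms(3) by (simp add: ucoef_eq_prod j)
  then show ?thesis
    using True assms by (simp add: wdot_eq field_simps)
next
  case False
  then have k: "k = m - 1" using assms(3) by auto
  obtain j where j: "m = Suc (Suc j)" using assms(2) by (metis add_2_eq_Suc le_Suc_ex numeral_2_eq_2 numeral_3_eq_3 le_SucE Suc_leD)
  have "(\<Prod>i=1..j. z + of_nat i) * (z + of_nat (Suc j)) = of_nat (fact m)"
    using assms(1) by (simp add: chi_root_iff j)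
  then have p: "(\<Prod>i=1..j. z + of_nat i) * (z + of_nat (Suc j)) = of_nat m * of_nat (Suc j) * fact j"
    by (simp add: j algebra_simps)
  have u: "ucoef z (Suc j) = (\<Prod>i=1..j. z + of_nat i) / fact j"
    by (simp add: ucoef_eq_prod)
  have "ucoef z (Suc j) * (z + of_nat (Suc j)) = of_nat m * of_nat (Suc j)"
    unfolding u using p by (simp add: field_simps)
  then show ?thesis
    using False assms k by (simp add: wdot_eq j algebra_simps)
qed

lemma exp_le_1_plus_square:
  fixes x :: real
  assumes "\<bar>x\<bar> \<le> 1"
  shows "exp x \<le> 1 + x + x\<^sup>2"
proof (cases "x \<ge> 0")
  case True
  then show ?thesis using exp_bound[of x] assms by simp
next
  case False
  define y where "y = - x"
  have y: "0 \<le> y" "y \<le> 1" using False assms by (auto simp: y_def)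
  have "1 \<le> (1 - y + y\<^sup>2) * (1 + y + y\<^sup>2 / 2)"
  proof -
    have "(1 - y + y\<^sup>2) * (1 + y + y\<^sup>2 / 2) = 1 + (y\<^sup>2 / 2 + y ^ 3 / 2 + y ^ 4 / 2)"
      by (simp add: field_simps power2_eq_square power3_eq_cube power4_eq_xxxx)
    then show ?thesis using y by simp
  qed
  also have "\<dots> \<le> (1 - y + y\<^sup>2) * exp y"
    using exp_lower_Taylor_quadratic[OF y(1)] y by (intro mult_left_mono) auto
  finally have "exp (- y) \<le> 1 - y + y\<^sup>2"
    by (simp add: exp_minus field_simps)
  then show ?thesis by (simp add: y_def)
qed

text \<open>A crude form of Hoeffding's lemma: centring removes the linear term of the exponential
  when \<open>c \<le> 1\<close>, and for \<open>c > 1\<close> the bound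
  \<open>x \<le> c \<le> c ^ 2\<close> is enough.\<close>

lemma weighted_exp_le:
  fixes x w :: "'i \<Rightarrow> real"
  assumes "\<And>k. k \<in> K \<Longrightarrow> w k \<ge> 0" "sum w K = 1" "(\<Sum>k\<in>K. w k * x k) = 0"
    and "\<And>k. k \<in> K \<Longrightarrow> \<bar>x k\<bar> \<le> c" "c \<ge> 0"
  shows "(\<Sum>k\<in>K. w k * exp (x k)) \<le> exp (c\<^sup>2)"
proof (cases "c \<le> 1")
  case True
  have "(\<Sum>k\<in>K. w k * exp (x k)) \<le> (\<Sum>k\<in>K. w k * (1 + x k + c\<^sup>2))"
  proof (intro sum_mono mult_left_mono assms(1))
    fix k assume k: "k \<in> K"
    have "exp (x k) \<le> 1 + x k + (x k)\<^sup>2"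
      using assms(4)[OF k] True by (intro exp_le_1_plus_square) auto
    also have "(x k)\<^sup>2 \<le> c\<^sup>2" using assms(4)[OF k] by (metis abs_le_square_iff abs_of_nonneg assms(5))
    finally show "exp (x k) \<le> 1 + x k + c\<^sup>2" by simp
  qed
  also have "\<dots> = 1 + c\<^sup>2"
    using assms(2,3) by (simp add: distrib_left sum.distrib flip: sum_distrib_right)
  also have "\<dots> \<le> exp (c\<^sup>2)" by (rule exp_ge_add_one_self)
  finally show ?thesis .
next
  case False
  have "(\<Sum>k\<in>K. w k * exp (x k)) \<le> (\<Sum>k\<in>K. w k * exp (c\<^sup>2))"
  proof (intro sum_mono mult_left_mono assms(1))
    fix k assume k: "k \<in> K"
    have "x k \<le> c" using assms(4)[OF k] by simp
    also have "\<dots> \<le> c\<^sup>2" using False by (simp add: power2_eq_square)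
    finally show "exp (x k) \<le> exp (c\<^sup>2)" by simp
  qed
  then show ?thesis using assms(2) by (simp flip: sum_distrib_right)
qed

text \<open>The factor 2 leaves room for the mean: the whole bounds an increment minus its
  average.\<close>

definition step_bound :: "nat \<Rightarrow> complex \<Rightarrow> real" where
  "step_bound m z = 2 * (\<Sum>k=1..m-1. cmod (wdot m (ucoef z) k))"

lemma u2_shift:
  assumes "v k > 0" "k \<in> {1..m-1}"
  shows "u2 m z (shift m k v) = u2 m z v + wdot m (ucoef z) k"
  using linear_shift[where k=k and v=v and c="ucoef z", OF assms] by (simp add: u2_eq)

context urn_process
begin

lemma mean_increment:
  assumes "b \<in> A n" "chi m z = 0"
  shows "(\<Sum>k=1..m-1. of_real (real k * real (b k) / rate m b) * wdot m (ucoef z) k) =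
    z / of_nat (N0 + n) * u2 m z b"
proof -
  have "(\<Sum>k=1..m-1. of_real (real k * real (b k) / rate m b) * wdot m (ucoef z) k) =
     (\<Sum>k=1..m-1. of_nat (b k) / of_nat (N0 + n) * (z * ucoef z k))"
    using rate_A[OF assms(1)] wdot_ucoef[OF assms(2) m3] by (intro sum.cong) (auto simp flip: wdot_ucoef)
  also have "\<dots> = z / of_nat (N0 + n) * u2 m z b"
    unfolding u2_eq sum_distrib_left by (intro sum.cong) auto
  finally show ?thesis .
qed

lemma sum_weights_A:
  assumes "b \<in> A n"
  shows "(\<Sum>k=1..m-1. real k * real (b k) / rate m b) = 1"
  using assms N0_pos by (intro sum_weights) (auto simp: states_def)

lemma gen_step_cong_shift:
  assumes "\<And>k. k \<in> {1..m-1} \<Longrightarrow> b k > 0 \<Longrightarrow> \<psi> (shift m k b) = \<psi>' k"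
  shows "gen_step m \<psi> b = (\<Sum>k=1..m-1. of_real (real k * real (b k) / rate m b) * \<psi>' k)"
  unfolding gen_step_def
proof (intro sum.cong refl)
  fix k assume k: "k \<in> {1..m-1}"
  show "of_real (real k * real (b k) / rate m b) * \<psi> (shift m k b) = of_real (real k * real (b k) / rate m b) * \<psi>' k"
    using assms[OF k] by (cases "b k = 0") auto
qed

lemma gen_step_u2:
  assumes "b \<in> A n" "chi m z = 0"
  shows "gen_step m (u2 m z) b = (1 + z / of_nat (N0 + n)) * u2 m z b"
proof -
  have "gen_step m (u2 m z) b =
     (\<Sum>k=1..m-1. of_real (real k * real (b k) / rate m b) * (u2 m z b + wdot m (ucoef z) k))"
    by (intro gen_step_cong_shift u2_shift)
  also have "\<dots> = of_real (\<Sum>k=1..m-1. real k * real (b k) / rate m b) * u2 m z b +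
     (\<Sum>k=1..m-1. of_real (real k * real (b k) / rate m b) * wdot m (ucoef z) k)"
    unfolding of_real_sum sum_distrib_right distrib_left sum.distrib ..
  finally show ?thesis
    unfolding mean_increment[OF assms] sum_weights_A[OF assms(1)] by (simp add: algebra_simps)
qed

text \<open>One step of an Azuma bound. The conditional mean of the new value is
  \<open>1 + z / (N0 + n)\<close> times the old one, so after centring the estimate has the same
  shape with a changed multiplier and can be iterated.\<close>

lemma gen_step_exp_u2:
  assumes b: "b \<in> A n" and z: "chi m z = 0"
  shows "gen_step m (\<lambda>v. exp (Re (\<beta> * u2 m z v))) b \<le>
    exp ((step_bound m z * cmod \<beta>)\<^sup>2) * exp (Re (\<beta> * (1 + z / of_nat (N0 + n)) * u2 m z b))"
proof -
  define w where "w k = real k * real (b k) / rate m b" for k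
  define d where "d k = wdot m (ucoef z) k" for k
  define \<mu> where "\<mu> = z / of_nat (N0 + n) * u2 m z b"
  define x where "x k = Re (\<beta> * (d k - \<mu>))" for k
  have w0: "w k \<ge> 0" for k by (simp add: w_def rate_eq_mass)
  have w1: "(\<Sum>k=1..m-1. w k) = 1" unfolding w_def by (rule sum_weights_A[OF b])
  have mu: "(\<Sum>k=1..m-1. of_real (w k) * d k) = \<mu>"
    unfolding w_def d_def \<mu>_def by (rule mean_increment[OF b z])
  have dle: "cmod (d k) \<le> step_bound m z / 2" if "k \<in> {1..m-1}" for k
    unfolding step_bound_def d_def using member_le_sum[OF that, of "\<lambda>k. cmod (wdot m (ucoef z) k)"] by simp
  have mule: "cmod \<mu> \<le> step_bound m z / 2"
  proof -
    have "cmod \<mu> \<le> (\<Sum>k=1..m-1. w k * (step_bound m z / 2))"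
      unfolding mu[symmetric]
    proof (intro order_trans[OF norm_sum] sum_mono)
      fix k assume "k \<in> {1..m-1}"
      from mult_left_mono[OF dle[OF this] w0[of k]]
      show "cmod (of_real (w k) * d k) \<le> w k * (step_bound m z / 2)"
        using w0[of k] by (simp only: norm_mult norm_of_real abs_of_nonneg)
    qed
    then show ?thesis using w1 by (simp add: flip: sum_distrib_right sum_divide_distrib)
  qed
  have "gen_step m (\<lambda>v. exp (Re (\<beta> * u2 m z v))) b = (\<Sum>k=1..m-1. w k * exp (Re (\<beta> * (u2 m z b + d k))))"
    using gen_step_cong_shift[of b "\<lambda>v. exp (Re (\<beta> * u2 m z v))" "\<lambda>k. exp (Re (\<beta> * (u2 m z b + d k)))"]
    by (simp add: u2_shift d_def w_def)
  also have "\<dots> = exp (Re (\<beta> * (u2 m z b + \<mu>))) * (\<Sum>k=1..m-1. w k * exp (x k))"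
    unfolding sum_distrib_left
  proof (intro sum.cong refl)
    fix k
    have "Re (\<beta> * (u2 m z b + d k)) = Re (\<beta> * (u2 m z b + \<mu>)) + x k" by (simp add: x_def algebra_simps)
    then show "w k * exp (Re (\<beta> * (u2 m z b + d k))) = exp (Re (\<beta> * (u2 m z b + \<mu>))) * (w k * exp (x k))"
      by (simp only: exp_add mult_ac)
  qed
  also have "\<dots> \<le> exp (Re (\<beta> * (u2 m z b + \<mu>))) * exp ((step_bound m z * cmod \<beta>)\<^sup>2)"
  proof (intro mult_left_mono weighted_exp_le w0 w1)
    have "(\<Sum>k=1..m-1. w k * x k) = Re (\<beta> * (\<Sum>k=1..m-1. of_real (w k) * (d k - \<mu>)))"
      by (simp add: x_def sum_distrib_left algebra_simps)
    also have "(\<Sum>k=1..m-1. of_real (w k) * (d k - \<mu>)) = \<mu> - of_real (\<Sum>k=1..m-1. w k) * \<mu>"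
      unfolding right_diff_distrib sum_subtractf mu of_real_sum sum_distrib_right ..
    finally show "(\<Sum>k=1..m-1. w k * x k) = 0" using w1 by simp
    show "\<bar>x k\<bar> \<le> step_bound m z * cmod \<beta>" if "k \<in> {1..m-1}" for k
    proof -
      have "\<bar>x k\<bar> \<le> cmod \<beta> * cmod (d k - \<mu>)" unfolding x_def norm_mult[symmetric] by (rule abs_Re_le_cmod)
      also have "\<dots> \<le> cmod \<beta> * step_bound m z"
        using norm_triangle_ineq4[of "d k" \<mu>] dle[OF that] mule by (intro mult_left_mono) auto
      finally show ?thesis by (simp add: mult.commute)
    qed
    show "0 \<le> step_bound m z * cmod \<beta>" by (simp add: step_bound_def sum_nonneg)
  qed simp
  also have "\<beta> * (u2 m z b + \<mu>) = \<beta> * (1 + z / of_nat (N0 + n)) * u2 m z b"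
    by (simp add: \<mu>_def algebra_simps)
  finally show ?thesis by (simp only: mult.commute)
qed

lemma expectation_exp_step:
  assumes "n0 \<le> n" "chi m z = 0" "\<And>v. \<phi> v \<ge> (0::real)"
  shows "expectation (\<lambda>\<omega>. \<phi> (Y n0 \<omega>) * exp (Re (\<beta> * u2 m z (Y (Suc n) \<omega>)))) \<le>
    exp ((step_bound m z * cmod \<beta>)\<^sup>2) *
    expectation (\<lambda>\<omega>. \<phi> (Y n0 \<omega>) * exp (Re (\<beta> * (1 + z / of_nat (N0 + n)) * u2 m z (Y n \<omega>))))"
proof -
  have "expectation (\<lambda>\<omega>. \<phi> (Y n0 \<omega>) * exp (Re (\<beta> * u2 m z (Y (Suc n) \<omega>)))) =
     expectation (\<lambda>\<omega>. \<phi> (Y n0 \<omega>) * gen_step m (\<lambda>v. exp (Re (\<beta> * u2 m z v))) (Y n \<omega>))"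
    by (rule markov_step[OF assms(1), of \<phi> "\<lambda>v. exp (Re (\<beta> * u2 m z v))"])
  also have "\<dots> \<le> expectation (\<lambda>\<omega>. exp ((step_bound m z * cmod \<beta>)\<^sup>2) *
       (\<phi> (Y n0 \<omega>) * exp (Re (\<beta> * (1 + z / of_nat (N0 + n)) * u2 m z (Y n \<omega>)))))"
  proof (rule integral_mono_AE)
    show "integrable M (\<lambda>\<omega>. \<phi> (Y n0 \<omega>) * gen_step m (\<lambda>v. exp (Re (\<beta> * u2 m z v))) (Y n \<omega>))"
      by (rule expectation_path(1)[OF assms(1)])
    show "integrable M (\<lambda>\<omega>. exp ((step_bound m z * cmod \<beta>)\<^sup>2) *
       (\<phi> (Y n0 \<omega>) * exp (Re (\<beta> * (1 + z / of_nat (N0 + n)) * u2 m z (Y n \<omega>)))))"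
      by (intro integrable_mult_right expectation_path(1)[OF assms(1), of \<phi> "\<lambda>v. exp (Re (\<beta> * (1 + z / of_nat (N0 + n)) * u2 m z v))"])
    show "AE \<omega> in M. \<phi> (Y n0 \<omega>) * gen_step m (\<lambda>v. exp (Re (\<beta> * u2 m z v))) (Y n \<omega>) \<le>
       exp ((step_bound m z * cmod \<beta>)\<^sup>2) * (\<phi> (Y n0 \<omega>) * exp (Re (\<beta> * (1 + z / of_nat (N0 + n)) * u2 m z (Y n \<omega>))))"
      using AE_path
    proof eventually_elim
      case (elim \<omega>)
      then have "Y n \<omega> \<in> A n" by blast
      from mult_left_mono[OF gen_step_exp_u2[OF this assms(2)] assms(3)] show ?case
        by (simp only: mult_ac)
    qed
  qed
  finally show ?thesis by simp
qed

lemma Y0: "AE \<omega> in M. Y 0 \<omega> = x0"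
proof -
  have "prob {\<omega> \<in> space M. Y 0 \<omega> \<in> {x0}} = 1"
    using law[of 0 "\<lambda>_. ss" "\<lambda>_. x0" for ss] by simp
  then show ?thesis using Y_pred[of 0 "{x0}"] by (subst (asm) prob_Collect_eq_1) auto
qed

definition gam :: "complex \<Rightarrow> nat \<Rightarrow> complex" where
  "gam z n = (\<Prod>j<n. 1 + z / of_nat (N0 + j))"

lemma expectation_u2: 
  assumes "chi m z = 0"
  shows "expectation (\<lambda>\<omega>. u2 m z (Y n \<omega>)) = gam z n * u2 m z x0"
    and "integrable M (\<lambda>\<omega>. u2 m z (Y n \<omega>))"
proof -
  have int: "integrable M (\<lambda>\<omega>. \<psi> (Y n \<omega>))" for n and \<psi> :: "_ \<Rightarrow> complex"
    using expectation_path(1)[of n n "\<lambda>_. 1" \<psi>] by simp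
  show "integrable M (\<lambda>\<omega>. u2 m z (Y n \<omega>))" by (rule int)
  show "expectation (\<lambda>\<omega>. u2 m z (Y n \<omega>)) = gam z n * u2 m z x0"
  proof (induction n)
    case 0
    have "expectation (\<lambda>\<omega>. u2 m z (Y 0 \<omega>)) = expectation (\<lambda>\<omega>. u2 m z x0)"
      using int[of "u2 m z" 0] Y0 by (intro integral_cong_AE) auto
    then show ?case by (simp add: gam_def prob_space)
  next
    case (Suc n)
    have "expectation (\<lambda>\<omega>. u2 m z (Y (Suc n) \<omega>)) = expectation (\<lambda>\<omega>. gen_step m (u2 m z) (Y n \<omega>))"
      using markov_step[of n n "\<lambda>_. 1" "u2 m z"] by simp
    also have "\<dots> = expectation (\<lambda>\<omega>. (1 + z / of_nat (N0 + n)) * u2 m z (Y n \<omega>))"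
    proof (rule integral_cong_AE)
      show "AE \<omega> in M. gen_step m (u2 m z) (Y n \<omega>) = (1 + z / of_nat (N0 + n)) * u2 m z (Y n \<omega>)"
        using AE_path by eventually_elim (use gen_step_u2[OF _ assms] in blast)
    qed (use int[of "gen_step m (u2 m z)" n] int[of "u2 m z" n] in auto)
    also have "\<dots> = (1 + z / of_nat (N0 + n)) * expectation (\<lambda>\<omega>. u2 m z (Y n \<omega>))" by simp
    finally show ?case using Suc by (simp add: gam_def mult_ac)
  qed
qed

text \<open>From the multiplier \<open>\<alpha> / gam z (Suc k)\<close> one step back leads to
  \<open>\<alpha> / gam z k\<close>: the normalisation cancels the drift, and only the squared step
  sizes accumulate.\<close>

lemma mgf_martingale:
  assumes z: "chi m z = 0" and nz: "\<And>n. gam z n \<noteq> 0" and "n \<le> k"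
  shows "expectation (\<lambda>\<omega>. exp (Re (\<alpha> * (u2 m z (Y k \<omega>) / gam z k - u2 m z (Y n \<omega>) / gam z n)))) \<le>
    exp ((step_bound m z * cmod \<alpha>)\<^sup>2 * (\<Sum>j=n..<k. 1 / (cmod (gam z (Suc j)))\<^sup>2))"
  using \<open>n \<le> k\<close>
proof (induction k rule: dec_induct)
  case base
  then show ?case by (simp add: prob_space)
next
  case (step k)
  \<comment> \<open>The earlier value is put into \<open>\<phi>\<close>, where the one-step estimate
    leaves it untouched.\<close>
  define \<phi> where "\<phi> v = exp (- Re (\<alpha> * (u2 m z v / gam z n)))" for v
  have eq: "exp (Re (\<alpha> * (u2 m z (Y j \<omega>) / gam z j - u2 m z (Y n \<omega>) / gam z n))) =
     \<phi> (Y n \<omega>) * exp (Re (\<alpha> / gam z j * u2 m z (Y j \<omega>)))" for j \<omega>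
  proof -
    have "\<alpha> * (u2 m z (Y j \<omega>) / gam z j - u2 m z (Y n \<omega>) / gam z n) =
      - (\<alpha> * (u2 m z (Y n \<omega>) / gam z n)) + \<alpha> / gam z j * u2 m z (Y j \<omega>)"
      by (simp add: algebra_simps)
    then show ?thesis by (simp only: \<phi>_def plus_complex.simps uminus_complex.simps exp_add)
  qed
  have a: "\<alpha> / gam z (Suc k) * (1 + z / of_nat (N0 + k)) = \<alpha> / gam z k"
    using nz[of "Suc k"] by (simp add: gam_def)
  have "expectation (\<lambda>\<omega>. exp (Re (\<alpha> * (u2 m z (Y (Suc k) \<omega>) / gam z (Suc k) - u2 m z (Y n \<omega>) / gam z n)))) \<le>
    exp ((step_bound m z * cmod (\<alpha> / gam z (Suc k)))\<^sup>2) *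
    expectation (\<lambda>\<omega>. \<phi> (Y n \<omega>) * exp (Re (\<alpha> / gam z k * u2 m z (Y k \<omega>))))"
    unfolding eq using expectation_exp_step[OF step(1) z, of \<phi> "\<alpha> / gam z (Suc k)"] unfolding a by (simp add: \<phi>_def)
  also have "\<dots> \<le> exp ((step_bound m z * cmod (\<alpha> / gam z (Suc k)))\<^sup>2) *
     exp ((step_bound m z * cmod \<alpha>)\<^sup>2 * (\<Sum>j=n..<k. 1 / (cmod (gam z (Suc j)))\<^sup>2))"
    using step(3) unfolding eq by (intro mult_left_mono) auto
  also have "\<dots> = exp ((step_bound m z * cmod \<alpha>)\<^sup>2 * (\<Sum>j=n..<Suc k. 1 / (cmod (gam z (Suc j)))\<^sup>2))"
    using step(1) by (simp add: norm_divide power_mult_distrib power_divide distrib_left add.commute flip: exp_add)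
  finally show ?case .
qed

lemma mgf_growth:
  assumes z: "chi m z = 0" and G0: "G 0 = 1" and G: "\<And>j. G j > 0"
    and GS: "\<And>j. G (Suc j) \<ge> cmod (1 + z / of_nat (N0 + j)) * G j"
  shows "expectation (\<lambda>\<omega>. exp (Re (\<beta> * u2 m z (Y n \<omega>)))) \<le>
    exp (cmod \<beta> * G n * cmod (u2 m z x0) + (step_bound m z * cmod \<beta> * G n)\<^sup>2 * (\<Sum>j<n. 1 / (G (Suc j))\<^sup>2))"
proof (induction n arbitrary: \<beta>)
  case 0
  have "expectation (\<lambda>\<omega>. exp (Re (\<beta> * u2 m z (Y 0 \<omega>)))) = expectation (\<lambda>\<omega>. exp (Re (\<beta> * u2 m z x0)))"
    using expectation_path(1)[of 0 0 "\<lambda>_. 1" "\<lambda>v. exp (Re (\<beta> * u2 m z v))"] Y0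
    by (intro integral_cong_AE) auto
  also have "\<dots> = exp (Re (\<beta> * u2 m z x0))" by (simp add: prob_space)
  also have "\<dots> \<le> exp (cmod \<beta> * cmod (u2 m z x0))"
    unfolding norm_mult[symmetric] exp_le_cancel_iff by (rule complex_Re_le_cmod)
  finally show ?case using G0 by simp
next
  case (Suc n)
  define g where "g = cmod (1 + z / of_nat (N0 + n))"
  define U where "U = cmod (u2 m z x0)"
  define B where "B = step_bound m z * cmod \<beta>"
  define s where "s = (\<Sum>j<n. 1 / (G (Suc j))\<^sup>2)"
  have g: "g \<ge> 0" "g * G n \<le> G (Suc n)" using GS[of n] by (auto simp: g_def)
  have "expectation (\<lambda>\<omega>. exp (Re (\<beta> * u2 m z (Y (Suc n) \<omega>)))) \<le>
     exp (B\<^sup>2) * expectation (\<lambda>\<omega>. exp (Re (\<beta> * (1 + z / of_nat (N0 + n)) * u2 m z (Y n \<omega>))))"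
    using expectation_exp_step[of n n z "\<lambda>_. 1" \<beta>] z by (simp add: B_def)
  also have "\<dots> \<le> exp (B\<^sup>2) * exp (cmod (\<beta> * (1 + z / of_nat (N0 + n))) * G n * U +
     (step_bound m z * cmod (\<beta> * (1 + z / of_nat (N0 + n))) * G n)\<^sup>2 * s)"
    unfolding U_def s_def by (intro mult_left_mono Suc) auto
  also have "\<dots> = exp (B\<^sup>2 + (cmod \<beta> * (g * G n) * U + (B * (g * G n))\<^sup>2 * s))"
    unfolding exp_add norm_mult g_def B_def by (simp add: mult_ac)
  also have "\<dots> \<le> exp (cmod \<beta> * G (Suc n) * U + (B * G (Suc n))\<^sup>2 * (\<Sum>j<Suc n. 1 / (G (Suc j))\<^sup>2))"
  proof -
    have "cmod \<beta> * (g * G n) * U \<le> cmod \<beta> * G (Suc n) * U"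
      using g by (intro mult_right_mono mult_left_mono) (auto simp: U_def)
    moreover have "(B * (g * G n))\<^sup>2 * s \<le> (B * G (Suc n))\<^sup>2 * s"
      unfolding power_mult_distrib[of B] using g less_imp_le[OF G]
      by (intro mult_right_mono mult_left_mono power_mono) (auto simp: s_def sum_nonneg)
    moreover have "B\<^sup>2 = (B * G (Suc n))\<^sup>2 * (1 / (G (Suc n))\<^sup>2)"
      using G[of "Suc n"] by (simp add: power_mult_distrib)
    ultimately show ?thesis by (simp add: s_def distrib_left)
  qed
  finally show ?case by (simp add: U_def B_def)
qed

end

section \<open>Exponential clocks\<close>

text \<open>Open upper half lines are stable under intersection and generate the Borel sets. The
  product formula is given for all indices together; a subfamily is reached by giving the other
  indices the threshold \<open>c\<close>, which they almost surely exceed.\<close>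

lemma (in prob_space) indep_vars_of_tails:
  fixes X :: "'i \<Rightarrow> 'a \<Rightarrow> real"
  assumes fin: "finite I" and meas: "\<And>i. i \<in> I \<Longrightarrow> X i \<in> borel_measurable M"
    and lower: "\<And>i. i \<in> I \<Longrightarrow> AE \<omega> in M. X i \<omega> > c"
    and tails: "\<And>s. prob {\<omega> \<in> space M. \<forall>i\<in>I. X i \<omega> > s i} = (\<Prod>i\<in>I. prob {\<omega> \<in> space M. X i \<omega> > s i})"
  shows "indep_vars (\<lambda>_. borel) X I"
proof -
  define F where "F i = range (\<lambda>s. {\<omega> \<in> space M. X i \<omega> > s})" for i
  have tail_set: "{\<omega> \<in> space M. X i \<omega> > s} \<in> events" if "i \<in> I" for i s
    using meas[OF that] by measurable
  have "indep_sets F I"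
    unfolding indep_sets_def
  proof (intro conjI ballI allI impI)
    fix i assume "i \<in> I"
    then show "F i \<subseteq> events" using tail_set by (auto simp: F_def)
  next
    fix J A assume J: "J \<subseteq> I" "J \<noteq> {}" "finite J" and A: "A \<in> Pi J F"
    have "\<forall>j\<in>J. \<exists>s. A j = {\<omega> \<in> space M. X j \<omega> > s}" using A by (auto simp: F_def Pi_iff)
    then obtain s where s: "\<And>j. j \<in> J \<Longrightarrow> A j = {\<omega> \<in> space M. X j \<omega> > s j}" by metis
    define s' where "s' i = (if i \<in> J then s i else c)" for i
    have one: "prob {\<omega> \<in> space M. X i \<omega> > c} = 1" if "i \<in> I" for i
      using lower[OF that] tail_set[OF that] by (subst prob_Collect_eq_1) auto
    have all: "{\<omega> \<in> space M. \<forall>i\<in>I. X i \<omega> > s' i} \<in> events"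
      using tail_set fin by (intro sets.sets_Collect_finite_All) auto
    have "prob (\<Inter>j\<in>J. A j) = prob {\<omega> \<in> space M. \<forall>i\<in>I. X i \<omega> > s' i}"
    proof (rule measure_eq_AE)
      have "AE \<omega> in M. \<forall>i\<in>I. X i \<omega> > c" using lower fin by (intro AE_finite_allI) auto
      then show "AE \<omega> in M. (\<omega> \<in> (\<Inter>j\<in>J. A j)) = (\<omega> \<in> {\<omega> \<in> space M. \<forall>i\<in>I. X i \<omega> > s' i})"
        using AE_space
      proof eventually_elim
        case (elim \<omega>)
        then show ?case using J s by (auto simp: s'_def)
      qed
      show "(\<Inter>j\<in>J. A j) \<in> events" using J s tail_set by (intro sets.finite_INT) auto
    qed (rule all)
    also have "\<dots> = (\<Prod>i\<in>I. prob {\<omega> \<in> space M. X i \<omega> > s' i})" by (rule tails)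
    also have "\<dots> = (\<Prod>j\<in>J. prob (A j))"
      using J fin one by (intro prod.mono_neutral_cong_right) (auto simp: s'_def s)
    finally show "prob (\<Inter>j\<in>J. A j) = (\<Prod>j\<in>J. prob (A j))" .
  qed
  moreover have "Int_stable (F i)" for i
  proof (rule Int_stableI)
    fix a b assume "a \<in> F i" "b \<in> F i"
    then obtain s t where "a = {\<omega> \<in> space M. X i \<omega> > s}" "b = {\<omega> \<in> space M. X i \<omega> > t}" by (auto simp: F_def)
    then have "a \<inter> b = {\<omega> \<in> space M. X i \<omega> > max s t}" by auto
    then show "a \<inter> b \<in> F i" unfolding F_def by (rule range_eqI)
  qed
  ultimately have ind: "indep_sets (\<lambda>i. sigma_sets (space M) (F i)) I" by (intro indep_sets_sigma)
  have sub: "{X i -` A \<inter> space M | A. A \<in> sets borel} \<subseteq> sigma_sets (space M) (F i)" for i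
  proof -
    have FP: "F i \<subseteq> Pow (space M)" by (auto simp: F_def)
    have "X i \<in> borel_measurable (sigma (space M) (F i))"
    proof (rule borel_measurableI_greater)
      fix y
      have "{w \<in> space M. y < X i w} \<in> F i" by (auto simp: F_def)
      then show "{w \<in> space (sigma (space M) (F i)). y < X i w} \<in> sets (sigma (space M) (F i))"
        using FP by (simp add: space_measure_of_conv sigma_sets.Basic)
    qed
    then show ?thesis
      using FP by (auto dest: measurable_sets simp: space_measure_of_conv)
  qed
  show ?thesis
    unfolding indep_vars_def2 using meas indep_sets_mono_sets[OF ind sub] by blast
qed

text \<open>The complex argument serves twice: imaginary z for the characteristic function of
  \<open>ln \<xi>\<close>, and a complex root z for the mean of \<open>W\<close>. The integral is
  evaluated through the antiderivative \<open>F\<close>.\<close>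

lemma (in prob_space) exponential_transform:
  fixes z :: complex
  assumes D: "distributed M lborel X (exponential_density r)" and r: "r > 0" and z: "r + Re z > 0"
  shows "integrable M (\<lambda>\<omega>. exp (- z * of_real (X \<omega>)))"
    and "expectation (\<lambda>\<omega>. exp (- z * of_real (X \<omega>))) = of_real r / (of_real r + z)"
proof -
  define w where "w = of_real r + z"
  have w: "Re w > 0" using z by (simp add: w_def)
  then have w0: "w \<noteq> 0" by auto
  define f where "f x = of_real r * exp (- w * of_real x)" for x :: real
  define F where "F x = - (of_real r / w) * exp (- w * of_real x)" for x :: real
  have eq: "exponential_density r x *\<^sub>R exp (- z * of_real x) = indicator {0..} x *\<^sub>R f x" for x
    by (auto simp: exponential_density_def f_def w_def scaleR_conv_of_real exp_add[symmetric] algebra_simps exp_of_real[symmetric])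
  have int0: "integrable lborel (\<lambda>x. indicator {0..} x *\<^sub>R f x)"
  proof (rule Bochner_Integration.integrable_bound)
    interpret E: prob_space "density lborel (exponential_density (Re w))" using w by (intro prob_space_exponential_density)
    have "integrable (density lborel (exponential_density (Re w))) (\<lambda>_. 1 :: real)" by simp
    then have "integrable lborel (exponential_density (Re w))"
      using w by (subst (asm) integrable_density) (auto simp: exponential_density_nonneg)
    then show "integrable lborel (\<lambda>x. r / Re w * exponential_density (Re w) x)" by simp
    show "(\<lambda>x. indicator {0..} x *\<^sub>R f x) \<in> borel_measurable lborel"
      unfolding f_def by measurable
    show "AE x in lborel. norm (indicator {0..} x *\<^sub>R f x) \<le> norm (r / Re w * exponential_density (Re w) x)"
      using r w by (intro AE_I2) (auto simp: f_def norm_mult exponential_density_def indicator_def mult.commute)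
  qed
  have g: "(\<lambda>x. exp (- z * of_real x)) \<in> borel_measurable borel" by measurable
  have dr: "(\<lambda>x. exponential_density r x) \<in> borel_measurable lborel" by measurable
  have distr: "distr M lborel X = density lborel (exponential_density r)"
    using D by (rule distributed_distr_eq_density)
  have Xm: "X \<in> measurable M lborel" using D by (rule distributed_measurable)
  have "integrable (density lborel (exponential_density r)) (\<lambda>x. exp (- z * of_real x))"
    using int0[folded eq] r by (subst integrable_density) (auto simp: exponential_density_nonneg)
  then have "integrable (distr M lborel X) (\<lambda>x. exp (- z * of_real x))" by (simp only: distr)
  then show "integrable M (\<lambda>\<omega>. exp (- z * of_real (X \<omega>)))"
    using Xm g by (subst (asm) integrable_distr_eq) auto
  have "expectation (\<lambda>\<omega>. exp (- z * of_real (X \<omega>))) = (\<integral>x. exp (- z * of_real x) \<partial>distr M lborel X)"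
    using Xm g by (subst integral_distr) auto
  also have "\<dots> = (\<integral>x. exponential_density r x *\<^sub>R exp (- z * of_real x) \<partial>lborel)"
    unfolding distr using r by (subst integral_density) (auto simp: exponential_density_nonneg)
  also have "\<dots> = (\<integral>x. indicator {0..} x *\<^sub>R f x \<partial>lborel)" by (simp only: eq)
  also have "\<dots> = (\<integral>x. indicator {0<..} x *\<^sub>R f x \<partial>lborel)"
  proof (rule integral_cong_AE)
    show "AE x in lborel. indicator {0..} x *\<^sub>R f x = indicator {0<..} x *\<^sub>R f x"
      using AE_lborel_singleton[of 0] by eventually_elim (auto simp: indicator_def)
  qed (auto simp: f_def)
  also have "\<dots> = (LBINT x=ereal 0..\<infinity>. f x)"
    by (simp add: interval_lebesgue_integral_0_infty interval_integral_to_infinity_eq set_lebesgue_integral_def)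
  also have "\<dots> = 0 - (- (of_real r / w))"
  proof (rule interval_integral_FTC_integrable)
    show "(F has_vector_derivative f x) (at x)" for x
    proof -
      have "((\<lambda>x. - (of_real r / w) * exp (- w * x)) has_field_derivative f x) (at (of_real x))"
        using w0 by (auto intro!: derivative_eq_intros simp: f_def)
      from has_vector_derivative_real_field[OF this] show ?thesis
        by (simp add: F_def[abs_def])
    qed
    show "isCont f x" for x unfolding f_def by (intro continuous_intros)
    have e: "einterval (ereal 0) \<infinity> = {0<..}" by (auto simp: einterval_def)
    have "integrable lborel (\<lambda>x. indicator {0<..} x *\<^sub>R (indicator {0..} x *\<^sub>R f x))"
      by (rule integrable_mult_indicator[OF _ int0]) auto
    then show "set_integrable lborel (einterval (ereal 0) \<infinity>) f"
      unfolding e set_integrable_def by (rule Bochner_Integration.integrable_cong[THEN iffD1, rotated 2]) (auto simp: indicator_def)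
    have "(F \<longlongrightarrow> F 0) (at_right 0)"
      unfolding F_def by (intro tendsto_intros)
    moreover have "F 0 = - (of_real r / w)" by (simp add: F_def)
    ultimately have "(F \<longlongrightarrow> - (of_real r / w)) (at_right 0)" by (simp only:)
    then show "((F \<circ> real_of_ereal) \<longlongrightarrow> - (of_real r / w)) (at_right (ereal 0))"
      by (simp only: ereal_tendsto_simps1)
    have "(F \<longlongrightarrow> 0) at_top"
    proof (rule tendsto_norm_zero_cancel)
      have "LIM x at_top. Re w * x :> at_top"
        using w by (intro filterlim_tendsto_pos_mult_at_top[OF tendsto_const _ filterlim_ident])
      then have "LIM x at_top. - (Re w * x) :> at_bot" by (simp add: filterlim_uminus_at_bot)
      then have "((\<lambda>x. cmod (of_real r / w) * exp (- (Re w * x))) \<longlongrightarrow> cmod (of_real r / w) * 0) at_top"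
        by (intro tendsto_intros filterlim_compose[OF exp_at_bot])
      then show "((\<lambda>x. norm (F x)) \<longlongrightarrow> 0) at_top"
        unfolding F_def norm_mult norm_minus_cancel norm_exp_eq_Re by simp
    qed
    then show "((F \<circ> real_of_ereal) \<longlongrightarrow> 0) (at_left \<infinity>)"
      by (simp add: ereal_tendsto_simps)
  qed auto
  finally show "expectation (\<lambda>\<omega>. exp (- z * of_real (X \<omega>))) = of_real r / (of_real r + z)"
    by (simp add: w_def)
qed

section \<open>Compensated clocks and their limit\<close>

lemma sum_inverse_squares_le:
  assumes "a \<ge> (1::real)" "n \<le> k"
  shows "(\<Sum>j=n..<k. 1 / (a + real j)\<^sup>2) \<le> 2 / (a + real n)"
proof -
  have "(\<Sum>j=n..<k. 1 / (a + real j)\<^sup>2) \<le> 2 / (a + real n) - 2 / (a + real k)"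
    using assms(2)
  proof (induction k rule: dec_induct)
    case (step k)
    define x where "x = a + real k"
    have x: "x \<ge> 1" using assms by (simp add: x_def)
    \<comment> \<open>Since \<open>x \<ge> 1\<close>, the square is comparable with
      \<open>x * (x + 1)\<close>, whose reciprocal telescopes.\<close>
    have "x * (x + 1) \<le> 2 * x\<^sup>2" using x by (simp add: power2_eq_square distrib_left)
    then have "2 / (2 * x\<^sup>2) \<le> 2 / (x * (x + 1))"
      using x by (intro frac_le) auto
    then have "1 / x\<^sup>2 \<le> 2 / (x * (x + 1))" by simp
    also have "\<dots> = 2 / x - 2 / (x + 1)" using x by (simp add: field_simps)
    finally show ?case using step by (simp add: x_def algebra_simps)
  qed simp
  also have "\<dots> \<le> 2 / (a + real n)" using assms by simp
  finally show ?thesis .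
qed

text \<open>Increasing because \<open>ln (x + 1) - ln x \<le> 1 / x\<close>, bounded because
  \<open>1 / (x + 1) \<le> ln (x + 1) - ln x\<close>. The limit is the analogue of Euler's constant
  for the shift \<open>a\<close>.\<close>

lemma convergent_harmonic_minus_ln:
  assumes "a \<ge> (1::real)"
  shows "convergent (\<lambda>n. (\<Sum>j<n. 1 / (a + real j)) - ln (a + real n))"
proof -
  define d where "d n = (\<Sum>j<n. 1 / (a + real j)) - ln (a + real n)" for n
  have step: "ln (x + 1) - ln x \<le> 1 / x" "1 / (x + 1) \<le> ln (x + 1) - ln x" if "x \<ge> 1" for x :: real
  proof -
    have "ln (1 + 1 / x) \<le> 1 / x" using that by (intro ln_add_one_self_le_self) auto
    moreover have "ln (x / (x + 1)) \<le> x / (x + 1) - 1" using that by (intro ln_le_minus_one) auto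
    moreover have "ln (1 + 1 / x) = ln (x + 1) - ln x" 
    proof -
      have "1 + 1 / x = (x + 1) / x" using that by (simp add: field_simps)
      then show ?thesis using that by (simp add: ln_div)
    qed
    moreover have "ln (x / (x + 1)) = ln x - ln (x + 1)" using that by (simp add: ln_div)
    moreover have "x / (x + 1) - 1 = - (1 / (x + 1))" using that by (simp add: field_simps)
    ultimately show "ln (x + 1) - ln x \<le> 1 / x" "1 / (x + 1) \<le> ln (x + 1) - ln x" by linarith+
  qed
  have "incseq d"
  proof (rule incseq_SucI)
    fix n show "d n \<le> d (Suc n)"
      using step(1)[of "a + real n"] assms by (simp add: d_def add_ac)
  qed
  moreover have "d n \<le> 1 / a - ln a" for n
  proof -
    have "d n \<le> 1 / a - ln a - 1 / (a + real n)"
    proof (induction n)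
      case (Suc n)
      then show ?case
        using step(2)[of "a + real n"] assms by (simp add: d_def add_ac)
    qed (simp add: d_def)
    also have "\<dots> \<le> 1 / a - ln a" using assms by simp
    finally show ?thesis .
  qed
  ultimately have "convergent d" by (metis incseq_convergent convergentI)
  then show ?thesis by (simp add: d_def[abs_def])
qed

text \<open>The left side is the moment generating function at s of a centred exponential clock of
  rate r, with \<open>x = s / r\<close>.\<close>

lemma inverse_one_minus_exp_le:
  fixes x :: real
  assumes "\<bar>x\<bar> \<le> 1/2"
  shows "inverse (1 - x) * exp (- x) \<le> exp (2 * x\<^sup>2)"
proof -
  have "\<bar>ln (1 + (- x)) - (- x)\<bar> \<le> 2 * (- x)\<^sup>2"
    using assms by (intro abs_ln_one_plus_x_minus_x_bound) auto
  then have "- ln (1 - x) - x \<le> 2 * x\<^sup>2" by simp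
  then have "exp (- ln (1 - x) - x) \<le> exp (2 * x\<^sup>2)" by simp
  moreover have "exp (- ln (1 - x) - x) = inverse (1 - x) * exp (- x)"
  proof -
    have "exp (- ln (1 - x) - x) = exp (- ln (1 - x)) * exp (- x)"
      by (simp only: exp_add[symmetric] diff_conv_add_uminus)
    also have "exp (- ln (1 - x)) = inverse (1 - x)" using assms by (subst exp_minus, subst exp_ln) auto
    finally show ?thesis .
  qed
  ultimately show ?thesis by simp
qed

lemma sum_lessThan_split:
  fixes f :: "nat \<Rightarrow> 'b::ab_group_add"
  assumes "n \<le> k"
  shows "(\<Sum>j<k. f j) - (\<Sum>j<n. f j) = (\<Sum>j=n..<k. f j)"
proof -
  have "(\<Sum>j<k. f j) = (\<Sum>j<n. f j) + (\<Sum>j=n..<k. f j)"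
    unfolding lessThan_atLeast0 using assms by (intro sum.atLeastLessThan_concat[symmetric]) auto
  then show ?thesis by simp
qed

text \<open>Separated from the chain so that the clocks after the n-th jump form another instance,
  with \<open>a + n\<close> in place of \<open>a\<close>. Only the transforms of sums of consecutive
  clocks enter, and they determine the law of the limit.\<close>

locale exp_clocks = prob_space M for M :: "'a measure" +
  fixes a :: real and S :: "nat \<Rightarrow> 'a \<Rightarrow> real"
  assumes a1: "a \<ge> 1"
    and S_measurable [measurable]: "\<And>j. S j \<in> borel_measurable M"
    and transform: "\<And>n k z. n \<le> k \<Longrightarrow> a + real n + Re z > 0 \<Longrightarrow>
      integrable M (\<lambda>\<omega>. exp (- z * of_real (\<Sum>j=n..<k. S j \<omega>))) \<and>
      expectation (\<lambda>\<omega>. exp (- z * of_real (\<Sum>j=n..<k. S j \<omega>))) =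
        (\<Prod>j=n..<k. of_real (a + real j) / (of_real (a + real j) + z))"
begin

definition T :: "nat \<Rightarrow> 'a \<Rightarrow> real" where
  "T n \<omega> = (\<Sum>j<n. S j \<omega>)"

lemma T_measurable [measurable]: "T n \<in> borel_measurable M"
  unfolding T_def by measurable

lemma prod_transform:
  fixes z :: complex
  assumes "n \<le> k" "a + real n + Re z > 0"
  shows "integrable M (\<lambda>\<omega>. exp (- z * of_real (T k \<omega> - T n \<omega>)))"
    and "expectation (\<lambda>\<omega>. exp (- z * of_real (T k \<omega> - T n \<omega>))) =
      (\<Prod>j=n..<k. of_real (a + real j) / (of_real (a + real j) + z))"
proof -
  have "T k \<omega> - T n \<omega> = (\<Sum>j=n..<k. S j \<omega>)" for \<omega>
    unfolding T_def by (rule sum_lessThan_split[OF assms(1)])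
  with transform[OF assms]
  show "integrable M (\<lambda>\<omega>. exp (- z * of_real (T k \<omega> - T n \<omega>)))"
    and "expectation (\<lambda>\<omega>. exp (- z * of_real (T k \<omega> - T n \<omega>))) =
      (\<Prod>j=n..<k. of_real (a + real j) / (of_real (a + real j) + z))" by presburger+
qed

lemma prod_transform_real:
  fixes s :: real
  assumes "n \<le> k" "a + real n + s > 0"
  shows "integrable M (\<lambda>\<omega>. exp (- s * (T k \<omega> - T n \<omega>)))"
    and "expectation (\<lambda>\<omega>. exp (- s * (T k \<omega> - T n \<omega>))) = (\<Prod>j=n..<k. (a + real j) / (a + real j + s))"
proof -
  have e: "exp (- of_real s * of_real (T k \<omega> - T n \<omega>)) = complex_of_real (exp (- s * (T k \<omega> - T n \<omega>)))" for \<omega>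
    by (simp add: exp_of_real[symmetric])
  note P = prod_transform[OF assms(1), of "of_real s", unfolded e]
  show i: "integrable M (\<lambda>\<omega>. exp (- s * (T k \<omega> - T n \<omega>)))"
    using P(1) assms by (simp only: complex_of_real_integrable_eq Re_complex_of_real)
  have "complex_of_real (expectation (\<lambda>\<omega>. exp (- s * (T k \<omega> - T n \<omega>)))) =
    of_real (\<Prod>j=n..<k. (a + real j) / (a + real j + s))"
    using P(2) assms i by simp
  then show "expectation (\<lambda>\<omega>. exp (- s * (T k \<omega> - T n \<omega>))) = (\<Prod>j=n..<k. (a + real j) / (a + real j + s))"
    by (simp only: of_real_eq_iff)
qed

definition L :: "nat \<Rightarrow> 'a \<Rightarrow> real" where
  "L n \<omega> = T n \<omega> - (\<Sum>j<n. 1 / (a + real j))"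

lemma L_measurable [measurable]: "L n \<in> borel_measurable M"
  unfolding L_def by measurable

text \<open>The range of s is of the order of the inverse standard deviation of
  \<open>L k - L n\<close>, whose variance is a sum of \<open>1 / (a + j) ^ 2\<close> and hence of
  order at most \<open>1 / n\<close>.\<close>

lemma mgf_L:
  assumes "n \<le> k" "\<bar>s\<bar> \<le> sqrt (real n + 1) / 2"
  shows "integrable M (\<lambda>\<omega>. exp (s * (L k \<omega> - L n \<omega>)))"
    and "expectation (\<lambda>\<omega>. exp (s * (L k \<omega> - L n \<omega>))) \<le> exp 1"
proof -
  have "sqrt (real n + 1) \<le> sqrt ((real n + 1)\<^sup>2)"
    by (intro real_sqrt_le_mono) (simp add: power2_eq_square)
  \<comment> \<open>Half of the smallest rate involved, so every ratio \<open>s / (a + j)\<close> is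
    at most \<open>1/2\<close> in modulus.\<close>
  then have s_le: "\<bar>s\<bar> \<le> (a + real n) / 2" using assms a1 by simp
  have pos: "a + real n + - s > 0" using s_le a1 by (auto simp: abs_if split: if_splits)
  define h where "h = (\<Sum>j=n..<k. 1 / (a + real j))"
  have e: "exp (s * (L k \<omega> - L n \<omega>)) = exp (- s * h) * exp (- (- s) * (T k \<omega> - T n \<omega>))" for \<omega>
  proof -
    have "L k \<omega> - L n \<omega> = (T k \<omega> - T n \<omega>) - h"
      using sum_lessThan_split[OF assms(1), of "\<lambda>j. 1 / (a + real j)"] unfolding L_def h_def by simp
    then have "s * (L k \<omega> - L n \<omega>) = - s * h + - (- s) * (T k \<omega> - T n \<omega>)"
      by (simp only: minus_minus right_diff_distrib)
    then show ?thesis by (simp only: exp_add)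
  qed
  note P = prod_transform_real[OF assms(1) pos]
  show "integrable M (\<lambda>\<omega>. exp (s * (L k \<omega> - L n \<omega>)))"
    unfolding e using P(1) by (intro integrable_mult_right)
  have "expectation (\<lambda>\<omega>. exp (s * (L k \<omega> - L n \<omega>))) = exp (- s * h) * (\<Prod>j=n..<k. (a + real j) / (a + real j + - s))"
    unfolding e P(2)[symmetric] by (rule Bochner_Integration.integral_mult_right_zero)
  also have "exp (- s * h) = (\<Prod>j=n..<k. exp (- (s / (a + real j))))"
    by (simp add: h_def exp_sum[symmetric] sum_distrib_left sum_negf)
  also have "\<dots> * (\<Prod>j=n..<k. (a + real j) / (a + real j + - s)) = (\<Prod>j=n..<k. inverse (1 - s / (a + real j)) * exp (- (s / (a + real j))))"
    unfolding prod.distrib[symmetric]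
  proof (intro prod.cong refl)
    fix j assume "j \<in> {n..<k}"
    then have "a + real j > 0" "a + real j - s > 0" using pos a1 by auto
    then show "exp (- (s / (a + real j))) * ((a + real j) / (a + real j + - s)) = inverse (1 - s / (a + real j)) * exp (- (s / (a + real j)))"
      by (simp add: field_simps)
  qed
  also have "\<dots> \<le> (\<Prod>j=n..<k. exp (2 * (s / (a + real j))\<^sup>2))"
  proof (intro prod_mono conjI)
    fix j assume j: "j \<in> {n..<k}"
    have ap: "a + real j > 0" using a1 by (simp add: add_pos_nonneg)
    have "\<bar>s\<bar> \<le> (a + real j) / 2" using s_le j by auto
    then have x: "\<bar>s / (a + real j)\<bar> \<le> 1/2" using ap by (simp add: abs_divide field_simps)
    then show "inverse (1 - s / (a + real j)) * exp (- (s / (a + real j))) \<le> exp (2 * (s / (a + real j))\<^sup>2)"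
      by (rule inverse_one_minus_exp_le)
    have "1 - s / (a + real j) > 0" using x by linarith
    then show "0 \<le> inverse (1 - s / (a + real j)) * exp (- (s / (a + real j)))" by simp
  qed
  also have "\<dots> = exp (2 * s\<^sup>2 * (\<Sum>j=n..<k. 1 / (a + real j)\<^sup>2))"
    by (simp add: exp_sum[symmetric] sum_distrib_left power_divide)
  also have "\<dots> \<le> exp 1"
  proof -
    have "2 * s\<^sup>2 * (\<Sum>j=n..<k. 1 / (a + real j)\<^sup>2) \<le> 2 * s\<^sup>2 * (2 / (a + real n))"
      using a1 assms(1) by (intro mult_left_mono sum_inverse_squares_le) auto
    also have "s\<^sup>2 \<le> (sqrt (real n + 1) / 2)\<^sup>2"
      using assms(2) by (metis abs_ge_zero power2_abs power_mono)
    then have "2 * s\<^sup>2 * (2 / (a + real n)) \<le> 2 * ((real n + 1) / 4) * (2 / (a + real n))"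
      using a1 by (intro mult_right_mono mult_left_mono) (auto simp: power_divide)
    also have "\<dots> \<le> 1" using a1 by (simp add: field_simps)
    finally show ?thesis by simp
  qed
  finally show "expectation (\<lambda>\<omega>. exp (s * (L k \<omega> - L n \<omega>))) \<le> exp 1" .
qed

definition Q :: "nat \<Rightarrow> 'a \<Rightarrow> real" where
  "Q n \<omega> = (a + real n) * exp (- T n \<omega>)"

lemma Q_measurable [measurable]: "Q n \<in> borel_measurable M"
  unfolding Q_def by measurable

text \<open>\<open>Q n\<close> is the exponential of minus \<open>L n\<close> and minus the harmonic
  sum corrected by its logarithm, and both converge. Defined as an exponential, the limit is
  positive everywhere and not just almost surely.\<close>

lemma ex_limit:
  "\<exists>\<xi>. \<xi> \<in> borel_measurable M \<and> (\<forall>\<omega>. \<xi> \<omega> > 0) \<and> (AE \<omega> in M. (\<lambda>n. Q n \<omega>) \<longlonglongrightarrow> \<xi> \<omega>)"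
proof -
  have "\<exists>Zi. Zi \<in> borel_measurable M \<and> (AE \<omega> in M. (\<lambda>n. complex_of_real (L n \<omega>)) \<longlonglongrightarrow> Zi \<omega>) \<and>
           moments_decay M 1 (\<lambda>n \<omega>. cmod (complex_of_real (L n \<omega>) - Zi \<omega>))"
  proof (rule AE_limit_of_mgf[where c = "1/2" and K = "exp 1"])
    fix n k :: nat and \<alpha> :: complex
    assume nk: "n \<le> k" and \<alpha>: "cmod \<alpha> = 1 / 2 * real (n + 1) powr (1 / 2)"
    have "\<bar>Re \<alpha>\<bar> \<le> sqrt (real n + 1) / 2"
      using abs_Re_le_cmod[of \<alpha>] \<alpha> by (simp add: powr_half_sqrt add.commute)
    from mgf_L[OF nk this]
    show "integrable M (\<lambda>\<omega>. exp (Re (\<alpha> * (complex_of_real (L k \<omega>) - complex_of_real (L n \<omega>))))) \<and>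
      expectation (\<lambda>\<omega>. exp (Re (\<alpha> * (complex_of_real (L k \<omega>) - complex_of_real (L n \<omega>))))) \<le> exp 1"
      by simp
  qed auto
  then obtain Zi where Zi [measurable]: "Zi \<in> borel_measurable M"
    and lim: "AE \<omega> in M. (\<lambda>n. complex_of_real (L n \<omega>)) \<longlonglongrightarrow> Zi \<omega>" by blast
  obtain c where c: "(\<lambda>n. (\<Sum>j<n. 1 / (a + real j)) - ln (a + real n)) \<longlonglongrightarrow> c"
    using convergent_harmonic_minus_ln[OF a1] by (auto simp: convergent_def)
  define \<xi> where "\<xi> \<omega> = exp (- (Re (Zi \<omega>) + c))" for \<omega>
  have "AE \<omega> in M. (\<lambda>n. Q n \<omega>) \<longlonglongrightarrow> \<xi> \<omega>"
    using lim
  proof eventually_elim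
    case (elim \<omega>)
    have "(\<lambda>n. exp (- (Re (complex_of_real (L n \<omega>)) + ((\<Sum>j<n. 1 / (a + real j)) - ln (a + real n))))) \<longlonglongrightarrow> \<xi> \<omega>"
      unfolding \<xi>_def using elim c by (intro tendsto_intros)
    moreover have "exp (- (Re (complex_of_real (L n \<omega>)) + ((\<Sum>j<n. 1 / (a + real j)) - ln (a + real n)))) = Q n \<omega>" for n
      using a1 by (simp add: L_def Q_def exp_diff exp_minus field_simps)
    ultimately show ?case by simp
  qed
  moreover have "\<xi> \<in> borel_measurable M" unfolding \<xi>_def by measurable
  moreover have "\<xi> \<omega> > 0" for \<omega> by (simp add: \<xi>_def)
  ultimately show ?thesis by blast
qed

end

lemma (in exp_clocks) shifted_clocks: "exp_clocks M (a + real n) (\<lambda>j. S (n + j))"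
proof
  show "a + real n \<ge> 1" using a1 by simp
  show "(\<lambda>\<omega>. S (n + j) \<omega>) \<in> borel_measurable M" for j by measurable
  fix i k :: nat and z :: complex
  assume "i \<le> k" "a + real n + real i + Re z > 0"
  then have P: "integrable M (\<lambda>\<omega>. exp (- z * of_real (\<Sum>j=n+i..<n+k. S j \<omega>)))"
     "expectation (\<lambda>\<omega>. exp (- z * of_real (\<Sum>j=n+i..<n+k. S j \<omega>))) =
        (\<Prod>j=n+i..<n+k. of_real (a + real j) / (of_real (a + real j) + z))"
    using transform[of "n + i" "n + k" z] by auto
  have s: "(\<Sum>j=n+i..<n+k. S j \<omega>) = (\<Sum>j=i..<k. S (n + j) \<omega>)" for \<omega>
    by (intro sum.reindex_bij_witness[of _ "\<lambda>j. n + j" "\<lambda>j. j - n"]) auto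
  have p: "(\<Prod>j=n+i..<n+k. of_real (a + real j) / (of_real (a + real j) + z)) =
      (\<Prod>j=i..<k. of_real (a + real n + real j) / (of_real (a + real n + real j) + z))"
    by (intro prod.reindex_bij_witness[of _ "\<lambda>j. n + j" "\<lambda>j. j - n"]) auto
  show "integrable M (\<lambda>\<omega>. exp (- z * of_real (\<Sum>j=i..<k. S (n + j) \<omega>))) \<and>
      expectation (\<lambda>\<omega>. exp (- z * of_real (\<Sum>j=i..<k. S (n + j) \<omega>))) =
        (\<Prod>j=i..<k. of_real (a + real n + real j) / (of_real (a + real n + real j) + z))"
    using P unfolding s p by blast
qed

section \<open>The Gamma limit\<close>

text \<open>The Pochhammer ratio of \<open>a + z\<close> and \<open>a\<close>. With
  \<open>a = N0\<close> it is the normalisation \<open>gam\<close> of the urn, and its reciprocal is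
  the Laplace transform of the jump time \<open>T n\<close>.\<close>

definition prat :: "real \<Rightarrow> complex \<Rightarrow> nat \<Rightarrow> complex" where
  "prat a z n = (\<Prod>j<n. 1 + z / of_real (a + real j))"

lemma one_plus_divide: "(A :: complex) \<noteq> 0 \<Longrightarrow> 1 + z / A = (A + z) / A"
  by (simp add: add_divide_distrib)

lemma Re_pos_not_nonpos_Int: "Re w > 0 \<Longrightarrow> w \<notin> \<int>\<^sub>\<le>\<^sub>0"
  by (auto elim!: nonpos_Ints_cases)

lemma prat_nonzero:
  assumes "a > 0" "a + Re z > 0"
  shows "prat a z n \<noteq> 0"
proof -
  have "1 + z / of_real (a + real j) \<noteq> 0" for j
  proof
    assume h: "1 + z / of_real (a + real j) = 0"
    have nz: "complex_of_real (a + real j) \<noteq> 0" using assms by (simp only: of_real_eq_0_iff)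
    have "of_real (a + real j) + z = 0"
      using h[unfolded one_plus_divide[OF nz]] nz unfolding divide_eq_0_iff by blast
    then have "Re (of_real (a + real j) + z) = 0" by (simp only: zero_complex.simps)
    then show False using assms by simp
  qed
  then show ?thesis by (simp add: prat_def)
qed

lemma inverse_prat:
  assumes "a > 0"
  shows "(\<Prod>j<n. of_real (a + real j) / (of_real (a + real j) + z)) = 1 / prat a z n"
proof -
  have "of_real (a + real j) / (of_real (a + real j) + z) = inverse (1 + z / of_real (a + real j))" for j
  proof -
    have "complex_of_real (a + real j) \<noteq> 0" using assms by (simp only: of_real_eq_0_iff)
    then have "1 + z / of_real (a + real j) = (of_real (a + real j) + z) / of_real (a + real j)"
      by (rule one_plus_divide)
    then show ?thesis by (simp only: inverse_divide)
  qed
  then show ?thesis by (simp only: prat_def inverse_eq_divide prod_dividef prod.neutral_const)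
qed

lemma prat_limit:
  assumes "a > 0" "a + Re z > 0"
  shows "(\<lambda>n. prat a z n / exp (z * of_real (ln (a + real n)))) \<longlonglongrightarrow> Gamma (of_real a) / Gamma (of_real a + z)"
proof -
  define f where "f n = Gamma_series' (of_real a) n / Gamma_series' (of_real a + z) n" for n
  have ni: "complex_of_real a \<notin> \<int>\<^sub>\<le>\<^sub>0" "of_real a + z \<notin> \<int>\<^sub>\<le>\<^sub>0"
    using assms by (auto intro!: Re_pos_not_nonpos_Int)
  then have nz: "Gamma (of_real a + z) \<noteq> 0" by (simp add: Gamma_eq_zero_iff)
  have "f \<longlonglongrightarrow> Gamma (of_real a) / Gamma (of_real a + z)"
    unfolding f_def using nz by (intro tendsto_divide Gamma_series'_LIMSEQ)
  \<comment> \<open>\<open>Gamma_series'\<close> normalises by powers of \<open>n\<close>; this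
    factor converts them to powers of \<open>a + n\<close>.\<close>
  moreover have "(\<lambda>n. exp (z * of_real (ln (real n / (a + real n))))) \<longlonglongrightarrow> exp (z * of_real (ln 1))"
  proof (intro tendsto_intros)
    have "(\<lambda>n. a / (a + real n)) \<longlonglongrightarrow> 0"
      by (intro tendsto_divide_0[OF tendsto_const] filterlim_at_top_imp_at_infinity
          filterlim_tendsto_add_at_top[OF tendsto_const] filterlim_real_sequentially)
    then have "(\<lambda>n. 1 - a / (a + real n)) \<longlonglongrightarrow> 1 - 0" by (intro tendsto_intros)
    moreover have "1 - a / (a + real n) = real n / (a + real n)" for n using assms by (simp add: field_simps)
    ultimately show "(\<lambda>n. real n / (a + real n)) \<longlonglongrightarrow> 1" by simp
  qed auto
  ultimately have "(\<lambda>n. f n * exp (z * of_real (ln (real n / (a + real n))))) \<longlonglongrightarrow>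
      Gamma (of_real a) / Gamma (of_real a + z) * exp (z * of_real (ln 1))" by (rule tendsto_mult)
  then have "(\<lambda>n. f n * exp (z * of_real (ln (real n / (a + real n))))) \<longlonglongrightarrow>
      Gamma (of_real a) / Gamma (of_real a + z)" by simp
  moreover have "eventually (\<lambda>n. f n * exp (z * of_real (ln (real n / (a + real n)))) =
      prat a z n / exp (z * of_real (ln (a + real n)))) sequentially"
    using eventually_gt_at_top[of 0]
  proof eventually_elim
    case (elim n)
    define p where "p = pochhammer (complex_of_real a) n"
    define p' where "p' = pochhammer (complex_of_real a + z) n"
    have pr: "prat a z n = p' / p"
    proof -
      have "prat a z n = (\<Prod>j<n. (of_real a + z + of_nat j) / (of_real a + of_nat j))"
        unfolding prat_def
      proof (intro prod.cong refl)
        fix j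
        have "complex_of_real (a + real j) \<noteq> 0" using assms by (simp only: of_real_eq_0_iff)
        then show "1 + z / of_real (a + real j) = (of_real a + z + of_nat j) / (of_real a + of_nat j)"
          by (simp add: one_plus_divide add_ac)
      qed
      then show ?thesis by (simp add: p_def p'_def pochhammer_prod prod_dividef lessThan_atLeast0)
    qed
    have p0: "p \<noteq> 0" "p' \<noteq> 0"
      using assms by (auto simp: p_def p'_def pochhammer_eq_0_iff dest!: arg_cong[where f=Re])
    define X where "X = complex_of_real (ln (real n))"
    have f: "f n = exp (of_real a * X) / exp ((of_real a + z) * X) * (p' / p)"
      unfolding f_def Gamma_series'_def p_def[symmetric] p'_def[symmetric] X_def by simp
    have l: "ln (real n / (a + real n)) = ln (real n) - ln (a + real n)" using elim assms by (simp add: ln_div)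
    show ?case unfolding f pr l X_def
      by (simp add: algebra_simps exp_add exp_diff field_simps)
  qed
  ultimately show ?thesis by (rule Lim_transform_eventually)
qed

lemma prat_bounds:
  assumes "a > 0" "a + Re z > 0"
  shows "\<exists>K. \<forall>n. cmod (prat a z n) \<le> K * (a + real n) powr Re z"
    and "\<exists>K. \<forall>n. 1 / cmod (prat a z n) \<le> K * (a + real n) powr (- Re z)"
proof -
  have norm_e: "cmod (exp (z * of_real (ln (a + real n)))) = (a + real n) powr Re z" for n
    using assms by (simp add: powr_def)
  have pos: "(a + real n) powr Re z > 0" for n using assms by simp
  define r where "r n = prat a z n / exp (z * of_real (ln (a + real n)))" for n
  have r0: "r n \<noteq> 0" for n unfolding r_def using prat_nonzero[OF assms] by simp
  have ni: "complex_of_real a \<notin> \<int>\<^sub>\<le>\<^sub>0" "of_real a + z \<notin> \<int>\<^sub>\<le>\<^sub>0"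
    using assms by (auto intro!: Re_pos_not_nonpos_Int)
  have lim: "r \<longlonglongrightarrow> Gamma (of_real a) / Gamma (of_real a + z)"
    unfolding r_def by (rule prat_limit[OF assms])
  then obtain K where K: "\<And>n. cmod (r n) \<le> K"
    by (meson Bseq_def convergentI convergent_imp_Bseq)
  have "cmod (prat a z n) \<le> K * (a + real n) powr Re z" for n
    using K[of n] pos[of n] norm_e[of n] by (simp add: r_def norm_divide field_simps)
  then show "\<exists>K. \<forall>n. cmod (prat a z n) \<le> K * (a + real n) powr Re z" by blast
  have "(\<lambda>n. inverse (r n)) \<longlonglongrightarrow> inverse (Gamma (of_real a) / Gamma (of_real a + z))"
    using ni by (intro tendsto_inverse lim) (simp add: Gamma_eq_zero_iff)
  then obtain K where K: "\<And>n. cmod (inverse (r n)) \<le> K"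
    by (meson Bseq_def convergentI convergent_imp_Bseq)
  have "1 / cmod (prat a z n) \<le> K * (a + real n) powr (- Re z)" for n
    using K[of n] pos[of n] norm_e[of n] prat_nonzero[OF assms, of n]
    by (simp add: r_def norm_divide norm_inverse powr_minus field_simps)
  then show "\<exists>K. \<forall>n. 1 / cmod (prat a z n) \<le> K * (a + real n) powr (- Re z)" by blast
qed

section \<open>Identification of the Gamma law\<close>

definition gamma_pdf :: "real \<Rightarrow> real \<Rightarrow> real" where
  "gamma_pdf a x = (if x \<le> 0 then 0 else x powr (a - 1) * exp (- x) / Gamma a)"

lemma gamma_density_1: "gamma_density a 1 x = ennreal (gamma_pdf a x)"
  by (simp add: gamma_density_def gamma_pdf_def)

lemma gamma_pdf_pos: "x > 0 \<Longrightarrow> gamma_pdf a x = x powr (a - 1) * exp (- x) / Gamma a"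
  by (simp add: gamma_pdf_def)

lemma gamma_pdf_measurable [measurable]: "gamma_pdf a \<in> borel_measurable borel"
  unfolding gamma_pdf_def[abs_def] by measurable

lemma gamma_pdf_nonneg: "a > 0 \<Longrightarrow> gamma_pdf a x \<ge> 0"
  by (simp add: gamma_pdf_def Gamma_real_pos less_imp_le)

lemma nn_integral_gamma_exp:
  assumes a: "a > 0" and s: "s < 1"
  shows "(\<integral>\<^sup>+x. ennreal (gamma_pdf a x * exp (s * x)) \<partial>lborel) = ennreal ((1 - s) powr (- a))"
proof -
  \<comment> \<open>Rescaling by \<open>c\<close> turns the exponent \<open>- (1 - s) * x\<close>
    into \<open>- x\<close>, which leaves the Gamma integral.\<close>
  define c where "c = 1 / (1 - s)"
  have c: "c > 0" using s by (simp add: c_def)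
  have "(\<integral>\<^sup>+x. ennreal (gamma_pdf a x * exp (s * x)) \<partial>lborel) =
     \<bar>c\<bar> * (\<integral>\<^sup>+x. ennreal (gamma_pdf a (0 + c * x) * exp (s * (0 + c * x))) \<partial>lborel)"
    using c by (intro nn_integral_real_affine) auto
  also have "(\<integral>\<^sup>+x. ennreal (gamma_pdf a (0 + c * x) * exp (s * (0 + c * x))) \<partial>lborel) =
     (\<integral>\<^sup>+x. ennreal (c powr (a - 1) / Gamma a) * ennreal (indicator {0..} x * x powr (a - 1) / exp x) \<partial>lborel)"
  proof (rule nn_integral_cong_AE)
    show "AE x in lborel. ennreal (gamma_pdf a (0 + c * x) * exp (s * (0 + c * x))) =
        ennreal (c powr (a - 1) / Gamma a) * ennreal (indicator {0..} x * x powr (a - 1) / exp x)"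
      using AE_lborel_singleton[of 0]
    proof eventually_elim
      case (elim x)
      show ?case
      proof (cases "x > 0")
        case True
        have "(1 - s) * c = 1" using s by (simp add: c_def)
        moreover have "- (c * x) + s * (c * x) = - ((1 - s) * c * x)" by (simp add: algebra_simps)
        ultimately have "- (c * x) + s * (c * x) = - x" by simp
        then have "exp (- (c * x)) * exp (s * (c * x)) = exp (- x)" by (simp only: exp_add[symmetric])
        moreover have "gamma_pdf a (0 + c * x) = (c * x) powr (a - 1) * exp (- (c * x)) / Gamma a"
          using gamma_pdf_pos[of "c * x"] c True by simp
        ultimately have "gamma_pdf a (0 + c * x) * exp (s * (0 + c * x)) =
            (c powr (a - 1) / Gamma a) * (indicator {0..} x * x powr (a - 1) / exp x)"
          using c True by (simp add: powr_mult exp_minus field_simps)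
        then show ?thesis
          using a Gamma_real_pos[OF a] by (subst ennreal_mult[symmetric]) auto
      next
        case False
        then have "x < 0" using elim by simp
        then have "c * x \<le> 0" using c by (simp add: mult_nonneg_nonpos)
        then show ?thesis using \<open>x < 0\<close> by (simp add: gamma_pdf_def indicator_def)
      qed
    qed
  qed
  also have "\<dots> = ennreal (c powr (a - 1) / Gamma a) * ennreal (Gamma a)"
    by (subst nn_integral_cmult) (auto simp: Gamma_conv_nn_integral_real[OF a])
  also have "ennreal \<bar>c\<bar> * (ennreal (c powr (a - 1) / Gamma a) * ennreal (Gamma a)) = ennreal (c powr a)"
    using c Gamma_real_pos[OF a] by (simp add: ennreal_mult[symmetric] powr_diff)
  also have "c powr a = (1 - s) powr (- a)"
    using s by (simp add: c_def powr_def ln_div)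
  finally show ?thesis .
qed

lemma prob_space_gamma:
  assumes "a > 0"
  shows "prob_space (density lborel (gamma_pdf a))"
proof
  show "emeasure (density lborel (gamma_pdf a)) (space (density lborel (gamma_pdf a))) = 1"
    using nn_integral_gamma_exp[OF assms, of 0] by (simp add: emeasure_density)
qed

text \<open>The Mellin transform of the Gamma density on a vertical line is the characteristic
  function of the logarithm.\<close>

lemma char_ln_gamma:
  assumes a: "a > 0"
  shows "(\<integral>x. exp (\<i> * of_real (u * ln x)) \<partial>density lborel (gamma_pdf a)) =
    Gamma (of_real a + \<i> * of_real u) / Gamma (of_real a)"
proof -
  define z where "z = of_real a + \<i> * of_real u"
  have z: "Re z > 0" using a by (simp add: z_def)
  define f where "f t = complex_of_real t powr (z - 1) / of_real (exp t)" for t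
  have fm: "(\<lambda>t. indicator {0<..} t *\<^sub>R f t) \<in> borel_measurable lborel"
  proof -
    have "(\<lambda>t. indicator {0<..} t *\<^sub>R f t) =
        (\<lambda>t. indicator {0<..} t *\<^sub>R (exp ((z - 1) * of_real (ln t)) / of_real (exp t)))"
      by (auto simp: f_def powr_def Ln_of_real indicator_def fun_eq_iff)
    moreover have "(\<lambda>t. indicator {0<..} t *\<^sub>R (exp ((z - 1) * of_real (ln t)) / of_real (exp t))) \<in> borel_measurable lborel"
      by measurable
    ultimately show ?thesis by simp
  qed
  have "(\<integral>x. exp (\<i> * of_real (u * ln x)) \<partial>density lborel (gamma_pdf a)) =
     (\<integral>x. gamma_pdf a x *\<^sub>R exp (\<i> * of_real (u * ln x)) \<partial>lborel)"
    by (subst integral_density) (auto simp: gamma_pdf_nonneg[OF a])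
  also have "\<dots> = (\<integral>x. (indicator {0<..} x *\<^sub>R f x) / of_real (Gamma a) \<partial>lborel)"
  proof (rule Bochner_Integration.integral_cong[OF refl])
    fix x :: real
    show "gamma_pdf a x *\<^sub>R exp (\<i> * of_real (u * ln x)) = (indicator {0<..} x *\<^sub>R f x) / of_real (Gamma a)"
    proof (cases "x > 0")
      case True
      have "complex_of_real x powr (z - 1) = of_real (x powr (a - 1)) * exp (\<i> * of_real (u * ln x))"
      proof -
        have "complex_of_real x powr (z - 1) = exp ((z - 1) * of_real (ln x))"
          using True by (simp add: powr_def Ln_of_real)
        also have "(z - 1) * of_real (ln x) = of_real ((a - 1) * ln x) + \<i> * of_real (u * ln x)"
          by (simp add: z_def algebra_simps)
        also have "exp \<dots> = of_real (x powr (a - 1)) * exp (\<i> * of_real (u * ln x))"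
          using True by (simp add: exp_add powr_def exp_of_real[symmetric])
        finally show ?thesis .
      qed
      then show ?thesis using True
        by (simp add: gamma_pdf_def f_def scaleR_conv_of_real exp_minus exp_of_real field_simps)
    qed (simp add: gamma_pdf_def)
  qed
  also have "\<dots> = (\<integral>x. indicator {0<..} x *\<^sub>R f x \<partial>lborel) / of_real (Gamma a)" by simp
  also have "(\<integral>x. indicator {0<..} x *\<^sub>R f x \<partial>lborel) = (\<integral>x. indicator {0<..} x *\<^sub>R f x \<partial>lebesgue)"
    using fm by (simp add: integral_completion)
  also have "\<dots> = integral {0<..} f"
    using absolutely_integrable_Gamma_integral'[OF z]
    by (subst set_lebesgue_integral_eq_integral(2)[symmetric]) (auto simp: f_def[abs_def] set_lebesgue_integral_def)
  also have "\<dots> = Gamma z"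
    using Gamma_integral_complex'[OF z] unfolding f_def by (rule integral_unique)
  finally show ?thesis by (simp add: z_def Gamma_complex_of_real)
qed

context exp_clocks
begin

lemma T_0 [simp]: "T 0 \<omega> = 0"
  by (simp add: T_def)

lemma transform_T:
  assumes "a + Re z > 0"
  shows "integrable M (\<lambda>\<omega>. exp (- z * of_real (T n \<omega>)))"
    and "expectation (\<lambda>\<omega>. exp (- z * of_real (T n \<omega>))) = 1 / prat a z n"
  using prod_transform[of 0 n z] assms a1 inverse_prat[where a=a and n=n and z=z] by (auto simp: lessThan_atLeast0)

lemma moment_exp_T:
  assumes "r \<ge> 0"
  shows "integrable M (\<lambda>\<omega>. exp (- r * T n \<omega>))"
    and "expectation (\<lambda>\<omega>. exp (- r * T n \<omega>)) = 1 / cmod (prat a (of_real r) n)"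
proof -
  have p: "(\<Prod>j<n. (a + real j) / (a + real j + r)) = 1 / cmod (prat a (of_real r) n)"
  proof -
    have "cmod (1 / prat a (of_real r) n) = (\<Prod>j<n. cmod (of_real (a + real j) / (of_real (a + real j) + of_real r)))"
      using inverse_prat[where a=a and n=n and z="of_real r"] a1 by (simp add: prod_norm)
    also have "\<dots> = (\<Prod>j<n. (a + real j) / (a + real j + r))"
    proof (intro prod.cong refl)
      fix j
      show "cmod (of_real (a + real j) / (of_real (a + real j) + of_real r)) = (a + real j) / (a + real j + r)"
        unfolding of_real_add[symmetric] of_real_divide[symmetric] norm_of_real using a1 assms by simp
    qed
    finally show ?thesis by (simp add: norm_divide)
  qed
  show "integrable M (\<lambda>\<omega>. exp (- r * T n \<omega>))"
    and "expectation (\<lambda>\<omega>. exp (- r * T n \<omega>)) = 1 / cmod (prat a (of_real r) n)"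
    using prod_transform_real[of 0 n r] assms a1 p by (auto simp: lessThan_atLeast0)
qed

text \<open>The mean of an imaginary power of \<open>Q n\<close> comes from the transform of
  \<open>T n\<close> at an imaginary point, hence from an explicit Pochhammer ratio. Having modulus
  one, the power passes to the limit by dominated convergence.\<close>

lemma char_ln_limit:
  assumes [measurable]: "\<xi> \<in> borel_measurable M" and pos: "\<And>\<omega>. \<xi> \<omega> > 0"
    and lim: "AE \<omega> in M. (\<lambda>n. Q n \<omega>) \<longlonglongrightarrow> \<xi> \<omega>"
  shows "expectation (\<lambda>\<omega>. exp (\<i> * of_real (u * ln (\<xi> \<omega>)))) =
    Gamma (of_real a + \<i> * of_real u) / Gamma (of_real a)"
proof (rule LIMSEQ_unique)
  show "(\<lambda>n. expectation (\<lambda>\<omega>. exp (\<i> * of_real (u * ln (Q n \<omega>))))) \<longlonglongrightarrow>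
      expectation (\<lambda>\<omega>. exp (\<i> * of_real (u * ln (\<xi> \<omega>))))"
  proof (rule integral_dominated_convergence[where w = "\<lambda>_. 1"])
    show "AE \<omega> in M. (\<lambda>n. exp (\<i> * of_real (u * ln (Q n \<omega>)))) \<longlonglongrightarrow> exp (\<i> * of_real (u * ln (\<xi> \<omega>)))"
      using lim
    proof eventually_elim
      case (elim \<omega>)
      show ?case using elim pos[of \<omega>] by (intro tendsto_intros) auto
    qed
    show "AE \<omega> in M. norm (exp (\<i> * of_real (u * ln (Q n \<omega>)))) \<le> 1" for n by simp
  qed auto
  have e: "expectation (\<lambda>\<omega>. exp (\<i> * of_real (u * ln (Q n \<omega>)))) =
      inverse (prat a (\<i> * of_real u) n / exp (\<i> * of_real u * of_real (ln (a + real n))))" for n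
  proof -
    have "exp (\<i> * of_real (u * ln (Q n \<omega>))) =
       exp (\<i> * of_real u * of_real (ln (a + real n))) * exp (- (\<i> * of_real u) * of_real (T n \<omega>))" for \<omega>
    proof -
      have "ln (Q n \<omega>) = ln (a + real n) - T n \<omega>" using a1 by (simp add: Q_def ln_mult)
      then have "\<i> * of_real (u * ln (Q n \<omega>)) =
          \<i> * of_real u * of_real (ln (a + real n)) + - (\<i> * of_real u) * of_real (T n \<omega>)"
        by (simp only: of_real_mult of_real_diff) (simp add: algebra_simps)
      then show ?thesis by (simp only: exp_add)
    qed
    then have "expectation (\<lambda>\<omega>. exp (\<i> * of_real (u * ln (Q n \<omega>)))) =
       exp (\<i> * of_real u * of_real (ln (a + real n))) * (1 / prat a (\<i> * of_real u) n)"
      using transform_T(2)[of "\<i> * of_real u" n] a1 by (simp only: integral_mult_right_zero) simp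
    then show ?thesis by (simp add: field_simps)
  qed
  have "Gamma (complex_of_real a) \<noteq> 0" "Gamma (of_real a + \<i> * of_real u) \<noteq> 0"
    using a1 by (auto simp: Gamma_eq_zero_iff dest!: Re_pos_not_nonpos_Int[THEN notE, rotated])
  then have "(\<lambda>n. inverse (prat a (\<i> * of_real u) n / exp (\<i> * of_real u * of_real (ln (a + real n))))) \<longlonglongrightarrow>
     inverse (Gamma (of_real a) / Gamma (of_real a + \<i> * of_real u))"
    using a1 by (intro tendsto_inverse prat_limit) auto
  then show "(\<lambda>n. expectation (\<lambda>\<omega>. exp (\<i> * of_real (u * ln (Q n \<omega>))))) \<longlonglongrightarrow>
    Gamma (of_real a + \<i> * of_real u) / Gamma (of_real a)"
    unfolding e by simp
qed

text \<open>The laws are compared after taking logarithms, where the characteristic functions are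
  known, and brought back by \<open>exp\<close>; this loses nothing because both live on the
  positive reals.\<close>

lemma limit_gamma_distributed:
  assumes \<xi>[measurable]: "\<xi> \<in> borel_measurable M" and pos: "\<And>\<omega>. \<xi> \<omega> > 0"
    and lim: "AE \<omega> in M. (\<lambda>n. Q n \<omega>) \<longlonglongrightarrow> \<xi> \<omega>"
  shows "distributed M lborel \<xi> (gamma_density a 1)"
proof -
  define G where "G = density lborel (gamma_pdf a)"
  have a0: "a > 0" using a1 by simp
  interpret G: prob_space G unfolding G_def by (rule prob_space_gamma[OF a0])
  have sG [measurable_cong]: "sets G = sets borel" by (simp add: G_def)
  have ln_m: "ln \<in> borel_measurable G" by measurable
  have "distr M borel (\<lambda>\<omega>. ln (\<xi> \<omega>)) = distr G borel ln"
  proof (rule Levy_uniqueness)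
    show "real_distribution (distr M borel (\<lambda>\<omega>. ln (\<xi> \<omega>)))" by (rule real_distribution_distr) measurable
    show "real_distribution (distr G borel ln)" by (rule G.real_distribution_distr) (rule ln_m)
    show "char (distr M borel (\<lambda>\<omega>. ln (\<xi> \<omega>))) = char (distr G borel ln)"
    proof
      fix u
      have "char (distr M borel (\<lambda>\<omega>. ln (\<xi> \<omega>))) u = expectation (\<lambda>\<omega>. exp (\<i> * of_real (u * ln (\<xi> \<omega>))))"
        unfolding char_def by (subst integral_distr) auto
      also have "\<dots> = (\<integral>x. exp (\<i> * of_real (u * ln x)) \<partial>G)"
        unfolding char_ln_limit[OF assms] G_def char_ln_gamma[OF a0] ..
      also have "\<dots> = char (distr G borel ln) u"
        unfolding char_def using ln_m by (subst integral_distr) auto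
      finally show "char (distr M borel (\<lambda>\<omega>. ln (\<xi> \<omega>))) u = char (distr G borel ln) u" .
    qed
  qed
  then have "distr (distr M borel (\<lambda>\<omega>. ln (\<xi> \<omega>))) borel exp = distr (distr G borel ln) borel exp" by simp
  then have "distr M borel (exp \<circ> (\<lambda>\<omega>. ln (\<xi> \<omega>))) = distr G borel (exp \<circ> ln)"
    using ln_m by (simp add: distr_distr)
  moreover have "exp \<circ> (\<lambda>\<omega>. ln (\<xi> \<omega>)) = \<xi>" using pos by (auto simp: fun_eq_iff)
  moreover have "distr G borel (exp \<circ> ln) = distr G borel (\<lambda>x. x)"
  proof (rule distr_cong_AE)
    have "AE x in lborel. 0 < ennreal (gamma_pdf a x) \<longrightarrow> (exp \<circ> ln) x = x"
      by (intro AE_I2) (auto simp: gamma_pdf_def ennreal_zero_less_divide split: if_splits)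
    then show "AE x in G. (exp \<circ> ln) x = x"
      unfolding G_def by (subst AE_density) auto
  qed auto
  moreover have "distr G borel (\<lambda>x. x) = G" using sG by (intro distr_id2) auto
  ultimately have "distr M borel \<xi> = G" by simp
  then have "distr M lborel \<xi> = G" by (simp add: distr_cong[OF refl sets_lborel refl])
  then show ?thesis
    unfolding distributed_def G_def gamma_density_1[abs_def]
    by (auto simp: gamma_density_1)
qed

lemma limit_mgf:
  assumes \<xi>[measurable]: "\<xi> \<in> borel_measurable M" and pos: "\<And>\<omega>. \<xi> \<omega> > 0"
    and lim: "AE \<omega> in M. (\<lambda>n. Q n \<omega>) \<longlonglongrightarrow> \<xi> \<omega>" and s: "s < 1"
  shows "integrable M (\<lambda>\<omega>. exp (s * \<xi> \<omega>))"
    and "expectation (\<lambda>\<omega>. exp (s * \<xi> \<omega>)) = (1 - s) powr (- a)"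
proof -
  have a0: "a > 0" using a1 by simp
  have D: "distributed M lborel \<xi> (\<lambda>x. ennreal (gamma_pdf a x))"
  proof -
    have "gamma_density a 1 = (\<lambda>x. ennreal (gamma_pdf a x))" by (simp add: fun_eq_iff gamma_density_1)
    then show ?thesis using limit_gamma_distributed[OF assms(1-3)] by simp
  qed
  have "(\<integral>\<^sup>+\<omega>. ennreal (exp (s * \<xi> \<omega>)) \<partial>M) = (\<integral>\<^sup>+x. ennreal (gamma_pdf a x) * ennreal (exp (s * x)) \<partial>lborel)"
    using distributed_nn_integral[OF D, of "\<lambda>x. ennreal (exp (s * x))"] by simp
  also have "\<dots> = (\<integral>\<^sup>+x. ennreal (gamma_pdf a x * exp (s * x)) \<partial>lborel)"
    by (intro nn_integral_cong) (simp add: ennreal_mult gamma_pdf_nonneg[OF a0])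
  also have "\<dots> = ennreal ((1 - s) powr (- a))" by (rule nn_integral_gamma_exp[OF a0 s])
  finally have nn: "(\<integral>\<^sup>+\<omega>. ennreal (exp (s * \<xi> \<omega>)) \<partial>M) = ennreal ((1 - s) powr (- a))" .
  show "integrable M (\<lambda>\<omega>. exp (s * \<xi> \<omega>))"
    using nn by (intro integrableI_nonneg) auto
  show "expectation (\<lambda>\<omega>. exp (s * \<xi> \<omega>)) = (1 - s) powr (- a)"
    using nn by (intro integral_eq_nn_integral[THEN trans]) auto
qed

section \<open>Fluctuations around the Gamma limit\<close>

lemma limit_central_moment:
  assumes \<xi>[measurable]: "\<xi> \<in> borel_measurable M" and pos: "\<And>\<omega>. \<xi> \<omega> > 0"
    and lim: "AE \<omega> in M. (\<lambda>n. Q n \<omega>) \<longlonglongrightarrow> \<xi> \<omega>"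
  shows "integrable M (\<lambda>\<omega>. (\<xi> \<omega> - a) ^ (2 * q))"
    and "expectation (\<lambda>\<omega>. (\<xi> \<omega> - a) ^ (2 * q)) \<le> 2 * exp (1/2) * fact (2 * q) * 4 ^ q * a powr real q"
proof -
  \<comment> \<open>Half of the inverse standard deviation \<open>1 / sqrt a\<close>: it makes
    \<open>2 * t ^ 2 * a = 1/2\<close>, and \<open>a \<ge> 1\<close> keeps it at most
    \<open>1/2\<close>.\<close>
  define s where "s = 1 / (2 * sqrt a)"
  have s: "0 < s" "s \<le> 1/2" using a1 by (auto simp: s_def field_simps)
  have mgf: "integrable M (\<lambda>\<omega>. exp (t * (\<xi> \<omega> - a))) \<and> expectation (\<lambda>\<omega>. exp (t * (\<xi> \<omega> - a))) \<le> exp (1/2)"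
    if t: "\<bar>t\<bar> = s" for t
  proof
    have t1: "t < 1" using t s by auto
    note P = limit_mgf[OF assms t1]
    have e: "exp (t * (\<xi> \<omega> - a)) = exp (- t * a) * exp (t * \<xi> \<omega>)" for \<omega>
      by (simp add: algebra_simps flip: exp_add)
    show "integrable M (\<lambda>\<omega>. exp (t * (\<xi> \<omega> - a)))" unfolding e by (intro integrable_mult_right P(1))
    have "expectation (\<lambda>\<omega>. exp (t * (\<xi> \<omega> - a))) = exp (- t * a) * (1 - t) powr (- a)"
      unfolding e using P(2) by simp
    also have "\<dots> = (inverse (1 - t) * exp (- t)) powr a"
    proof -
      have "ln (inverse (1 - t) * exp (- t)) = - ln (1 - t) - t" using t1 by (simp add: ln_mult ln_inverse)
      then have "(inverse (1 - t) * exp (- t)) powr a = exp (a * (- ln (1 - t) - t))"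
        using t1 by (simp add: powr_def)
      moreover have "(1 - t) powr (- a) = exp (- a * ln (1 - t))" using t1 by (simp add: powr_def)
      ultimately show ?thesis by (simp add: algebra_simps flip: exp_add)
    qed
    also have "\<dots> \<le> exp (2 * t\<^sup>2) powr a"
      using t t1 s a1 by (intro powr_mono2 inverse_one_minus_exp_le) auto
    also have "\<dots> = exp (1/2)"
    proof -
      have "t\<^sup>2 = s\<^sup>2" using t by (metis power2_abs)
      then have "2 * t\<^sup>2 * a = 1/2" using a1 by (simp add: s_def power_divide power_mult_distrib)
      then show ?thesis by (simp add: powr_def mult.commute)
    qed
    finally show "expectation (\<lambda>\<omega>. exp (t * (\<xi> \<omega> - a))) \<le> exp (1/2)" .
  qed
  have "\<bar>s\<bar> = s" "\<bar>-s\<bar> = s" using s by auto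
  note m = mgf[OF this(1)] mgf[OF this(2)]
  have meas: "(\<lambda>\<omega>. \<xi> \<omega> - a) \<in> borel_measurable M" by measurable
  show "integrable M (\<lambda>\<omega>. (\<xi> \<omega> - a) ^ (2 * q))"
    using m by (intro moment_le_of_mgf(1)[OF meas s(1)]) auto
  have "expectation (\<lambda>\<omega>. (\<xi> \<omega> - a) ^ (2 * q)) \<le> 2 * exp (1/2) * fact (2 * q) / s ^ (2 * q)"
    using m by (intro moment_le_of_mgf(2)[OF meas s(1)]) auto
  also have "s ^ (2 * q) = 1 / (4 ^ q * a powr real q)"
    using a1 by (simp add: s_def power_mult power_divide power_mult_distrib powr_realpow)
  finally show "expectation (\<lambda>\<omega>. (\<xi> \<omega> - a) ^ (2 * q)) \<le> 2 * exp (1/2) * fact (2 * q) * 4 ^ q * a powr real q"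
    by simp
qed

text \<open>\<open>exp (T n) * \<xi>\<close> is the limit belonging to the clocks after the n-th
  jump, so the bound on central moments applies with \<open>a + n\<close> in place of
  \<open>a\<close>.\<close>

lemma shifted_limit:
  assumes \<xi>[measurable]: "\<xi> \<in> borel_measurable M" and pos: "\<And>\<omega>. \<xi> \<omega> > 0"
    and lim: "AE \<omega> in M. (\<lambda>n. Q n \<omega>) \<longlonglongrightarrow> \<xi> \<omega>"
  shows "integrable M (\<lambda>\<omega>. (exp (T n \<omega>) * \<xi> \<omega> - (a + real n)) ^ (2 * q))"
    and "expectation (\<lambda>\<omega>. (exp (T n \<omega>) * \<xi> \<omega> - (a + real n)) ^ (2 * q)) \<le>
      2 * exp (1/2) * fact (2 * q) * 4 ^ q * (a + real n) powr real q"
proof -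
  interpret N: exp_clocks M "a + real n" "\<lambda>j. S (n + j)" by (rule shifted_clocks)
  have NT: "N.T k \<omega> = T (n + k) \<omega> - T n \<omega>" for k \<omega>
  proof -
    have "(\<Sum>j<n+k. S j \<omega>) - (\<Sum>j<n. S j \<omega>) = (\<Sum>j=n..<n+k. S j \<omega>)" by (rule sum_lessThan_split) simp
    also have "\<dots> = (\<Sum>j<k. S (n + j) \<omega>)"
      by (intro sum.reindex_bij_witness[of _ "\<lambda>j. n + j" "\<lambda>j. j - n"]) auto
    finally show ?thesis by (simp add: N.T_def T_def)
  qed
  have NQ: "N.Q k \<omega> = exp (T n \<omega>) * Q (n + k) \<omega>" for k \<omega>
    unfolding N.Q_def Q_def NT by (simp add: exp_diff exp_minus field_simps)
  have l: "AE \<omega> in M. (\<lambda>k. N.Q k \<omega>) \<longlonglongrightarrow> exp (T n \<omega>) * \<xi> \<omega>"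
    using lim
  proof eventually_elim
    case (elim \<omega>)
    from LIMSEQ_ignore_initial_segment[OF elim, of n]
    show ?case unfolding NQ by (intro tendsto_intros) (simp add: add.commute)
  qed
  have m: "(\<lambda>\<omega>. exp (T n \<omega>) * \<xi> \<omega>) \<in> borel_measurable M" by measurable
  show "integrable M (\<lambda>\<omega>. (exp (T n \<omega>) * \<xi> \<omega> - (a + real n)) ^ (2 * q))"
    and "expectation (\<lambda>\<omega>. (exp (T n \<omega>) * \<xi> \<omega> - (a + real n)) ^ (2 * q)) \<le>
      2 * exp (1/2) * fact (2 * q) * 4 ^ q * (a + real n) powr real q"
    using N.limit_central_moment[OF m _ l, of q] pos by auto
qed

text \<open>A factor of size \<open>n\<close> to the power \<open>- \<sigma>\<close> times a
  fluctuation of size \<open>sqrt n\<close>. The two are separated by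
  \<open>x * y \<le> w * x ^ 2 + y ^ 2 / w\<close>, which involves only their individual
  moments.\<close>

lemma fluctuation_decay:
  assumes \<xi>[measurable]: "\<xi> \<in> borel_measurable M" and pos: "\<And>\<omega>. \<xi> \<omega> > 0"
    and lim: "AE \<omega> in M. (\<lambda>n. Q n \<omega>) \<longlonglongrightarrow> \<xi> \<omega>" and \<sigma>: "\<sigma> > 1/2"
  shows "moments_decay M (2 * \<sigma> - 1) (\<lambda>n \<omega>. exp (- \<sigma> * T n \<omega>) * (exp (T n \<omega>) * \<xi> \<omega> - (a + real n)))"
  unfolding moments_decay_def
proof (intro conjI allI)
  fix q :: nat
  define C :: real where "C = 2 * exp (1/2) * fact (2 * (2 * q)) * 4 ^ (2 * q)"
  define r where "r = 4 * real q * \<sigma>"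
  have r: "r \<ge> 0" using \<sigma> by (simp add: r_def)
  obtain K where K: "\<And>n. 1 / cmod (prat a (of_real r) n) \<le> K * (a + real n) powr (- r)"
    using prat_bounds(2)[of a "of_real r"] a1 r by auto
  have K0: "K \<ge> 0"
  proof (rule ccontr)
    assume "\<not> K \<ge> 0"
    then have "K * (a + real 0) powr (- r) < 0" using a1 by (intro mult_neg_pos) auto
    with K[of 0] show False by (smt (verit) divide_nonneg_nonneg norm_ge_zero)
  qed
  show "\<exists>C. \<forall>n. integrable M (\<lambda>\<omega>. (exp (- \<sigma> * T n \<omega>) * (exp (T n \<omega>) * \<xi> \<omega> - (a + real n))) ^ (2 * q)) \<and>
     (\<integral>\<omega>. (exp (- \<sigma> * T n \<omega>) * (exp (T n \<omega>) * \<xi> \<omega> - (a + real n))) ^ (2 * q) \<partial>M) \<le>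
       C * real (n + 1) powr (- ((2 * \<sigma> - 1) * real q))"
  proof (intro exI allI)
    fix n
    define b where "b = a + real n"
    have b: "b \<ge> 1" "b \<ge> real (n + 1)" using a1 by (auto simp: b_def)
    \<comment> \<open>Balances the two terms: with \<open>r = 4 * q * \<sigma>\<close> both
      \<open>w * b powr (- r)\<close> and \<open>b powr (2 * q) / w\<close> become
      \<open>b powr (- ((2 * \<sigma> - 1) * q))\<close>.\<close>
    define w where "w = b powr (real q + 2 * real q * \<sigma>)"
    have w: "w > 0" using b by (simp add: w_def)
    define D where "D \<omega> = exp (T n \<omega>) * \<xi> \<omega> - b" for \<omega>
    have [measurable]: "D \<in> borel_measurable M" unfolding D_def by measurable
    note S = shifted_limit[OF assms(1-3), of n "2 * q", folded b_def, folded D_def]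
    note E = moment_exp_T[OF r, of n]
    define g where "g \<omega> = w * exp (- r * T n \<omega>) + D \<omega> ^ (2 * (2 * q)) / w" for \<omega>
    have g_int: "integrable M g"
      unfolding g_def by (intro Bochner_Integration.integrable_add integrable_mult_right integrable_divide_zero S(1) E(1))
    have le: "(exp (- \<sigma> * T n \<omega>) * D \<omega>) ^ (2 * q) \<le> g \<omega>" for \<omega>
    proof -
      define x where "x = exp (- \<sigma> * T n \<omega>) ^ (2 * q)"
      define y where "y = D \<omega> ^ (2 * q)"
      have xy: "x \<ge> 0" "y \<ge> 0" by (auto simp: x_def y_def power_mult)
      have x2: "x\<^sup>2 = exp (- r * T n \<omega>)"
        unfolding x_def r_def by (simp add: mult_ac flip: exp_of_nat_mult power_mult)
      have y2: "y\<^sup>2 = D \<omega> ^ (2 * (2 * q))"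
        unfolding y_def by (simp add: mult_ac flip: power_mult)
      have "0 \<le> (w * x - y)\<^sup>2" by simp
      then have "2 * (w * x * y) \<le> w\<^sup>2 * x\<^sup>2 + y\<^sup>2" by (simp add: power2_eq_square algebra_simps)
      moreover have "0 \<le> w * x * y" using w xy by simp
      ultimately have "w * (x * y) \<le> w * (w * x\<^sup>2 + y\<^sup>2 / w)"
        using w by (simp add: distrib_left power2_eq_square mult_ac)
      then have "x * y \<le> w * x\<^sup>2 + y\<^sup>2 / w" using w by (simp only: mult_le_cancel_left_pos)
      then show ?thesis by (simp only: power_mult_distrib x_def[symmetric] y_def[symmetric] x2 y2 g_def)
    qed
    have int: "integrable M (\<lambda>\<omega>. (exp (- \<sigma> * T n \<omega>) * D \<omega>) ^ (2 * q))"
    proof (rule Bochner_Integration.integrable_bound[OF g_int])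
      show "AE \<omega> in M. norm ((exp (- \<sigma> * T n \<omega>) * D \<omega>) ^ (2 * q)) \<le> norm (g \<omega>)"
      proof (rule AE_I2)
        fix \<omega>
        have "0 \<le> (exp (- \<sigma> * T n \<omega>) * D \<omega>) ^ (2 * q)" by (simp add: power_mult)
        then show "norm ((exp (- \<sigma> * T n \<omega>) * D \<omega>) ^ (2 * q)) \<le> norm (g \<omega>)"
          using le[of \<omega>] by (simp only: real_norm_def abs_of_nonneg) 
      qed
    qed measurable
    have "(\<integral>\<omega>. (exp (- \<sigma> * T n \<omega>) * D \<omega>) ^ (2 * q) \<partial>M) \<le> (\<integral>\<omega>. g \<omega> \<partial>M)"
      by (intro integral_mono int g_int le)
    also have "\<dots> = w * (1 / cmod (prat a (of_real r) n)) + expectation (\<lambda>\<omega>. D \<omega> ^ (2 * (2 * q))) / w"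
      unfolding g_def using S(1) E by (subst Bochner_Integration.integral_add) auto
    also have "\<dots> \<le> w * (K * b powr (- r)) + (C * b powr real (2 * q)) / w"
      using w K[of n] S(2) by (intro add_mono mult_left_mono divide_right_mono) (auto simp: b_def C_def)
    also have "\<dots> = (K + C) * b powr (- ((2 * \<sigma> - 1) * real q))"
    proof -
      have e1: "w * b powr (- r) = b powr (- ((2 * \<sigma> - 1) * real q))"
        unfolding w_def r_def powr_add[symmetric] by (simp add: algebra_simps)
      have e2: "b powr real (2 * q) / w = b powr (- ((2 * \<sigma> - 1) * real q))"
        unfolding w_def powr_diff[symmetric] by (simp add: algebra_simps)
      have "w * (K * b powr (- r)) + (C * b powr real (2 * q)) / w =
         K * (w * b powr (- r)) + C * (b powr real (2 * q) / w)" by simp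
      also have "\<dots> = (K + C) * b powr (- ((2 * \<sigma> - 1) * real q))" unfolding e1 e2 by (simp add: distrib_right)
      finally show ?thesis .
    qed
    also have "\<dots> \<le> (K + C) * real (n + 1) powr (- ((2 * \<sigma> - 1) * real q))"
      using b K0 \<sigma> by (intro mult_left_mono powr_mono2') (auto simp: C_def)
    finally show "integrable M (\<lambda>\<omega>. (exp (- \<sigma> * T n \<omega>) * (exp (T n \<omega>) * \<xi> \<omega> - (a + real n))) ^ (2 * q)) \<and>
     (\<integral>\<omega>. (exp (- \<sigma> * T n \<omega>) * (exp (T n \<omega>) * \<xi> \<omega> - (a + real n))) ^ (2 * q) \<partial>M) \<le>
       (K + C) * real (n + 1) powr (- ((2 * \<sigma> - 1) * real q))"
      using int by (simp only: D_def b_def simp_thms)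
  qed
qed measurable

end

section \<open>Independence of the jump chain and the clocks\<close>

context urn_process
begin

lemma prob_S: "prob {\<omega> \<in> space M. \<forall>j<n. S j \<omega> > s j} = (\<Prod>j<n. exp (- real (N0 + j) * max 0 (s j)))"
proof -
  have "prob {\<omega> \<in> space M. Y n \<omega> \<in> UNIV \<and> (\<forall>j<n. S j \<omega> > s j)} =
      prob {\<omega> \<in> space M. Y n \<omega> \<in> UNIV} * (\<Prod>j<n. exp (- real (N0 + j) * max 0 (s j)))"
    by (rule prob_Y_S)
  then show ?thesis by (simp only: UNIV_I simp_thms Collect_mem_eq prob_space mult_1_left)
qed

lemma prob_S_single: "prob {\<omega> \<in> space M. S j \<omega> > s} = exp (- real (N0 + j) * max 0 s)"
proof -
  \<comment> \<open>The threshold \<open>-1\<close> is exceeded almost surely, so the other clocks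
    impose no condition.\<close>
  define s' where "s' i = (if i = j then s else -1)" for i
  have "prob {\<omega> \<in> space M. S j \<omega> > s} = prob {\<omega> \<in> space M. \<forall>i<Suc j. S i \<omega> > s' i}"
  proof (rule measure_eq_AE)
    show "AE \<omega> in M. (\<omega> \<in> {\<omega> \<in> space M. S j \<omega> > s}) = (\<omega> \<in> {\<omega> \<in> space M. \<forall>i<Suc j. S i \<omega> > s' i})"
      using AE_path
    proof eventually_elim
      case (elim \<omega>)
      have "S i \<omega> > s' i" if "i \<noteq> j" for i
      proof -
        have "S i \<omega> > 0" using elim by blast
        then show ?thesis using that by (simp add: s'_def)
      qed
      moreover have "s' j = s" by (simp add: s'_def)
      ultimately have "(\<forall>i<Suc j. S i \<omega> > s' i) \<longleftrightarrow> S j \<omega> > s" by (metis lessI)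
      then show ?case by simp
    qed
  qed measurable
  also have "\<dots> = (\<Prod>i<Suc j. exp (- real (N0 + i) * max 0 (s' i)))" by (rule prob_S)
  also have "\<dots> = exp (- real (N0 + j) * max 0 s)"
  proof -
    have "(\<Prod>i<j. exp (- real (N0 + i) * max 0 (s' i))) = 1"
      by (intro prod.neutral) (auto simp: s'_def)
    then show ?thesis by (simp add: s'_def)
  qed
  finally show ?thesis .
qed

lemma S_exponential: "distributed M lborel (S j) (exponential_density (real N0 + real j))"
proof -
  have "prob {\<omega> \<in> space M. S j \<omega> \<le> t} = 1 - exp (- t * (real N0 + real j))" if "t \<ge> 0" for t
  proof -
    have "{\<omega> \<in> space M. S j \<omega> \<le> t} = space M - {\<omega> \<in> space M. S j \<omega> > t}" by auto
    then have "prob {\<omega> \<in> space M. S j \<omega> \<le> t} = 1 - prob {\<omega> \<in> space M. S j \<omega> > t}"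
      by (simp add: prob_compl)
    then show ?thesis using prob_S_single[where j=j and s=t] that by (simp add: algebra_simps)
  qed
  then show ?thesis
    using N0_pos by (subst exponential_distributed_iff) auto
qed

lemma S_transform:
  assumes "real N0 + real j + Re z > 0"
  shows "integrable M (\<lambda>\<omega>. exp (- z * of_real (S j \<omega>)))"
    and "expectation (\<lambda>\<omega>. exp (- z * of_real (S j \<omega>))) = of_real (real N0 + real j) / (of_real (real N0 + real j) + z)"
  using exponential_transform[OF S_exponential[of j] _ assms] N0_pos by auto

text \<open>The chain is placed at index 0 and the clocks at the successors, so that one family of
  real variables expresses the joint independence. The criterion is for real values; the complex
  \<open>u2\<close> enters through its real and imaginary parts.\<close>

lemma indep_f_S:
  fixes f :: "(nat \<Rightarrow> nat) \<Rightarrow> real"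
  shows "indep_vars (\<lambda>_. borel) (\<lambda>i. case i of 0 \<Rightarrow> (\<lambda>\<omega>. f (Y n \<omega>)) | Suc j \<Rightarrow> S j) {..n}"
proof -
  define X where "X i = (case i of 0 \<Rightarrow> (\<lambda>\<omega>. f (Y n \<omega>)) | Suc j \<Rightarrow> S j)" for i
  have X0: "X 0 \<omega> = f (Y n \<omega>)" and XS: "X (Suc j) = S j" for j \<omega> by (auto simp: X_def)
  have fm: "(\<lambda>\<omega>. f (Y n \<omega>)) \<in> borel_measurable M" by (rule measurable_compose[OF Y_measurable]) simp
  \<comment> \<open>Below zero and below every value of \<open>f\<close> on the finitely many states
    reachable after n jumps.\<close>
  define c where "c = - 1 - (\<Sum>y\<in>A n. \<bar>f y\<bar>)"
  have "0 \<le> (\<Sum>y\<in>A n. \<bar>f y\<bar>)" by (intro sum_nonneg) auto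
  then have c: "c < 0" unfolding c_def by linarith
  have all_iff: "(\<forall>i\<in>{..n}. P i) \<longleftrightarrow> P 0 \<and> (\<forall>j<n. P (Suc j))" for P
    by (metis Suc_leI atMost_iff le0 less_Suc_eq_le not0_implies_Suc Suc_le_lessD)
  have "indep_vars (\<lambda>_. borel) X {..n}"
  proof (rule indep_vars_of_tails)
    show "X i \<in> borel_measurable M" for i
      using fm by (cases i) (auto simp: X_def)
    show "AE \<omega> in M. X i \<omega> > c" for i
      using AE_path
    proof eventually_elim
      case (elim \<omega>)
      show ?case
      proof (cases i)
        case 0
        have "Y n \<omega> \<in> A n" using elim by blast
        then have "\<bar>f (Y n \<omega>)\<bar> \<le> (\<Sum>y\<in>A n. \<bar>f y\<bar>)" using finite_states by (intro member_le_sum) auto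
        then show ?thesis using 0 by (simp add: X0 c_def)
      next
        case (Suc j)
        have "S j \<omega> > 0" using elim by blast
        then show ?thesis using c Suc by (simp add: XS)
      qed
    qed
    show "prob {\<omega> \<in> space M. \<forall>i\<in>{..n}. X i \<omega> > s i} = (\<Prod>i\<in>{..n}. prob {\<omega> \<in> space M. X i \<omega> > s i})" for s
    proof -
      have "prob {\<omega> \<in> space M. \<forall>i\<in>{..n}. X i \<omega> > s i} =
          prob {\<omega> \<in> space M. Y n \<omega> \<in> {y. f y > s 0} \<and> (\<forall>j<n. S j \<omega> > s (Suc j))}"
        unfolding all_iff X0 XS by (simp only: mem_Collect_eq)
      also have "\<dots> = prob {\<omega> \<in> space M. Y n \<omega> \<in> {y. f y > s 0}} * (\<Prod>j<n. exp (- real (N0 + j) * max 0 (s (Suc j))))"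
        by (rule prob_Y_S)
      also have "\<dots> = prob {\<omega> \<in> space M. X 0 \<omega> > s 0} * (\<Prod>j<n. prob {\<omega> \<in> space M. X (Suc j) \<omega> > s (Suc j)})"
        unfolding X0 XS prob_S_single by (simp only: mem_Collect_eq)
      also have "\<dots> = (\<Prod>i\<le>n. prob {\<omega> \<in> space M. X i \<omega> > s i})"
        by (rule prod.atMost_shift[symmetric])
      finally show ?thesis .
    qed
  qed simp
  then show ?thesis by (simp only: X_def[abs_def])
qed

lemma indep_S: "indep_vars (\<lambda>_. borel) S {..<n}"
proof (rule indep_vars_of_tails[where c = 0])
  show "AE \<omega> in M. S i \<omega> > 0" for i using AE_path by eventually_elim blast
  show "prob {\<omega> \<in> space M. \<forall>i\<in>{..<n}. S i \<omega> > s i} = (\<Prod>i\<in>{..<n}. prob {\<omega> \<in> space M. S i \<omega> > s i})" for s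
    using prob_S[of n s] by (simp only: prob_S_single lessThan_iff Ball_def)
qed auto

sublocale clocks: exp_clocks M "real N0" S
proof
  show "real N0 \<ge> 1" using N0_pos by simp
  fix n k :: nat and z :: complex
  assume nk: "n \<le> k" and z: "real N0 + real n + Re z > 0"
  have e: "exp (- z * of_real (\<Sum>j=n..<k. S j \<omega>)) = (\<Prod>j=n..<k. exp (- z * of_real (S j \<omega>)))" for \<omega>
    by (simp add: exp_sum[symmetric] sum_distrib_left)
  have "indep_vars (\<lambda>_. borel) S {n..<k}"
    by (rule indep_vars_subset[OF indep_S[of k]]) auto
  then have ind: "indep_vars (\<lambda>_. borel) (\<lambda>j \<omega>. exp (- z * of_real (S j \<omega>))) {n..<k}"
    by (rule indep_vars_compose2) measurable
  have int: "integrable M (\<lambda>\<omega>. exp (- z * of_real (S j \<omega>)))"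
    and ex: "expectation (\<lambda>\<omega>. exp (- z * of_real (S j \<omega>))) = of_real (real N0 + real j) / (of_real (real N0 + real j) + z)"
    if "j \<in> {n..<k}" for j
    using S_transform[of j z] that z by auto
  show "integrable M (\<lambda>\<omega>. exp (- z * of_real (\<Sum>j=n..<k. S j \<omega>))) \<and>
      expectation (\<lambda>\<omega>. exp (- z * of_real (\<Sum>j=n..<k. S j \<omega>))) =
        (\<Prod>j=n..<k. of_real (real N0 + real j) / (of_real (real N0 + real j) + z))"
    unfolding e
  proof
    show "integrable M (\<lambda>\<omega>. \<Prod>j=n..<k. exp (- z * of_real (S j \<omega>)))"
      by (rule indep_vars_integrable[OF _ ind int]) simp
    have "expectation (\<lambda>\<omega>. \<Prod>j=n..<k. exp (- z * of_real (S j \<omega>))) =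
        (\<Prod>j=n..<k. expectation (\<lambda>\<omega>. exp (- z * of_real (S j \<omega>))))"
      by (rule indep_vars_lebesgue_integral[OF _ ind int]) simp
    then show "expectation (\<lambda>\<omega>. \<Prod>j=n..<k. exp (- z * of_real (S j \<omega>))) =
        (\<Prod>j=n..<k. of_real (real N0 + real j) / (of_real (real N0 + real j) + z))"
      using ex by (simp only: cong: prod.cong)
  qed
qed simp

lemma gam_eq_prat: "gam z n = prat (real N0) z n"
  by (simp add: gam_def prat_def)

lemma expectation_f_T:
  fixes f :: "(nat \<Rightarrow> nat) \<Rightarrow> real"
  assumes z: "real N0 + Re z > 0"
  shows "integrable M (\<lambda>\<omega>. of_real (f (Y n \<omega>)) * exp (- z * of_real (clocks.T n \<omega>)))"
    and "expectation (\<lambda>\<omega>. of_real (f (Y n \<omega>)) * exp (- z * of_real (clocks.T n \<omega>))) =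
       of_real (expectation (\<lambda>\<omega>. f (Y n \<omega>))) * (1 / gam z n)"
proof -
  define X where "X i = (case i of 0 \<Rightarrow> (\<lambda>\<omega>. f (Y n \<omega>)) | Suc j \<Rightarrow> S j)" for i
  define g where "g i x = (if i = (0::nat) then of_real x else exp (- z * of_real x))" for i and x :: real
  have X0: "X 0 \<omega> = f (Y n \<omega>)" and XS: "X (Suc j) = S j" for j \<omega> by (auto simp: X_def)
  have ind0: "indep_vars (\<lambda>_. borel) X {..n}" unfolding X_def by (rule indep_f_S)
  have gm: "g i \<in> borel_measurable borel" for i
    by (cases "i = 0") (auto simp: g_def[abs_def])
  have ind: "indep_vars (\<lambda>_. borel) (\<lambda>i \<omega>. g i (X i \<omega>)) {..n}"
    using indep_vars_compose2[OF ind0, of g "\<lambda>_. borel"] gm by blast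
  have intf: "integrable M (\<lambda>\<omega>. f (Y n \<omega>))"
    using expectation_path(1)[of n n "\<lambda>_. 1" f] by simp
  have ex: "integrable M (\<lambda>\<omega>. exp (- z * of_real (S j \<omega>)))"
    "expectation (\<lambda>\<omega>. exp (- z * of_real (S j \<omega>))) = of_real (real N0 + real j) / (of_real (real N0 + real j) + z)" for j
    using S_transform[of j z] z by auto
  have int: "integrable M (\<lambda>\<omega>. g i (X i \<omega>))" for i
    using intf ex(1) by (cases i) (auto simp: g_def X0 XS)
  have e: "(\<Prod>i\<le>n. g i (X i \<omega>)) = of_real (f (Y n \<omega>)) * exp (- z * of_real (clocks.T n \<omega>))" for \<omega>
  proof -
    have "exp (- z * of_real (clocks.T n \<omega>)) = (\<Prod>j<n. exp (- z * of_real (S j \<omega>)))"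
      by (simp add: clocks.T_def exp_sum[symmetric] sum_distrib_left)
    then show ?thesis unfolding prod.atMost_shift by (simp add: g_def X0 XS)
  qed
  show "integrable M (\<lambda>\<omega>. of_real (f (Y n \<omega>)) * exp (- z * of_real (clocks.T n \<omega>)))"
    unfolding e[symmetric] by (rule indep_vars_integrable[OF _ ind int]) simp
  have "expectation (\<lambda>\<omega>. of_real (f (Y n \<omega>)) * exp (- z * of_real (clocks.T n \<omega>))) =
     (\<Prod>i\<le>n. expectation (\<lambda>\<omega>. g i (X i \<omega>)))"
    unfolding e[symmetric] by (rule indep_vars_lebesgue_integral[OF _ ind int]) simp
  also have "\<dots> = of_real (expectation (\<lambda>\<omega>. f (Y n \<omega>))) *
      (\<Prod>j<n. of_real (real N0 + real j) / (of_real (real N0 + real j) + z))"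
    unfolding prod.atMost_shift using intf ex(2) by (simp add: g_def X0 XS)
  also have "(\<Prod>j<n. of_real (real N0 + real j) / (of_real (real N0 + real j) + z)) = 1 / gam z n"
    unfolding gam_eq_prat using N0_pos by (intro inverse_prat) simp
  finally show "expectation (\<lambda>\<omega>. of_real (f (Y n \<omega>)) * exp (- z * of_real (clocks.T n \<omega>))) =
       of_real (expectation (\<lambda>\<omega>. f (Y n \<omega>))) * (1 / gam z n)" .
qed

text \<open>The urn contributes the factor \<open>gam z n\<close> and the independent clocks its
  reciprocal, so the product keeps its initial mean. This is how \<open>W\<close> gets its
  expectation.\<close>

lemma expectation_u2_T:
  assumes chi: "chi m z = 0" and z: "real N0 + Re z > 0"
  shows "expectation (\<lambda>\<omega>. u2 m z (Y n \<omega>) * exp (- z * of_real (clocks.T n \<omega>))) = u2 m z x0"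
proof -
  define R I where "R v = Re (u2 m z v)" and "I v = Im (u2 m z v)" for v
  note FR = expectation_f_T[OF z, of R n] and FI = expectation_f_T[OF z, of I n]
  have u: "u2 m z v = of_real (R v) + \<i> * of_real (I v)" for v
    by (simp add: R_def I_def complex_eq_iff)
  have ir: "integrable M (\<lambda>\<omega>. R (Y n \<omega>))" "integrable M (\<lambda>\<omega>. I (Y n \<omega>))"
    using expectation_path(1)[of n n "\<lambda>_. 1" R] expectation_path(1)[of n n "\<lambda>_. 1" I] by auto
  have "expectation (\<lambda>\<omega>. u2 m z (Y n \<omega>) * exp (- z * of_real (clocks.T n \<omega>))) =
     expectation (\<lambda>\<omega>. of_real (R (Y n \<omega>)) * exp (- z * of_real (clocks.T n \<omega>)) +
        \<i> * (of_real (I (Y n \<omega>)) * exp (- z * of_real (clocks.T n \<omega>))))"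
    unfolding u by (simp only: distrib_right mult.assoc)
  also have "\<dots> = of_real (expectation (\<lambda>\<omega>. R (Y n \<omega>))) * (1 / gam z n) +
      \<i> * (of_real (expectation (\<lambda>\<omega>. I (Y n \<omega>))) * (1 / gam z n))"
    unfolding FR(2)[symmetric] FI(2)[symmetric] using FR(1) FI(1)
    by (subst Bochner_Integration.integral_add) (auto simp del: mult_minus_left)
  also have "\<dots> = (of_real (expectation (\<lambda>\<omega>. R (Y n \<omega>))) + \<i> * of_real (expectation (\<lambda>\<omega>. I (Y n \<omega>)))) / gam z n"
    by (simp add: add_divide_distrib)
  also have "of_real (expectation (\<lambda>\<omega>. R (Y n \<omega>))) + \<i> * of_real (expectation (\<lambda>\<omega>. I (Y n \<omega>))) =
      expectation (\<lambda>\<omega>. u2 m z (Y n \<omega>))"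
    unfolding u using ir by simp
  also have "\<dots> = gam z n * u2 m z x0" by (rule expectation_u2(1)[OF chi])
  also have "gam z n * u2 m z x0 / gam z n = u2 m z x0"
    using prat_nonzero[of "real N0" z n] N0_pos z by (simp add: gam_eq_prat)
  finally show ?thesis .
qed

end

section \<open>Asymptotics of the jump chain\<close>

text \<open>Comparison with an integral, in the form of the mean value theorem for the power
  \<open>1 - s\<close>, so that the sum telescopes.\<close>

lemma tail_sum_powr:
  assumes s: "s > 1" and "n \<le> k"
  shows "(\<Sum>j=n..<k. real (j + 2) powr (- s)) \<le> real (n + 1) powr (1 - s) / (s - 1)"
proof -
  have step: "real (j + 2) powr (- s) \<le> (real (j + 1) powr (1 - s) - real (j + 2) powr (1 - s)) / (s - 1)" for j
  proof -
    have "\<exists>y. real (j + 1) < y \<and> y < real (j + 2) \<and>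
        real (j + 2) powr (1 - s) - real (j + 1) powr (1 - s) = (real (j + 2) - real (j + 1)) * ((1 - s) * y powr (1 - s - 1))"
      by (rule MVT2) (auto intro!: derivative_eq_intros has_real_derivative_powr)
    then obtain y where y: "real (j + 1) < y" "y < real (j + 2)"
      "real (j + 2) powr (1 - s) - real (j + 1) powr (1 - s) = (1 - s) * y powr (- s)" by auto
    have "real (j + 2) powr (- s) \<le> y powr (- s)" using y s by (intro powr_mono2') auto
    also have "\<dots> = (real (j + 1) powr (1 - s) - real (j + 2) powr (1 - s)) / (s - 1)"
      using y(3) s by (simp add: field_simps)
    finally show ?thesis .
  qed
  have "(\<Sum>j=n..<k. real (j + 2) powr (- s)) \<le>
      (\<Sum>j=n..<k. (real (j + 1) powr (1 - s) - real (j + 2) powr (1 - s)) / (s - 1))"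
    by (intro sum_mono step)
  also have "\<dots> = (real (n + 1) powr (1 - s) - real (k + 1) powr (1 - s)) / (s - 1)"
    using assms(2) by (induction k rule: dec_induct) (auto simp: diff_divide_distrib)
  also have "\<dots> \<le> real (n + 1) powr (1 - s) / (s - 1)"
    using s by (intro divide_right_mono) auto
  finally show ?thesis .
qed

context urn_process
begin

lemma u2_Y_measurable [measurable]: "(\<lambda>\<omega>. u2 m z (Y n \<omega>)) \<in> borel_measurable M"
  by (rule measurable_compose[OF Y_measurable]) simp

lemma sum_inverse_square_gam:
  assumes K: "\<And>n. 1 / g n \<le> K * (real N0 + real n) powr (- \<sigma>)" and g: "\<And>n. g n > (0::real)"
    and \<sigma>: "\<sigma> > 1/2" and "n \<le> k"
  shows "(\<Sum>j=n..<k. 1 / (g (Suc j))\<^sup>2) \<le> K\<^sup>2 * (real (n + 1) powr (1 - 2 * \<sigma>) / (2 * \<sigma> - 1))"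
proof -
  have "(\<Sum>j=n..<k. 1 / (g (Suc j))\<^sup>2) \<le> (\<Sum>j=n..<k. K\<^sup>2 * real (j + 2) powr (- (2 * \<sigma>)))"
  proof (rule sum_mono)
    fix j
    have "0 < real N0 + real (Suc j)" by simp
    have "1 / (g (Suc j))\<^sup>2 = (1 / g (Suc j))\<^sup>2" by (simp add: power_divide)
    also have "\<dots> \<le> (K * (real N0 + real (Suc j)) powr (- \<sigma>))\<^sup>2"
      using K[of "Suc j"] g[of "Suc j"] by (intro power_mono) auto
    also have "\<dots> = K\<^sup>2 * (real N0 + real (Suc j)) powr (- (2 * \<sigma>))"
    proof -
      have "((real N0 + real (Suc j)) powr (- \<sigma>))\<^sup>2 = (real N0 + real (Suc j)) powr (- (2 * \<sigma>))"
        by (simp add: power2_eq_square flip: powr_add)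
      then show ?thesis by (simp only: power_mult_distrib)
    qed
    \<comment> \<open>Uses \<open>N0 \<ge> 1\<close>, so \<open>N0 + Suc j\<close> is at least
      \<open>j + 2\<close>.\<close>
    also have "\<dots> \<le> K\<^sup>2 * real (j + 2) powr (- (2 * \<sigma>))"
      using N0_pos \<sigma> by (intro mult_left_mono powr_mono2') auto
    finally show "1 / (g (Suc j))\<^sup>2 \<le> K\<^sup>2 * real (j + 2) powr (- (2 * \<sigma>))" .
  qed
  also have "\<dots> = K\<^sup>2 * (\<Sum>j=n..<k. real (j + 2) powr (- (2 * \<sigma>)))" by (simp only: sum_distrib_left)
  also have "\<dots> \<le> K\<^sup>2 * (real (n + 1) powr (1 - 2 * \<sigma>) / (2 * \<sigma> - 1))"
    using \<sigma> \<open>n \<le> k\<close> by (intro mult_left_mono tail_sum_powr) auto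
  finally show ?thesis .
qed

text \<open>After n the squared step sizes sum to the order of \<open>n\<close> to the power
  \<open>1 - 2 * Re z\<close>. This dictates \<open>\<beta> = 2 * Re z - 1\<close>, positive exactly
  when \<open>Re z > 1/2\<close>.\<close>

lemma martingale_limit:
  assumes chi: "chi m z = 0" and z: "Re z > 1/2"
  shows "\<exists>Zi D. Zi \<in> borel_measurable M \<and> all_moments M D \<and>
    (AE \<omega> in M. (\<lambda>n. u2 m z (Y n \<omega>) / gam z n) \<longlonglongrightarrow> Zi \<omega>) \<and>
    (AE \<omega> in M. \<forall>n. cmod (u2 m z (Y n \<omega>) / gam z n) \<le> D \<omega>)"
proof -
  define Z where "Z n \<omega> = u2 m z (Y n \<omega>) / gam z n" for n \<omega>
  have [measurable]: "Z n \<in> borel_measurable M" for n unfolding Z_def by measurable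
  have a: "real N0 > 0" "real N0 + Re z > 0" using N0_pos z by auto
  have nz: "gam z n \<noteq> 0" for n unfolding gam_eq_prat by (rule prat_nonzero[OF a])
  define \<beta> where "\<beta> = 2 * Re z - 1"
  have \<beta>: "\<beta> > 0" using z by (simp add: \<beta>_def)
  obtain K where K: "\<And>n. 1 / cmod (gam z n) \<le> K * (real N0 + real n) powr (- Re z)"
    using prat_bounds(2)[OF a] unfolding gam_eq_prat by blast
  define V where "V = (step_bound m z)\<^sup>2 * K\<^sup>2 / \<beta>"
  have "\<exists>Zi. Zi \<in> borel_measurable M \<and> (AE \<omega> in M. (\<lambda>n. Z n \<omega>) \<longlonglongrightarrow> Zi \<omega>) \<and>
           moments_decay M \<beta> (\<lambda>n \<omega>. cmod (Z n \<omega> - Zi \<omega>))"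
  proof (rule AE_limit_of_mgf[where c = 1 and K = "exp V"])
    fix n k :: nat and \<alpha> :: complex
    assume nk: "n \<le> k" and \<alpha>: "cmod \<alpha> = 1 * real (n + 1) powr (\<beta> / 2)"
    show "integrable M (\<lambda>\<omega>. exp (Re (\<alpha> * (Z k \<omega> - Z n \<omega>)))) \<and>
       expectation (\<lambda>\<omega>. exp (Re (\<alpha> * (Z k \<omega> - Z n \<omega>)))) \<le> exp V"
    proof
      have e: "exp (Re (\<alpha> * (Z k \<omega> - Z n \<omega>))) =
          exp (- Re (\<alpha> * (u2 m z (Y n \<omega>) / gam z n))) * exp (Re (\<alpha> * (u2 m z (Y k \<omega>) / gam z k)))" for \<omega>
        by (simp add: Z_def right_diff_distrib exp_diff exp_minus field_simps)
      show "integrable M (\<lambda>\<omega>. exp (Re (\<alpha> * (Z k \<omega> - Z n \<omega>))))"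
        unfolding e by (rule expectation_path(1)[OF nk, of "\<lambda>v. exp (- Re (\<alpha> * (u2 m z v / gam z n)))" "\<lambda>v. exp (Re (\<alpha> * (u2 m z v / gam z k)))"])
      have "expectation (\<lambda>\<omega>. exp (Re (\<alpha> * (Z k \<omega> - Z n \<omega>)))) \<le>
          exp ((step_bound m z * cmod \<alpha>)\<^sup>2 * (\<Sum>j=n..<k. 1 / (cmod (gam z (Suc j)))\<^sup>2))"
        unfolding Z_def by (rule mgf_martingale[OF chi nz nk])
      also have "\<dots> \<le> exp V"
      proof -
        have "(step_bound m z * cmod \<alpha>)\<^sup>2 * (\<Sum>j=n..<k. 1 / (cmod (gam z (Suc j)))\<^sup>2) \<le>
            (step_bound m z * cmod \<alpha>)\<^sup>2 * (K\<^sup>2 * (real (n + 1) powr (1 - 2 * Re z) / (2 * Re z - 1)))"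
          using nz z nk by (intro mult_left_mono sum_inverse_square_gam[OF K]) auto
        also have "\<dots> = V * (real (n + 1) powr \<beta> * real (n + 1) powr (- \<beta>))"
        proof -
          have sq: "(step_bound m z * cmod \<alpha>)\<^sup>2 = (step_bound m z)\<^sup>2 * real (n + 1) powr \<beta>"
            unfolding \<alpha> by (simp add: power_mult_distrib power2_eq_square flip: powr_add)
          show ?thesis unfolding sq by (simp add: V_def \<beta>_def)
        qed
        also have "\<dots> = V" by (simp flip: powr_add)
        finally show ?thesis by simp
      qed
      finally show "expectation (\<lambda>\<omega>. exp (Re (\<alpha> * (Z k \<omega> - Z n \<omega>)))) \<le> exp V" .
    qed
  qed (use \<beta> in auto)
  then obtain Zi where Zi [measurable]: "Zi \<in> borel_measurable M"
    and lim: "AE \<omega> in M. (\<lambda>n. Z n \<omega>) \<longlonglongrightarrow> Zi \<omega>"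
    and dec: "moments_decay M \<beta> (\<lambda>n \<omega>. cmod (Z n \<omega> - Zi \<omega>))" by blast
  obtain D where D: "all_moments M D" "AE \<omega> in M. \<forall>n. \<bar>cmod (Z n \<omega> - Zi \<omega>)\<bar> \<le> D \<omega>"
    using moments_decay_imp_dominated(2)[OF dec \<beta>] by blast
  \<comment> \<open>Each \<open>Z n\<close> is compared with the limit, and the limit with the
    constant \<open>Z 0\<close>; both distances are at most the same \<open>D\<close>.\<close>
  have "AE \<omega> in M. \<forall>n. cmod (Z n \<omega>) \<le> D \<omega> + D \<omega> + cmod (u2 m z x0)"
    using D(2) Y0
  proof eventually_elim
    case (elim \<omega>)
    show ?case
    proof
      fix n
      have "cmod (Z n \<omega>) \<le> cmod (Z n \<omega> - Zi \<omega>) + cmod (Zi \<omega> - Z 0 \<omega>) + cmod (Z 0 \<omega>)"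
        using norm_triangle_ineq[of "Z n \<omega> - Zi \<omega>" "Zi \<omega>"] norm_triangle_ineq[of "Zi \<omega> - Z 0 \<omega>" "Z 0 \<omega>"] by simp
      moreover have "cmod (Z n \<omega> - Zi \<omega>) \<le> D \<omega>" using elim(1) by simp
      moreover have "cmod (Zi \<omega> - Z 0 \<omega>) \<le> D \<omega>" using elim(1)[rule_format, of 0] by (simp add: norm_minus_commute)
      moreover have "Z 0 \<omega> = u2 m z x0" using elim(2) by (simp add: Z_def gam_def)
      ultimately show "cmod (Z n \<omega>) \<le> D \<omega> + D \<omega> + cmod (u2 m z x0)" by simp
    qed
  qed
  moreover have "all_moments M (\<lambda>\<omega>. D \<omega> + D \<omega> + cmod (u2 m z x0))"
    by (intro all_moments_add all_moments_const D(1))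
  ultimately show ?thesis using Zi lim unfolding Z_def by blast
qed

text \<open>The growth exponent \<open>\<rho>\<close> lies strictly above \<open>1/2\<close>, so
  that the noise is square summable relative to the growth, and strictly below
  \<open>\<sigma>\<close>; the gap \<open>\<sigma> - \<rho>\<close> is the rate.\<close>

lemma small_eigenvalue_decay:
  assumes chi: "chi m z = 0" and \<rho>: "1/2 < \<rho>" "Re z \<le> \<rho>" "\<rho> < \<sigma>"
  shows "moments_decay M (2 * (\<sigma> - \<rho>)) (\<lambda>n \<omega>. cmod (u2 m z (Y n \<omega>) / of_real ((real N0 + real n) powr \<sigma>)))"
proof -
  \<comment> \<open>\<open>p\<close> grows like \<open>n\<close> to the power \<open>\<rho>\<close>,
    while \<open>e\<close> stays bounded and absorbs the second order term in \<open>cmod (1 + z /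
    x) \<le> (1 + \<rho> / x) * (1 + (cmod z / x) ^ 2)\<close>.\<close>
  define p where "p n = (\<Prod>j<n. 1 + \<rho> / (real N0 + real j))" for n
  define e where "e n = (\<Prod>j<n. 1 + (cmod z)\<^sup>2 / (real N0 + real j)\<^sup>2)" for n
  define G where "G n = p n * e n" for n
  have a: "real N0 > 0" "real N0 + Re (of_real \<rho>) > 0" using N0_pos \<rho> by auto
  have xp: "real N0 + real j > 0" for j using a by simp
  have "0 < 1 + \<rho> / (real N0 + real j)" for j using divide_pos_pos[OF _ xp[of j], of \<rho>] \<rho> by linarith
  then have pp: "p n > 0" for n unfolding p_def by (intro prod_pos) blast
  have p_prat: "p n = cmod (prat (real N0) (of_real \<rho>) n)" for n
  proof -
    have "prat (real N0) (of_real \<rho>) n = of_real (p n)" by (simp add: prat_def p_def)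
    then show ?thesis using pp[of n] by simp
  qed
  have e1: "e n \<ge> 1" for n unfolding e_def by (intro prod_ge_1) auto
  have eE: "e n \<le> exp (2 * (cmod z)\<^sup>2)" for n
  proof -
    have "e n \<le> (\<Prod>j<n. exp ((cmod z)\<^sup>2 / (real N0 + real j)\<^sup>2))"
      unfolding e_def by (intro prod_mono) (auto simp: add_nonneg_nonneg)
    also have "\<dots> = exp ((cmod z)\<^sup>2 * (\<Sum>j=0..<n. 1 / (real N0 + real j)\<^sup>2))"
      by (simp add: exp_sum[symmetric] sum_distrib_left lessThan_atLeast0)
    also have "\<dots> \<le> exp ((cmod z)\<^sup>2 * 2)"
    proof -
      have "(\<Sum>j=0..<n. 1 / (real N0 + real j)\<^sup>2) \<le> 2 / (real N0 + real 0)"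
        using N0_pos by (intro sum_inverse_squares_le) auto
      also have "\<dots> \<le> 2" using N0_pos by (simp add: field_simps)
      finally show ?thesis by (simp only: exp_le_cancel_iff mult_left_mono zero_le_power2)
    qed
    finally show ?thesis by (simp only: mult.commute)
  qed
  obtain K where K: "\<And>n. 1 / p n \<le> K * (real N0 + real n) powr (- \<rho>)"
    using prat_bounds(2)[OF a] unfolding p_prat by auto
  obtain K2 where K2: "\<And>n. p n \<le> K2 * (real N0 + real n) powr \<rho>"
    using prat_bounds(1)[OF a] unfolding p_prat by auto
  have Gp: "G n > 0" for n unfolding G_def using pp[of n] e1[of n] by simp
  have KG: "1 / G n \<le> K * (real N0 + real n) powr (- \<rho>)" for n
  proof -
    have "1 / G n \<le> 1 / p n" unfolding G_def using pp[of n] e1[of n] by (intro divide_left_mono) auto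
    with K[of n] show ?thesis by simp
  qed
  define K3 where "K3 = K2 * exp (2 * (cmod z)\<^sup>2)"
  have G3: "G n \<le> K3 * (real N0 + real n) powr \<rho>" for n
  proof -
    have "G n \<le> (K2 * (real N0 + real n) powr \<rho>) * exp (2 * (cmod z)\<^sup>2)"
      unfolding G_def using pp[of n] e1[of n] K2[of n] eE[of n] by (intro mult_mono) auto
    then show ?thesis by (simp add: K3_def mult_ac)
  qed
  have step: "cmod (1 + z / of_nat (N0 + j)) * G j \<le> G (Suc j)" for j
  proof -
    define x where "x = real N0 + real j"
    have x: "x > 0" using xp by (simp add: x_def)
    define r where "r = (cmod z)\<^sup>2 / x\<^sup>2"
    have r: "r \<ge> 0" by (simp add: r_def)
    have "(cmod (1 + z / of_real x))\<^sup>2 = (1 + Re z / x)\<^sup>2 + (Im z / x)\<^sup>2"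
      by (simp add: cmod_power2 Re_divide_of_real Im_divide_of_real)
    also have "\<dots> = 1 + 2 * Re z / x + r"
      unfolding r_def cmod_power2 using x by (simp add: power2_eq_square field_simps)
    also have "\<dots> \<le> 1 + 2 * \<rho> / x + r" using \<rho> x by (simp add: divide_right_mono)
    also have "\<dots> \<le> (1 + \<rho> / x)\<^sup>2 * (1 + r)\<^sup>2"
    proof -
      have t: "\<rho> / x \<ge> 0" using \<rho> x by simp
      have "1 + 2 * u + r \<le> (1 + u)\<^sup>2 * (1 + r)\<^sup>2" if "u \<ge> 0" for u
      proof -
        have "0 \<le> u * r" using that r by simp
        then have "1 + 2 * u + r \<le> (1 + 2 * u) * (1 + r)" by (simp add: algebra_simps)
        also have "\<dots> \<le> (1 + u)\<^sup>2 * (1 + r)\<^sup>2"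
        proof (rule mult_mono)
          show "1 + 2 * u \<le> (1 + u)\<^sup>2" by (simp add: power2_sum)
          show "1 + r \<le> (1 + r)\<^sup>2" using r by (simp add: power2_eq_square algebra_simps)
        qed (use r in auto)
        finally show ?thesis .
      qed
      from this[OF t]
      have "1 + 2 * (\<rho> / x) + r \<le> (1 + \<rho> / x)\<^sup>2 * (1 + r)\<^sup>2" .
      then show ?thesis by simp
    qed
    also have "\<dots> = ((1 + \<rho> / x) * (1 + r))\<^sup>2" by (simp only: power_mult_distrib)
    finally have sq: "(cmod (1 + z / of_real x))\<^sup>2 \<le> ((1 + \<rho> / x) * (1 + r))\<^sup>2" .
    have "0 \<le> \<rho> / x" using \<rho> x by simp
    then have "0 \<le> (1 + \<rho> / x) * (1 + r)" using r by (intro mult_nonneg_nonneg add_nonneg_nonneg) simp_all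
    from power2_le_imp_le[OF sq this] have "cmod (1 + z / of_real x) \<le> (1 + \<rho> / x) * (1 + r)" .
    then have "cmod (1 + z / of_real x) * G j \<le> (1 + \<rho> / x) * (1 + r) * G j"
      by (rule mult_right_mono[OF _ less_imp_le[OF Gp]])
    also have "\<dots> = G (Suc j)" by (simp add: G_def p_def e_def x_def r_def mult_ac)
    finally show ?thesis by (simp add: x_def)
  qed
  have G0: "G 0 = 1" by (simp add: G_def p_def e_def)
  define U where "U = cmod (u2 m z x0)"
  define V where "V = K\<^sup>2 / (2 * \<rho> - 1)"
  have sumG: "(\<Sum>j<n. 1 / (G (Suc j))\<^sup>2) \<le> V" for n
    using sum_inverse_square_gam[OF KG Gp \<rho>(1), of 0 n] by (simp add: V_def lessThan_atLeast0)
  have V: "V \<ge> 0" using \<rho> by (simp add: V_def)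
  have [measurable]: "(\<lambda>\<omega>. u2 m z (Y n \<omega>) / of_real ((real N0 + real n) powr \<sigma>)) \<in> borel_measurable M" for n
    by measurable
  show ?thesis
  proof (rule moments_decay_cmod_of_mgf[where c = 1 and K = "exp (K3 * U + (step_bound m z * K3)\<^sup>2 * V)"])
    fix n and \<alpha> :: complex
    assume \<alpha>: "cmod \<alpha> = 1 * real (n + 1) powr (2 * (\<sigma> - \<rho>) / 2)"
    define x where "x = real N0 + real n"
    have x: "x > 0" "real (n + 1) \<le> x" using N0_pos by (auto simp: x_def)
    define \<beta> where "\<beta> = \<alpha> / of_real (x powr \<sigma>)"
    have e: "\<alpha> * (u2 m z v / of_real (x powr \<sigma>)) = \<beta> * u2 m z v" for v
      by (simp add: \<beta>_def)
    have nb: "cmod \<beta> * G n \<le> K3"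
    proof -
      have "2 * (\<sigma> - \<rho>) / 2 = \<sigma> - \<rho>" by simp
      with \<alpha> have "cmod \<alpha> = real (n + 1) powr (\<sigma> - \<rho>)" by (simp only: mult_1_left)
      also have "\<dots> \<le> x powr (\<sigma> - \<rho>)" using x \<rho> by (intro powr_mono2) auto
      finally have "cmod \<alpha> \<le> x powr (\<sigma> - \<rho>)" .
      then have "cmod \<beta> \<le> x powr (\<sigma> - \<rho>) / x powr \<sigma>"
        unfolding \<beta>_def norm_divide using x by (simp add: divide_right_mono)
      then have "cmod \<beta> * G n \<le> x powr (\<sigma> - \<rho>) / x powr \<sigma> * (K3 * x powr \<rho>)"
        using G3[of n] Gp[of n] x by (intro mult_mono) (auto simp: x_def)
      also have "\<dots> = K3 * (x powr (\<sigma> - \<rho>) * x powr \<rho> / x powr \<sigma>)" by simp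
      also have "x powr (\<sigma> - \<rho>) * x powr \<rho> / x powr \<sigma> = 1" using x by (simp flip: powr_add)
      finally show ?thesis by simp
    qed
    have nb0: "0 \<le> cmod \<beta> * G n" using Gp[of n] by simp
    show "integrable M (\<lambda>\<omega>. exp (Re (\<alpha> * (u2 m z (Y n \<omega>) / of_real ((real N0 + real n) powr \<sigma>))))) \<and>
      expectation (\<lambda>\<omega>. exp (Re (\<alpha> * (u2 m z (Y n \<omega>) / of_real ((real N0 + real n) powr \<sigma>))))) \<le>
        exp (K3 * U + (step_bound m z * K3)\<^sup>2 * V)"
      unfolding x_def[symmetric] e
    proof
      show "integrable M (\<lambda>\<omega>. exp (Re (\<beta> * u2 m z (Y n \<omega>))))"
        using expectation_path(1)[of n n "\<lambda>_. 1" "\<lambda>v. exp (Re (\<beta> * u2 m z v))"] by simp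
      have "expectation (\<lambda>\<omega>. exp (Re (\<beta> * u2 m z (Y n \<omega>)))) \<le>
        exp (cmod \<beta> * G n * U + (step_bound m z * cmod \<beta> * G n)\<^sup>2 * (\<Sum>j<n. 1 / (G (Suc j))\<^sup>2))"
        unfolding U_def by (rule mgf_growth[OF chi G0 Gp step])
      also have "\<dots> \<le> exp (K3 * U + (step_bound m z * K3)\<^sup>2 * V)"
      proof -
        have "cmod \<beta> * G n * U \<le> K3 * U" using nb by (intro mult_right_mono) (auto simp: U_def)
        moreover have "(step_bound m z * cmod \<beta> * G n)\<^sup>2 \<le> (step_bound m z * K3)\<^sup>2"
          using nb nb0 by (simp only: mult.assoc power_mult_distrib[of "step_bound m z"])
            (intro mult_left_mono power_mono, auto)
        then have "(step_bound m z * cmod \<beta> * G n)\<^sup>2 * (\<Sum>j<n. 1 / (G (Suc j))\<^sup>2) \<le> (step_bound m z * K3)\<^sup>2 * V"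
          using sumG[of n] by (intro mult_mono) (auto intro!: sum_nonneg)
        ultimately show ?thesis by simp
      qed
      finally show "expectation (\<lambda>\<omega>. exp (Re (\<beta> * u2 m z (Y n \<omega>)))) \<le> exp (K3 * U + (step_bound m z * K3)\<^sup>2 * V)" .
    qed
  qed auto
qed

end

section \<open>Asymptotics in continuous time\<close>

lemma ucoef_cnj: "k \<ge> 1 \<Longrightarrow> ucoef (cnj z) k = cnj (ucoef z k)"
  by (simp add: ucoef_eq_prod)

lemma u2_cnj: "u2 m (cnj z) x = cnj (u2 m z x)"
  by (simp add: u2_eq ucoef_cnj)

lemma v2_cnj: "v2 m (cnj z) k = cnj (v2 m z k)"
  by (simp add: v2_def Hm_def gchoose_eq_prod)

lemma state_decomposition:
  assumes m: "m \<ge> 2" and z: "chi m z = 0" "Im z > 0" and k: "k \<in> {1..m-1}"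
  shows "complex_of_real (real (x k)) = of_real (u1 m x * v1 m k) + of_real (2 * Re (u2 m z x * v2 m z k)) +
    (\<Sum>w\<in>chi_roots m - {1, z, cnj z}. u2 m w x * v2 m w k)"
proof -
  define f where "f w = u2 m w x * v2 m w k" for w
  have fin: "finite (chi_roots m)" using m by (rule finite_chi_roots)
  have sub: "{1, z, cnj z} \<subseteq> chi_roots m"
    using z chi_1[of m] m by (auto simp: chi_roots_def chi_cnj)
  have ne: "1 \<noteq> z" "1 \<noteq> cnj z" "z \<noteq> cnj z" using z by (auto simp: complex_eq_iff)
  have "of_nat (x k) = (\<Sum>w\<in>chi_roots m. f w)"
    unfolding f_def using spectral_decomposition[OF m k] by simp
  also have "\<dots> = (\<Sum>w\<in>{1, z, cnj z}. f w) + (\<Sum>w\<in>chi_roots m - {1, z, cnj z}. f w)"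
    using sum.subset_diff[OF sub fin, of f] by (simp only: add.commute)
  also have "(\<Sum>w\<in>{1, z, cnj z}. f w) = f 1 + (f z + cnj (f z))"
    using ne by (simp add: f_def u2_cnj v2_cnj)
  also have "f z + cnj (f z) = of_real (2 * Re (f z))" by (rule complex_add_cnj)
  also have "f 1 = of_real (u1 m x * v1 m k)" using m by (simp add: f_def u2_1 v2_1)
  finally show ?thesis by (simp add: f_def)
qed

text \<open>Maximality of \<open>Re z\<close> gives only a weak inequality; equality is excluded
  because such a vertical line carries just a root and its conjugate. The strict gap is what makes
  these roots negligible.\<close>

lemma other_roots_Re_less:
  assumes m: "m \<ge> 2" and z: "chi m z = 0" "Re z > -1"
    and max: "\<forall>w. chi m w = 0 \<and> w \<noteq> 1 \<longrightarrow> Re w \<le> Re z" and w: "w \<in> chi_roots m - {1, z, cnj z}"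
  shows "Re w < Re z"
proof -
  have cw: "chi m w = 0" "w \<noteq> 1" "w \<noteq> z" "w \<noteq> cnj z" using w by (auto simp: chi_roots_def)
  then have "Re w \<le> Re z" using max by blast
  moreover have "Re w \<noteq> Re z" using chi_roots_same_Re[OF z(1) cw(1) _ z(2) m] cw by auto
  ultimately show ?thesis by simp
qed

text \<open>Between two jumps \<open>exp (-\<sigma> t) (exp t \<xi> - N)\<close> is monotone in \<open>t\<close>, so its values at the jump times control it.\<close>
lemma between_jumps:
  fixes N \<xi> s t u \<sigma> :: real
  assumes "0 < \<sigma>" "\<sigma> < 1" "\<xi> > 0" "N \<ge> 0" "s \<le> t" "t \<le> u"
  shows "exp (- \<sigma> * t) * \<bar>exp t * \<xi> - N\<bar> \<le>
    \<bar>exp (- \<sigma> * s) * (exp s * \<xi> - N)\<bar> + \<bar>exp (- \<sigma> * u) * (exp u * \<xi> - (N + 1))\<bar> + exp (- \<sigma> * t)"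
proof -
  define h where "h t = exp ((1 - \<sigma>) * t) * \<xi> - exp (- \<sigma> * t) * N" for t
  have h: "exp (- \<sigma> * t) * (exp t * \<xi> - N) = h t" for t
    by (simp add: h_def algebra_simps flip: exp_add)
  have mono: "h a \<le> h b" if "a \<le> b" for a b
    unfolding h_def using assms that by (intro diff_mono mult_right_mono) auto
  have "exp (- \<sigma> * t) * \<bar>exp t * \<xi> - N\<bar> = \<bar>h t\<bar>"
    unfolding h[symmetric] by (simp add: abs_mult)
  also have "\<dots> \<le> \<bar>h s\<bar> + \<bar>h u - exp (- \<sigma> * u)\<bar> + exp (- \<sigma> * t)"
  proof -
    have "exp (- \<sigma> * u) \<le> exp (- \<sigma> * t)" using assms by simp
    moreover have "0 < exp (- \<sigma> * t)" "0 < exp (- \<sigma> * u)" by auto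
    ultimately show ?thesis using mono[OF assms(5)] mono[OF assms(6)] by linarith
  qed
  also have "h s = exp (- \<sigma> * s) * (exp s * \<xi> - N)" by (rule h[symmetric])
  also have "h u - exp (- \<sigma> * u) = exp (- \<sigma> * u) * (exp u * \<xi> - (N + 1))"
    unfolding h[symmetric] by (simp add: algebra_simps)
  finally show ?thesis .
qed

lemma filterlim_jump_count:
  fixes T :: "nat \<Rightarrow> real"
  assumes "mono T" "\<And>t. t \<ge> 0 \<Longrightarrow> T (N t) \<le> t \<and> t < T (Suc (N t))"
  shows "filterlim N sequentially at_top"
  unfolding filterlim_at_top
proof
  fix K
  show "\<forall>\<^sub>F t in at_top. K \<le> N t"
    using eventually_ge_at_top[of "max 0 (T K)"]
  proof eventually_elim
    case (elim t)
    have t: "0 \<le> t" "T K \<le> t" using elim by simp_all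
    show "K \<le> N t"
    proof (rule ccontr)
      assume "\<not> K \<le> N t"
      then have "Suc (N t) \<le> K" by simp
      then have "T (Suc (N t)) \<le> T K" by (rule monoD[OF assms(1)])
      moreover have "t < T (Suc (N t))" using assms(2)[OF t(1)] by (rule conjunct2)
      ultimately show False using t(2) by linarith
    qed
  qed
qed

context urn_process
begin

definition gam_ratio :: "complex \<Rightarrow> nat \<Rightarrow> complex" where
  "gam_ratio z n = gam z n / exp (z * of_real (ln (real N0 + real n)))"

lemma gam_ratio_limit:
  assumes "real N0 + Re z > 0"
  shows "gam_ratio z \<longlonglongrightarrow> Gamma (of_nat N0) / Gamma (of_nat N0 + z)"
  using prat_limit[of "real N0" z] assms N0_pos unfolding gam_ratio_def gam_eq_prat by simp

lemma gam_ratio_bounded: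
  assumes "real N0 + Re z > 0"
  shows "\<exists>K. \<forall>n. cmod (gam_ratio z n) \<le> K"
  using convergent_imp_Bseq[OF convergentI[OF gam_ratio_limit[OF assms]]] unfolding Bseq_def by blast

end

section \<open>Comparison with the process at real times\<close>

locale urn_asymptotics = urn_process M m x0 Y S
  for M :: "'a measure" and m x0 Y S +
  fixes X :: "real \<Rightarrow> 'a \<Rightarrow> nat \<Rightarrow> nat" and z :: complex
  assumes z_root: "chi m z = 0" and z_Im: "Im z > 0" and z_Re: "Re z > 1/2"
    and z_max: "\<forall>w. chi m w = 0 \<and> w \<noteq> 1 \<longrightarrow> Re w \<le> Re z"
    and X_jumps: "AE \<omega> in M. \<forall>t\<ge>0. \<exists>n. (\<Sum>j<n. S j \<omega>) \<le> t \<and> t < (\<Sum>j<Suc n. S j \<omega>) \<and> X t \<omega> = Y n \<omega>"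
begin

abbreviation "\<sigma> \<equiv> Re z"

abbreviation T :: "nat \<Rightarrow> 'a \<Rightarrow> real" where "T \<equiv> clocks.T"

lemma sigma: "1/2 < \<sigma>" "\<sigma> < 1"
proof -
  have "z \<noteq> 1" using z_Im by auto
  then show "\<sigma> < 1" using chi_root_Re_less_1[OF z_root] m3 by simp
qed (rule z_Re)

lemma N0_z: "real N0 + Re z > 0"
  using sigma N0_pos by simp

definition others :: "complex set" where "others = chi_roots m - {1, z, cnj z}"

lemma finite_others: "finite others"
  unfolding others_def using finite_chi_roots[of m] m3 by simp

lemma others_decay:
  assumes "w \<in> others"
  shows "\<exists>D. all_moments M D \<and>
     (AE \<omega> in M. (\<lambda>n. cmod (u2 m w (Y n \<omega>)) / (real N0 + real n) powr \<sigma>) \<longlonglongrightarrow> 0) \<and>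
     (AE \<omega> in M. \<forall>n. cmod (u2 m w (Y n \<omega>)) / (real N0 + real n) powr \<sigma> \<le> D \<omega>)"
proof -
  have "Re w < \<sigma>"
    using other_roots_Re_less[OF _ z_root _ z_max, of w] assms m3 sigma by (simp add: others_def)
  define \<rho> where "\<rho> = (max (1/2) (Re w) + \<sigma>) / 2"
  have \<rho>: "1/2 < \<rho>" "Re w \<le> \<rho>" "\<rho> < \<sigma>" using \<open>Re w < \<sigma>\<close> sigma by (auto simp: \<rho>_def max_def)
  have cw: "chi m w = 0" using assms by (simp add: others_def chi_roots_def)
  have x: "real N0 + real n > 0" for n using N0_pos by simp
  have e: "cmod (u2 m w v / of_real ((real N0 + real n) powr \<sigma>)) = cmod (u2 m w v) / (real N0 + real n) powr \<sigma>" for v n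
    by (simp add: norm_divide)
  note dec = small_eigenvalue_decay[OF cw \<rho>, unfolded e]
  have pos: "2 * (\<sigma> - \<rho>) > 0" using \<rho> by simp
  obtain D where "all_moments M D"
    "AE \<omega> in M. \<forall>n. \<bar>cmod (u2 m w (Y n \<omega>)) / (real N0 + real n) powr \<sigma>\<bar> \<le> D \<omega>"
    using moments_decay_imp_dominated(2)[OF dec pos] by blast
  then show ?thesis using moments_decay_imp_dominated(1)[OF dec pos] by (intro exI[of _ D]) simp
qed

text \<open>The third error term that remains when the first two are taken to be zero.\<close>

definition residual :: "('a \<Rightarrow> real) \<Rightarrow> ('a \<Rightarrow> complex) \<Rightarrow> nat \<Rightarrow> real \<Rightarrow> 'a \<Rightarrow> real" where
  "residual \<xi> W k t \<omega> = real (X t \<omega> k) - exp t * \<xi> \<omega> * v1 m k - 2 * Re (exp (z * of_real t) * W \<omega> * v2 m z k)"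

text \<open>The state is expanded over the roots: the root \<open>1\<close> leaves the fluctuation
  of \<open>N0 + n\<close> around \<open>exp t * \<xi>\<close>, the pair \<open>z\<close>,
  \<open>cnj z\<close> leaves the distance to \<open>W\<close>, and the other roots are estimated in
  modulus.\<close>

lemma residual_le:
  assumes X: "X t \<omega> = Y n \<omega>" and Yn: "Y n \<omega> \<in> A n" and k: "k \<in> {1..m-1}"
  shows "\<bar>residual \<xi> W k t \<omega> / exp (\<sigma> * t)\<bar> \<le>
     \<bar>v1 m k\<bar> * (exp (- \<sigma> * t) * \<bar>exp t * \<xi> \<omega> - (real N0 + real n)\<bar>) +
     2 * cmod (v2 m z k) * cmod (u2 m z (Y n \<omega>) * exp (- z * of_real t) - W \<omega>) +
     (\<Sum>w\<in>others. cmod (v2 m w k) * (cmod (u2 m w (Y n \<omega>)) * exp (- \<sigma> * t)))"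
proof -
  define E where "E = exp (\<sigma> * t)"
  have E: "E > 0" "exp (- \<sigma> * t) = 1 / E" "cmod (exp (z * of_real t)) = E"
    by (auto simp: E_def exp_minus divide_inverse)
  define O1 where "O1 = (\<Sum>w\<in>others. u2 m w (Y n \<omega>) * v2 m w k)"
  define P where "P = u2 m z (Y n \<omega>) * v2 m z k"
  define Q where "Q = exp (z * of_real t) * W \<omega> * v2 m z k"
  have u: "u1 m (Y n \<omega>) = real N0 + real n" using Yn by (simp add: u1_eq_mass states_def)
  have d: "complex_of_real (real (Y n \<omega> k)) = of_real ((real N0 + real n) * v1 m k) + of_real (2 * Re P) + O1"
    using state_decomposition[OF _ z_root z_Im k, of "Y n \<omega>"] m3 unfolding u others_def[symmetric] O1_def P_def by simp
  have "real (Y n \<omega> k) = Re (complex_of_real (real (Y n \<omega> k)))" by simp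
  also have "\<dots> = (real N0 + real n) * v1 m k + 2 * Re P + Re O1" unfolding d by simp
  finally have r: "residual \<xi> W k t \<omega> = - ((exp t * \<xi> \<omega> - (real N0 + real n)) * v1 m k) + 2 * Re (P - Q) + Re O1"
    unfolding residual_def X Q_def by (simp add: algebra_simps)
  have "\<bar>residual \<xi> W k t \<omega>\<bar> \<le> \<bar>exp t * \<xi> \<omega> - (real N0 + real n)\<bar> * \<bar>v1 m k\<bar> + 2 * cmod (P - Q) + cmod O1"
    unfolding r abs_mult[symmetric] using abs_Re_le_cmod[of "P - Q"] abs_Re_le_cmod[of O1] by linarith
  then have "\<bar>residual \<xi> W k t \<omega>\<bar> / E \<le>
     (\<bar>exp t * \<xi> \<omega> - (real N0 + real n)\<bar> * \<bar>v1 m k\<bar> + 2 * cmod (P - Q) + cmod O1) / E"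
    using E by (simp add: divide_right_mono)
  also have "\<dots> = \<bar>v1 m k\<bar> * (1 / E * \<bar>exp t * \<xi> \<omega> - (real N0 + real n)\<bar>) + 2 * (cmod (P - Q) / E) + cmod O1 / E"
    by (simp add: add_divide_distrib)
  also have "cmod (P - Q) / E = cmod (v2 m z k) * cmod (u2 m z (Y n \<omega>) * exp (- z * of_real t) - W \<omega>)"
  proof -
    have "P - Q = exp (z * of_real t) * (v2 m z k * (u2 m z (Y n \<omega>) * exp (- z * of_real t) - W \<omega>))"
      by (simp add: P_def Q_def algebra_simps exp_minus)
    then have "cmod (P - Q) = E * (cmod (v2 m z k) * cmod (u2 m z (Y n \<omega>) * exp (- z * of_real t) - W \<omega>))"
      by (simp only: norm_mult E(3))
    then show ?thesis using E(1) by simp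
  qed
  also have "cmod O1 / E \<le> (\<Sum>w\<in>others. cmod (v2 m w k) * (cmod (u2 m w (Y n \<omega>)) * (1 / E)))"
  proof -
    have "cmod O1 \<le> (\<Sum>w\<in>others. cmod (u2 m w (Y n \<omega>)) * cmod (v2 m w k))"
      unfolding O1_def norm_mult[symmetric] by (rule norm_sum)
    then have "cmod O1 / E \<le> (\<Sum>w\<in>others. cmod (u2 m w (Y n \<omega>)) * cmod (v2 m w k)) / E"
      using E by (simp add: divide_right_mono)
    then show ?thesis by (simp add: sum_divide_distrib mult_ac)
  qed
  finally show ?thesis using E by (simp add: E_def[symmetric] mult.assoc)
qed

lemma main_asymptotics:
  "\<exists>\<xi> W. distributed M lborel \<xi> (gamma_density (real N0) 1) \<and> (\<forall>\<omega>. \<xi> \<omega> > 0) \<and>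
     W \<in> borel_measurable M \<and> all_moments M (\<lambda>\<omega>. cmod (W \<omega>)) \<and> expectation W = u2 m z x0 \<and>
     (\<exists>D. all_moments M D \<and> (AE \<omega> in M. \<forall>k\<in>{1..m-1}.
        ((\<lambda>t. residual \<xi> W k t \<omega> / exp (\<sigma> * t)) \<longlongrightarrow> 0) at_top \<and>
        (\<forall>t\<ge>0. \<bar>residual \<xi> W k t \<omega> / exp (\<sigma> * t)\<bar> \<le> D \<omega>)))"
proof -
  obtain \<xi> where \<xi> [measurable]: "\<xi> \<in> borel_measurable M" and \<xi>pos: "\<And>\<omega>. \<xi> \<omega> > 0"
    and Qlim: "AE \<omega> in M. (\<lambda>n. clocks.Q n \<omega>) \<longlonglongrightarrow> \<xi> \<omega>"
    using clocks.ex_limit by blast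
  define F where "F n \<omega> = exp (- \<sigma> * T n \<omega>) * (exp (T n \<omega>) * \<xi> \<omega> - (real N0 + real n))" for n \<omega>
  have Fdec: "moments_decay M (2 * \<sigma> - 1) F"
    unfolding F_def using clocks.fluctuation_decay[OF \<xi> \<xi>pos Qlim sigma(1)] .
  have s0: "2 * \<sigma> - 1 > 0" using sigma by simp
  note Flim = moments_decay_imp_dominated(1)[OF Fdec s0]
  obtain DF where DF: "all_moments M DF" and Fle: "AE \<omega> in M. \<forall>n. \<bar>F n \<omega>\<bar> \<le> DF \<omega>"
    using moments_decay_imp_dominated(2)[OF Fdec s0] by blast
  obtain Zi DZ where Zi [measurable]: "Zi \<in> borel_measurable M" and DZ: "all_moments M DZ"
    and Zlim: "AE \<omega> in M. (\<lambda>n. u2 m z (Y n \<omega>) / gam z n) \<longlonglongrightarrow> Zi \<omega>"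
    and Zle: "AE \<omega> in M. \<forall>n. cmod (u2 m z (Y n \<omega>) / gam z n) \<le> DZ \<omega>"
    using martingale_limit[OF z_root z_Re] by blast
  define PO where "PO w D \<longleftrightarrow> all_moments M D \<and>
     (AE \<omega> in M. (\<lambda>n. cmod (u2 m w (Y n \<omega>)) / (real N0 + real n) powr \<sigma>) \<longlonglongrightarrow> 0) \<and>
     (AE \<omega> in M. \<forall>n. cmod (u2 m w (Y n \<omega>)) / (real N0 + real n) powr \<sigma> \<le> D \<omega>)" for w D
  have "\<forall>w\<in>others. \<exists>D. PO w D" unfolding PO_def by (rule ballI) (rule others_decay)
  then obtain DO where PO: "\<forall>w\<in>others. PO w (DO w)" by (rule bchoice[THEN exE])
  have DO: "all_moments M (DO w)" if "w \<in> others" for w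
    using bspec[OF PO that, unfolded PO_def] by (rule conjunct1)
  have Olim: "AE \<omega> in M. (\<lambda>n. cmod (u2 m w (Y n \<omega>)) / (real N0 + real n) powr \<sigma>) \<longlonglongrightarrow> 0"
    if "w \<in> others" for w
    using bspec[OF PO that, unfolded PO_def] by (rule conjunct2[THEN conjunct1])
  have Ole: "AE \<omega> in M. \<forall>n. cmod (u2 m w (Y n \<omega>)) / (real N0 + real n) powr \<sigma> \<le> DO w \<omega>"
    if "w \<in> others" for w
    using bspec[OF PO that, unfolded PO_def] by (rule conjunct2[THEN conjunct2])
  obtain K where K: "\<And>n. cmod (gam_ratio z n) \<le> K" using gam_ratio_bounded[OF N0_z] by blast
  have K0: "K \<ge> 0" by (rule order_trans[OF norm_ge_zero K[of 0]])
  define c where "c = Gamma (of_nat N0) / Gamma (of_nat N0 + z)"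
  have clim: "gam_ratio z \<longlonglongrightarrow> c" unfolding c_def by (rule gam_ratio_limit[OF N0_z])
  \<comment> \<open>With \<open>q = (N0 + n) * exp (- t)\<close> one has
    \<open>gam z n * exp (- z * t) = gam_ratio z n * exp (z * ln q)\<close>, and q tends to \<xi>;
    hence this product.\<close>
  define W where "W \<omega> = Zi \<omega> * c * exp (z * of_real (ln (\<xi> \<omega>)))" for \<omega>
  have W [measurable]: "W \<in> borel_measurable M" unfolding W_def by measurable
  define q where "q n t = (real N0 + real n) * exp (- t)" for n and t :: real
  have q0: "q n t > 0" for n t using N0_pos by (simp add: q_def)
  have u2q: "u2 m z (Y n \<omega>) * exp (- z * of_real t) =
     u2 m z (Y n \<omega>) / gam z n * gam_ratio z n * exp (z * of_real (ln (q n t)))" for n t \<omega>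
  proof -
    have nz: "gam z n \<noteq> 0" unfolding gam_eq_prat using N0_z N0_pos by (intro prat_nonzero) auto
    have l: "ln (q n t) = ln (real N0 + real n) - t" using N0_pos by (simp add: q_def ln_mult)
    have e: "exp (z * of_real (ln (q n t))) = exp (z * of_real (ln (real N0 + real n))) * exp (- z * of_real t)"
      unfolding l by (simp add: right_diff_distrib exp_diff exp_minus divide_inverse)
    show ?thesis unfolding e gam_ratio_def using nz by simp
  qed
  \<comment> \<open>A bound for q at all times between the n-th jump and the next: \<xi> plus the
    fluctuation, which is estimated by its values at the two jumps plus \<open>1\<close>.\<close>
  define DQ where "DQ \<omega> = \<bar>\<xi> \<omega> + (DF \<omega> + (DF \<omega> + 1))\<bar>" for \<omega>
  \<comment> \<open>At \<open>n = 0\<close> the jump time is zero and the fluctuation is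
    \<open>\<xi> - N0\<close>, so its dominating variable also bounds \<xi>.\<close>
  have \<xi>_mom: "all_moments M \<xi>"
  proof (rule all_moments_bound)
    show "all_moments M (\<lambda>\<omega>. real N0 + DF \<omega>)" by (intro all_moments_add all_moments_const DF)
    show "AE \<omega> in M. \<bar>\<xi> \<omega>\<bar> \<le> real N0 + DF \<omega>"
      using Fle
    proof eventually_elim
      case (elim \<omega>)
      have "\<bar>F 0 \<omega>\<bar> \<le> DF \<omega>" using elim by blast
      then show ?case by (simp add: F_def)
    qed
  qed measurable
  have DQ: "all_moments M DQ"
    unfolding DQ_def by (intro all_moments_abs all_moments_add all_moments_const DF \<xi>_mom)
  define DW where "DW \<omega> = DZ \<omega> * (K * \<bar>DQ \<omega>\<bar> powr \<sigma>)" for \<omega>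
  have DW: "all_moments M DW"
    unfolding DW_def using sigma by (intro all_moments_mult all_moments_const all_moments_powr DZ DQ) auto
  have normq: "cmod (exp (z * of_real (ln y))) = y powr \<sigma>" if "y > 0" for y
    using that by (simp add: powr_def)
  have mart_le: "cmod (u2 m z (Y n \<omega>) * exp (- z * of_real t)) \<le> DW \<omega>"
    if "\<forall>n. cmod (u2 m z (Y n \<omega>) / gam z n) \<le> DZ \<omega>" "q n t \<le> DQ \<omega>" for n t \<omega>
  proof -
    have "cmod (u2 m z (Y n \<omega>) / gam z n * gam_ratio z n * exp (z * of_real (ln (q n t)))) =
       cmod (u2 m z (Y n \<omega>) / gam z n) * (cmod (gam_ratio z n) * q n t powr \<sigma>)"
      by (simp only: norm_mult normq[OF q0] mult.assoc)
    also have "\<dots> \<le> DZ \<omega> * (K * \<bar>DQ \<omega>\<bar> powr \<sigma>)"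
    proof (rule mult_mono)
      show "cmod (u2 m z (Y n \<omega>) / gam z n) \<le> DZ \<omega>" using that(1) by blast
      then show "0 \<le> DZ \<omega>" using norm_ge_zero order_trans by blast
      show "cmod (gam_ratio z n) * q n t powr \<sigma> \<le> K * \<bar>DQ \<omega>\<bar> powr \<sigma>"
        using K K0 that(2) q0[of n t] sigma by (intro mult_mono powr_mono2) auto
    qed auto
    finally show ?thesis unfolding u2q DW_def .
  qed
  \<comment> \<open>The filter is left open: the same limit is used along the jump times, for the
    mean of \<open>W\<close>, and at real infinity.\<close>
  have mart_lim: "((\<lambda>t. u2 m z (Y (N t) \<omega>) * exp (- z * of_real (\<tau> t))) \<longlongrightarrow> W \<omega>) G"
    if "(\<lambda>n. u2 m z (Y n \<omega>) / gam z n) \<longlonglongrightarrow> Zi \<omega>" "filterlim N sequentially G"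
      "((\<lambda>t. q (N t) (\<tau> t)) \<longlongrightarrow> \<xi> \<omega>) G" for \<omega> and N :: "'b \<Rightarrow> nat" and \<tau> G
    unfolding u2q W_def
    using filterlim_compose[OF that(1,2)] filterlim_compose[OF clim that(2)] that(3) \<xi>pos[of \<omega>]
    by (intro tendsto_intros) auto
  have q_le: "\<bar>q n t - \<xi> \<omega>\<bar> \<le> exp (- \<sigma> * t) * \<bar>exp t * \<xi> \<omega> - (real N0 + real n)\<bar>" if "t \<ge> 0" for n t \<omega>
  proof -
    have "\<bar>q n t - \<xi> \<omega>\<bar> = exp (- t) * \<bar>exp t * \<xi> \<omega> - (real N0 + real n)\<bar>"
    proof -
      have "\<xi> \<omega> - q n t = exp (- t) * (exp t * \<xi> \<omega> - (real N0 + real n))"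
        by (simp add: q_def algebra_simps exp_minus)
      then have "\<bar>\<xi> \<omega> - q n t\<bar> = exp (- t) * \<bar>exp t * \<xi> \<omega> - (real N0 + real n)\<bar>"
        by (simp only: abs_mult abs_exp_cancel)
      then show ?thesis by (simp only: abs_minus_commute)
    qed
    also have "\<dots> \<le> exp (- \<sigma> * t) * \<bar>exp t * \<xi> \<omega> - (real N0 + real n)\<bar>"
    proof (rule mult_right_mono)
      have "\<sigma> * t \<le> 1 * t" using that sigma by (intro mult_right_mono) auto
      then show "exp (- t) \<le> exp (- \<sigma> * t)" by simp
    qed simp
    finally show ?thesis .
  qed
  have T_nonneg: "T n \<omega> \<ge> 0" if "\<forall>j. S j \<omega> > 0" for n \<omega>
    unfolding clocks.T_def using that by (intro sum_nonneg) (auto intro: less_imp_le)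
  have EW: "expectation W = u2 m z x0" and Wmom: "all_moments M (\<lambda>\<omega>. cmod (W \<omega>))"
  proof -
    have lim: "AE \<omega> in M. (\<lambda>n. u2 m z (Y n \<omega>) * exp (- z * of_real (T n \<omega>))) \<longlonglongrightarrow> W \<omega>"
      using Zlim Qlim
    proof eventually_elim
      case (elim \<omega>)
      have "(\<lambda>n. q n (T n \<omega>)) \<longlonglongrightarrow> \<xi> \<omega>" using elim(2) by (simp add: q_def clocks.Q_def)
      from mart_lim[OF elim(1) filterlim_ident this] show ?case .
    qed
    have dom: "AE \<omega> in M. \<forall>n. cmod (u2 m z (Y n \<omega>) * exp (- z * of_real (T n \<omega>))) \<le> DW \<omega>"
      using Zle Fle AE_path
    proof eventually_elim
      case (elim \<omega>)
      show ?case
      proof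
        fix n
        have S: "\<forall>j. S j \<omega> > 0" using elim(3) by blast
        have "\<bar>q n (T n \<omega>) - \<xi> \<omega>\<bar> \<le> exp (- \<sigma> * T n \<omega>) * \<bar>exp (T n \<omega>) * \<xi> \<omega> - (real N0 + real n)\<bar>"
          by (rule q_le) (rule T_nonneg[OF S])
        then have "\<bar>q n (T n \<omega>) - \<xi> \<omega>\<bar> \<le> \<bar>F n \<omega>\<bar>"
          by (simp add: F_def abs_mult)
        moreover have "\<bar>F n \<omega>\<bar> \<le> DF \<omega>" using elim(2) by blast
        ultimately have "q n (T n \<omega>) \<le> DQ \<omega>" unfolding DQ_def by linarith
        then show "cmod (u2 m z (Y n \<omega>) * exp (- z * of_real (T n \<omega>))) \<le> DW \<omega>"
          by (rule mart_le[OF elim(1)])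
      qed
    qed
    \<comment> \<open>The left side is constant in n, so the limit computes the mean of
      \<open>W\<close>.\<close>
    have "(\<lambda>n. expectation (\<lambda>\<omega>. u2 m z (Y n \<omega>) * exp (- z * of_real (T n \<omega>)))) \<longlonglongrightarrow> expectation W"
    proof (rule integral_dominated_convergence[where w = "\<lambda>\<omega>. \<bar>DW \<omega>\<bar> ^ 1"])
      show "integrable M (\<lambda>\<omega>. \<bar>DW \<omega>\<bar> ^ 1)" using DW unfolding all_moments_def by blast
      show "AE \<omega> in M. (\<lambda>n. u2 m z (Y n \<omega>) * exp (- z * of_real (T n \<omega>))) \<longlonglongrightarrow> W \<omega>" by (rule lim)
      show "AE \<omega> in M. norm (u2 m z (Y n \<omega>) * exp (- z * of_real (T n \<omega>))) \<le> \<bar>DW \<omega>\<bar> ^ 1" for n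
        using dom
      proof eventually_elim
        case (elim \<omega>)
        then have "cmod (u2 m z (Y n \<omega>) * exp (- z * of_real (T n \<omega>))) \<le> DW \<omega>" by blast
        then show ?case by simp
      qed
    qed measurable
    then show "expectation W = u2 m z x0"
      unfolding expectation_u2_T[OF z_root N0_z] by (simp add: LIMSEQ_const_iff)
    show "all_moments M (\<lambda>\<omega>. cmod (W \<omega>))"
    proof (rule all_moments_bound[OF DW])
      show "AE \<omega> in M. \<bar>cmod (W \<omega>)\<bar> \<le> DW \<omega>"
        using lim dom
      proof eventually_elim
        case (elim \<omega>)
        have "cmod (W \<omega>) \<le> DW \<omega>"
          by (rule LIMSEQ_le_const2[OF tendsto_norm[OF elim(1)]]) (use elim(2) in blast)
        then show ?case by simp
      qed
    qed measurable
  qed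
  \<comment> \<open>Summing the coordinate bounds over k gives one dominating variable for the whole
    vector.\<close>
  define D where "D \<omega> = (\<Sum>k=1..m-1. \<bar>v1 m k\<bar> * (DF \<omega> + (DF \<omega> + 1)) +
     (2 * cmod (v2 m z k) * (DW \<omega> + cmod (W \<omega>)) + (\<Sum>w\<in>others. cmod (v2 m w k) * (DO w \<omega> * \<bar>DQ \<omega>\<bar> powr \<sigma>))))" for \<omega>
  have sum_mom: "all_moments M (\<lambda>\<omega>. \<Sum>i\<in>I. f i \<omega>)" if "finite I" "\<And>i. i \<in> I \<Longrightarrow> all_moments M (f i)"
    for I :: "'i set" and f
    using that by (induction I) (auto intro!: all_moments_add all_moments_const)
  have "all_moments M D"
    unfolding D_def using sigma
    by (intro sum_mom all_moments_add all_moments_mult all_moments_const all_moments_powr DF DW Wmom DO DQ finite_others) auto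
  moreover have "AE \<omega> in M. \<forall>k\<in>{1..m-1}.
        ((\<lambda>t. residual \<xi> W k t \<omega> / exp (\<sigma> * t)) \<longlongrightarrow> 0) at_top \<and>
        (\<forall>t\<ge>0. \<bar>residual \<xi> W k t \<omega> / exp (\<sigma> * t)\<bar> \<le> D \<omega>)"
  proof -
    have Olim': "AE \<omega> in M. \<forall>w\<in>others. (\<lambda>n. cmod (u2 m w (Y n \<omega>)) / (real N0 + real n) powr \<sigma>) \<longlonglongrightarrow> 0"
      using Olim finite_others by (intro AE_finite_allI) auto
    have Ole': "AE \<omega> in M. \<forall>w\<in>others. \<forall>n. cmod (u2 m w (Y n \<omega>)) / (real N0 + real n) powr \<sigma> \<le> DO w \<omega>"
      using Ole finite_others by (intro AE_finite_allI) auto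
    show ?thesis
      using Olim' Ole' Zlim Zle Flim Fle X_jumps AE_path
    proof eventually_elim
      case (elim \<omega>)
      have Spos: "\<forall>j. S j \<omega> > 0" and YA: "\<forall>j. Y j \<omega> \<in> A j" using elim(8) by blast+
      \<comment> \<open>\<open>N t\<close> is the number of jumps up to time t, chosen separately
        for each path.\<close>
      obtain N where N: "\<And>t. t \<ge> 0 \<Longrightarrow> T (N t) \<omega> \<le> t \<and> t < T (Suc (N t)) \<omega> \<and> X t \<omega> = Y (N t) \<omega>"
        using elim(7) unfolding clocks.T_def by metis
      have "mono (\<lambda>n. T n \<omega>)"
        using Spos by (intro mono_iff_le_Suc[THEN iffD2]) (auto simp: clocks.T_def intro: less_imp_le)
      then have Ninf: "filterlim N sequentially at_top"
        by (rule filterlim_jump_count) (use N in blast)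
      define B1 where "B1 t = exp (- \<sigma> * t) * \<bar>exp t * \<xi> \<omega> - (real N0 + real (N t))\<bar>" for t
      \<comment> \<open>The index \<open>Suc (N t)\<close> enters because the value at time t is
        enclosed between those at the jumps before and after it.\<close>
      have B1: "B1 t \<le> \<bar>F (N t) \<omega>\<bar> + \<bar>F (Suc (N t)) \<omega>\<bar> + exp (- \<sigma> * t)" if "t \<ge> 0" for t
        using between_jumps[of \<sigma> "\<xi> \<omega>" "real N0 + real (N t)" "T (N t) \<omega>" t "T (Suc (N t)) \<omega>"] N[OF that] \<xi>pos[of \<omega>] sigma
        by (simp add: B1_def F_def add.commute add.left_commute)
      have B1n: "B1 t \<ge> 0" for t by (simp add: B1_def)
      have FNlim: "((\<lambda>t. F (N t) \<omega>) \<longlongrightarrow> 0) at_top" "((\<lambda>t. F (Suc (N t)) \<omega>) \<longlongrightarrow> 0) at_top"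
        using filterlim_compose[OF elim(5) Ninf] filterlim_compose[OF LIMSEQ_Suc[OF elim(5)] Ninf] by auto
      have expl: "((\<lambda>t. exp (- \<sigma> * t)) \<longlongrightarrow> 0) at_top"
      proof -
        have "LIM t at_top. \<sigma> * t :> at_top"
          using sigma by (intro filterlim_tendsto_pos_mult_at_top[OF tendsto_const _ filterlim_ident]) auto
        then have "LIM t at_top. - \<sigma> * t :> at_bot" by (simp add: filterlim_uminus_at_bot)
        then show ?thesis by (rule filterlim_compose[OF exp_at_bot])
      qed
      have B1lim: "(B1 \<longlongrightarrow> 0) at_top"
      proof (rule Lim_null_comparison)
        show "((\<lambda>t. \<bar>F (N t) \<omega>\<bar> + \<bar>F (Suc (N t)) \<omega>\<bar> + exp (- \<sigma> * t)) \<longlongrightarrow> 0) at_top"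
          using tendsto_add[OF tendsto_add[OF tendsto_rabs_zero[OF FNlim(1)] tendsto_rabs_zero[OF FNlim(2)]] expl] by simp
        show "\<forall>\<^sub>F t in at_top. norm (B1 t) \<le> \<bar>F (N t) \<omega>\<bar> + \<bar>F (Suc (N t)) \<omega>\<bar> + exp (- \<sigma> * t)"
          using eventually_ge_at_top[of 0]
          by eventually_elim (unfold real_norm_def abs_of_nonneg[OF B1n], rule B1)
      qed
      have B1D: "B1 t \<le> DF \<omega> + (DF \<omega> + 1)" if "t \<ge> 0" for t
      proof -
        have "\<bar>F (N t) \<omega>\<bar> \<le> DF \<omega>" "\<bar>F (Suc (N t)) \<omega>\<bar> \<le> DF \<omega>" using elim(6) by blast+
        moreover have "exp (- \<sigma> * t) \<le> 1" using that sigma by simp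
        ultimately show ?thesis using B1[OF that] by linarith
      qed
      have qB1: "\<bar>q (N t) t - \<xi> \<omega>\<bar> \<le> B1 t" if "t \<ge> 0" for t
        unfolding B1_def by (rule q_le[OF that])
      have qlim: "((\<lambda>t. q (N t) t) \<longlongrightarrow> \<xi> \<omega>) at_top"
      proof (rule LIM_zero_cancel, rule Lim_null_comparison[OF _ B1lim])
        show "\<forall>\<^sub>F t in at_top. norm (q (N t) t - \<xi> \<omega>) \<le> B1 t"
          using eventually_ge_at_top[of 0] by eventually_elim (simp add: qB1)
      qed
      have qD: "q (N t) t \<le> DQ \<omega>" if "t \<ge> 0" for t
        using qB1[OF that] B1D[OF that] unfolding DQ_def by linarith
      define B2 where "B2 t = cmod (u2 m z (Y (N t) \<omega>) * exp (- z * of_real t) - W \<omega>)" for t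
      have B2lim: "(B2 \<longlongrightarrow> 0) at_top"
        unfolding B2_def using mart_lim[OF elim(3) Ninf qlim] by (intro tendsto_norm_zero LIM_zero)
      have B2D: "B2 t \<le> DW \<omega> + cmod (W \<omega>)" if "t \<ge> 0" for t
        using norm_triangle_ineq4[of "u2 m z (Y (N t) \<omega>) * exp (- z * of_real t)" "W \<omega>"]
          mart_le[OF elim(4) qD[OF that]] by (simp add: B2_def)
      define B3 where "B3 w t = cmod (u2 m w (Y (N t) \<omega>)) * exp (- \<sigma> * t)" for w t
      \<comment> \<open>Real time is replaced by the number of jumps, at the cost of a power of q
        that converges to a positive power of \<xi>.\<close>
      have B3: "B3 w t = cmod (u2 m w (Y (N t) \<omega>)) / (real N0 + real (N t)) powr \<sigma> * q (N t) t powr \<sigma>" for w t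
      proof -
        have p: "real N0 + real (N t) > 0" using N0_pos by simp
        then have "q (N t) t powr \<sigma> = (real N0 + real (N t)) powr \<sigma> * exp (- \<sigma> * t)"
          unfolding q_def by (subst powr_mult) (auto simp: powr_def)
        then show ?thesis using p by (simp add: B3_def)
      qed
      have B3lim: "(B3 w \<longlongrightarrow> 0) at_top" if "w \<in> others" for w
      proof -
        have "(\<lambda>n. cmod (u2 m w (Y n \<omega>)) / (real N0 + real n) powr \<sigma>) \<longlonglongrightarrow> 0" using elim(1) that by blast
        from filterlim_compose[OF this Ninf]
        have "(B3 w \<longlongrightarrow> 0 * \<xi> \<omega> powr \<sigma>) at_top"
          unfolding B3 using qlim \<xi>pos[of \<omega>] by (intro tendsto_mult tendsto_powr tendsto_const) auto
        then show ?thesis by simp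
      qed
      have B3D: "B3 w t \<le> DO w \<omega> * \<bar>DQ \<omega>\<bar> powr \<sigma>" if "t \<ge> 0" "w \<in> others" for w t
        unfolding B3
      proof (rule mult_mono)
        show o: "cmod (u2 m w (Y (N t) \<omega>)) / (real N0 + real (N t)) powr \<sigma> \<le> DO w \<omega>"
          using elim(2) that(2) by blast
        have "0 \<le> cmod (u2 m w (Y (N t) \<omega>)) / (real N0 + real (N t)) powr \<sigma>" by simp
        then show "0 \<le> DO w \<omega>" using o by (rule order_trans)
        show "q (N t) t powr \<sigma> \<le> \<bar>DQ \<omega>\<bar> powr \<sigma>"
          using qD[OF that(1)] q0[of "N t" t] sigma by (intro powr_mono2) auto
      qed simp
      define R where "R k t = \<bar>v1 m k\<bar> * B1 t + 2 * cmod (v2 m z k) * B2 t + (\<Sum>w\<in>others. cmod (v2 m w k) * B3 w t)" for k t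
      have RR: "\<bar>residual \<xi> W k t \<omega> / exp (\<sigma> * t)\<bar> \<le> R k t" if "k \<in> {1..m-1}" "t \<ge> 0" for k t
      proof -
        have "X t \<omega> = Y (N t) \<omega>" "Y (N t) \<omega> \<in> A (N t)" using N[OF that(2)] YA by blast+
        from residual_le[OF this that(1), of \<xi> W] show ?thesis
          unfolding R_def B1_def B2_def B3_def .
      qed
      have Rlim: "(R k \<longlongrightarrow> 0) at_top" for k
      proof -
        have "(R k \<longlongrightarrow> \<bar>v1 m k\<bar> * 0 + 2 * cmod (v2 m z k) * 0 + (\<Sum>w\<in>others. cmod (v2 m w k) * 0)) at_top"
          unfolding R_def by (intro tendsto_add tendsto_mult tendsto_const tendsto_sum B1lim B2lim B3lim)
        then show ?thesis by simp
      qed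
      define Dk where "Dk k = \<bar>v1 m k\<bar> * (DF \<omega> + (DF \<omega> + 1)) +
         (2 * cmod (v2 m z k) * (DW \<omega> + cmod (W \<omega>)) + (\<Sum>w\<in>others. cmod (v2 m w k) * (DO w \<omega> * \<bar>DQ \<omega>\<bar> powr \<sigma>)))" for k
      have RD: "R k t \<le> Dk k" if "t \<ge> 0" for k t
        unfolding R_def Dk_def add.assoc
        using B1D[OF that] B2D[OF that] B3D[OF that]
        by (intro add_mono mult_left_mono sum_mono) auto
      have B2n: "B2 t \<ge> 0" and B3n: "B3 w t \<ge> 0" for w t by (auto simp: B2_def B3_def)
      have Rn: "R k t \<ge> 0" for k t
        unfolding R_def using B1n B2n B3n by (intro add_nonneg_nonneg mult_nonneg_nonneg sum_nonneg) auto
      have Dkn: "Dk k \<ge> 0" for k using order_trans[OF Rn RD[of 0 k]] by simp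
      have DkD: "Dk k \<le> D \<omega>" if "k \<in> {1..m-1}" for k
        unfolding D_def Dk_def[symmetric] using Dkn that by (intro member_le_sum) auto
      show ?case
      proof (intro ballI conjI allI impI)
        fix k assume k: "k \<in> {1..m-1}"
        show "((\<lambda>t. residual \<xi> W k t \<omega> / exp (\<sigma> * t)) \<longlongrightarrow> 0) at_top"
        proof (rule Lim_null_comparison[OF _ Rlim[of k]])
          show "\<forall>\<^sub>F t in at_top. norm (residual \<xi> W k t \<omega> / exp (\<sigma> * t)) \<le> R k t"
            using eventually_ge_at_top[of 0] by eventually_elim (unfold real_norm_def, rule RR[OF k])
        qed
        show "\<bar>residual \<xi> W k t \<omega> / exp (\<sigma> * t)\<bar> \<le> D \<omega>" if "t \<ge> 0" for t
          using order_trans[OF RR[OF k that] order_trans[OF RD[OF that] DkD[OF k]]] .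
      qed
    qed
  qed
  ultimately show ?thesis
    using clocks.limit_gamma_distributed[OF \<xi> \<xi>pos Qlim] \<xi>pos W Wmom EW by blast
qed

end

theorem theorem4p1:
  fixes M :: "'a measure" and X :: "real \<Rightarrow> 'a \<Rightarrow> (nat \<Rightarrow> nat)"
    and m :: nat and x0 :: "nat \<Rightarrow> nat" and lam2 :: complex
  assumes "prob_space M"
    and "m \<ge> 27"
    and "\<forall>i. i \<notin> {1..m-1} \<longrightarrow> x0 i = 0"
    and "x0 \<noteq> (\<lambda>_. 0)"
    and "is_branching_process m x0 M X"
    and "chi m lam2 = 0" and "Im lam2 > 0"
    and "\<forall>z. chi m z = 0 \<and> z \<noteq> 1 \<longrightarrow> Re z \<le> Re lam2"
  shows "\<exists>(\<xi> :: 'a \<Rightarrow> real) (W :: 'a \<Rightarrow> complex)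
           (\<epsilon>1 :: real \<Rightarrow> 'a \<Rightarrow> real) (\<epsilon>2 :: real \<Rightarrow> 'a \<Rightarrow> real)
           (\<epsilon>3 :: real \<Rightarrow> 'a \<Rightarrow> nat \<Rightarrow> real).
     (\<exists>a \<theta>. a > 0 \<and> \<theta> > 0 \<and> a * \<theta> = u1 m x0 \<and>
            distributed M lborel \<xi> (gamma_density a \<theta>)) \<and>
     (AE \<omega> in M. \<xi> \<omega> > 0) \<and>
     W \<in> borel_measurable M \<and>
     (\<forall>p::real. p \<ge> 1 \<longrightarrow> integrable M (\<lambda>\<omega>. norm (W \<omega>) powr p)) \<and>
     (\<integral>\<omega>. W \<omega> \<partial>M) = u2 m lam2 x0 \<and>
     (\<forall>t. \<epsilon>1 t \<in> borel_measurable M \<and> \<epsilon>2 t \<in> borel_measurable M \<and>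
          (\<forall>k. (\<lambda>\<omega>. \<epsilon>3 t \<omega> k) \<in> borel_measurable M)) \<and>
     (AE \<omega> in M. ((\<lambda>t. \<epsilon>1 t \<omega>) \<longlongrightarrow> 0) at_top) \<and>
     (AE \<omega> in M. ((\<lambda>t. \<epsilon>2 t \<omega>) \<longlongrightarrow> 0) at_top) \<and>
     (\<forall>p::real. p \<ge> 1 \<longrightarrow>
        ((\<lambda>t. \<integral>\<^sup>+\<omega>. ennreal (\<bar>\<epsilon>1 t \<omega>\<bar> powr p) \<partial>M) \<longlongrightarrow> 0) at_top \<and>
        ((\<lambda>t. \<integral>\<^sup>+\<omega>. ennreal (\<bar>\<epsilon>2 t \<omega>\<bar> powr p) \<partial>M) \<longlongrightarrow> 0) at_top) \<and>
     (\<forall>k\<in>{1..m-1}.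
        (AE \<omega> in M. ((\<lambda>t. \<epsilon>3 t \<omega> k / exp (Re lam2 * t)) \<longlongrightarrow> 0) at_top) \<and>
        (\<forall>p::real. p \<ge> 1 \<longrightarrow>
           ((\<lambda>t. \<integral>\<^sup>+\<omega>. ennreal (\<bar>\<epsilon>3 t \<omega> k / exp (Re lam2 * t)\<bar> powr p) \<partial>M)
              \<longlongrightarrow> 0) at_top)) \<and>
     (\<forall>t\<ge>0. \<forall>\<omega>\<in>space M. \<forall>k\<in>{1..m-1}.
        real (X t \<omega> k) =
          exp t * \<xi> \<omega> * v1 m k * (1 + \<epsilon>1 t \<omega>)
          + 2 * Re (exp (lam2 * of_real t) * W \<omega> * v2 m lam2 k) * (1 + \<epsilon>2 t \<omega>)
          + \<epsilon>3 t \<omega> k)"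
proof -
  have Xm: "X t \<in> measurable M (count_space UNIV)" if "t \<ge> 0" for t
    using assms(5) that unfolding is_branching_process_def by blast
  obtain Y S where Ym: "\<And>j. Y j \<in> measurable M (count_space UNIV)"
    and Sm: "\<And>j. S j \<in> borel_measurable M"
    and law: "\<And>n (ys :: nat \<Rightarrow> (nat \<Rightarrow> nat)) (ss :: nat \<Rightarrow> real). (\<forall>j<n. ss j \<ge> 0) \<Longrightarrow>
           measure M {\<omega> \<in> space M. (\<forall>j\<le>n. Y j \<omega> = ys j) \<and> (\<forall>j<n. S j \<omega> > ss j)} =
           (if ys 0 = x0 then 1 else 0) *
           (\<Prod>j<n. jump_prob m (ys j) (ys (Suc j)) * exp (- rate m (ys j) * ss j))"
    and XY: "AE \<omega> in M. \<forall>t\<ge>0. \<exists>n. (\<Sum>j<n. S j \<omega>) \<le> t \<and> t < (\<Sum>j<Suc n. S j \<omega>) \<and> X t \<omega> = Y n \<omega>"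
    using assms(5) unfolding is_branching_process_def by blast
  \<comment> \<open>A root other than \<open>1\<close> with real part above \<open>1/2\<close>
    passes this bound on to \<open>lam2\<close> by maximality.\<close>
  obtain w where w: "chi m w = 0" "w \<noteq> 1" "Re w > 1/2"
    using ex_root_Re_gt_half[OF assms(2)] by blast
  then have Re_lam2: "Re lam2 > 1/2" using assms(8) by fastforce
  interpret urn_asymptotics M m x0 Y S X lam2
    unfolding urn_asymptotics_def urn_process_def urn_process_axioms_def urn_asymptotics_axioms_def
    using assms(1-4,6-8) Ym Sm law XY Re_lam2 by (intro conjI allI impI) auto
  obtain \<xi> W D where \<xi>: "distributed M lborel \<xi> (gamma_density (real N0) 1)" and \<xi>pos: "\<And>\<omega>. \<xi> \<omega> > 0"
    and W: "W \<in> borel_measurable M" "all_moments M (\<lambda>\<omega>. cmod (W \<omega>))" "expectation W = u2 m lam2 x0"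
    and D: "all_moments M D"
    and R: "AE \<omega> in M. \<forall>k\<in>{1..m-1}.
        ((\<lambda>t. residual \<xi> W k t \<omega> / exp (Re lam2 * t)) \<longlongrightarrow> 0) at_top \<and>
        (\<forall>t\<ge>0. \<bar>residual \<xi> W k t \<omega> / exp (Re lam2 * t)\<bar> \<le> D \<omega>)"
    using main_asymptotics by blast
  have \<xi>m: "\<xi> \<in> borel_measurable M" using distributed_measurable[OF \<xi>] by simp
  \<comment> \<open>Measurability of the process is given for \<open>t \<ge> 0\<close>, while the
    error must be measurable at every real t; the default \<open>0\<close> at negative times also
    keeps the domination valid for all t.\<close>
  define e3 where "e3 t \<omega> k = (if t < 0 then 0 else residual \<xi> W k t \<omega>)" for t \<omega> k
  have e3m: "(\<lambda>\<omega>. e3 t \<omega> k) \<in> borel_measurable M" for t k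
  proof (cases "t < 0")
    case False
    have [measurable]: "(\<lambda>\<omega>. real (X t \<omega> k)) \<in> borel_measurable M"
      using False by (intro measurable_compose[OF Xm]) auto
    note [measurable] = \<xi>m W(1)
    show ?thesis using False unfolding e3_def residual_def by simp
  qed (simp add: e3_def)
  have e3_lim: "AE \<omega> in M. ((\<lambda>t. e3 t \<omega> k / exp (Re lam2 * t)) \<longlongrightarrow> 0) at_top" if k: "k \<in> {1..m-1}" for k
    using R
  proof eventually_elim
    case (elim \<omega>)
    have "((\<lambda>t. residual \<xi> W k t \<omega> / exp (Re lam2 * t)) \<longlongrightarrow> 0) at_top" using bspec[OF elim k] by (rule conjunct1)
    moreover have "\<forall>\<^sub>F t in at_top. residual \<xi> W k t \<omega> / exp (Re lam2 * t) = e3 t \<omega> k / exp (Re lam2 * t)"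
      using eventually_ge_at_top[of 0] by eventually_elim (simp add: e3_def)
    ultimately show ?case by (rule Lim_transform_eventually)
  qed
  have e3_Lp: "((\<lambda>t. \<integral>\<^sup>+\<omega>. ennreal (\<bar>e3 t \<omega> k / exp (Re lam2 * t)\<bar> powr p) \<partial>M) \<longlongrightarrow> 0) at_top"
    if k: "k \<in> {1..m-1}" and p: "p \<ge> 1" for k p
  proof (rule tendsto_nn_integral_powr[OF _ e3_lim[OF k] _ all_moments_abs[OF D] p])
    show "(\<lambda>\<omega>. e3 t \<omega> k / exp (Re lam2 * t)) \<in> borel_measurable M" for t
      using e3m[of t k] by measurable
    show "AE \<omega> in M. \<forall>t. \<bar>e3 t \<omega> k / exp (Re lam2 * t)\<bar> \<le> \<bar>D \<omega>\<bar>"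
      using R
    proof eventually_elim
      case (elim \<omega>)
      have b: "\<bar>residual \<xi> W k t \<omega> / exp (Re lam2 * t)\<bar> \<le> D \<omega>" if "t \<ge> 0" for t
        using conjunct2[OF bspec[OF elim k]] that by blast
      show ?case
      proof
        fix t
        show "\<bar>e3 t \<omega> k / exp (Re lam2 * t)\<bar> \<le> \<bar>D \<omega>\<bar>"
        proof (cases "t < 0")
          case False
          then have "\<bar>e3 t \<omega> k / exp (Re lam2 * t)\<bar> \<le> D \<omega>" using b[of t] by (simp add: e3_def)
          then show ?thesis by linarith
        qed (simp add: e3_def)
      qed
    qed
  qed
  have u: "real N0 = u1 m x0" by (simp add: u1_eq_mass N0_def)
  show ?thesis
  proof (rule exI[of _ \<xi>], rule exI[of _ W], rule exI[of _ "\<lambda>_ _. 0"], rule exI[of _ "\<lambda>_ _. 0"], rule exI[of _ e3], intro conjI)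
    show "\<exists>a \<theta>. a > 0 \<and> \<theta> > 0 \<and> a * \<theta> = u1 m x0 \<and> distributed M lborel \<xi> (gamma_density a \<theta>)"
      using \<xi> N0_pos u by (intro exI[of _ "real N0"] exI[of _ 1]) simp
    show "AE \<omega> in M. \<xi> \<omega> > 0" using \<xi>pos by simp
    show "\<forall>p::real. p \<ge> 1 \<longrightarrow> integrable M (\<lambda>\<omega>. norm (W \<omega>) powr p)"
      using all_moments_integrable_powr[OF W(2)] by simp
    show "\<forall>k\<in>{1..m-1}.
        (AE \<omega> in M. ((\<lambda>t. e3 t \<omega> k / exp (Re lam2 * t)) \<longlongrightarrow> 0) at_top) \<and>
        (\<forall>p::real. p \<ge> 1 \<longrightarrow>
           ((\<lambda>t. \<integral>\<^sup>+\<omega>. ennreal (\<bar>e3 t \<omega> k / exp (Re lam2 * t)\<bar> powr p) \<partial>M) \<longlongrightarrow> 0) at_top)"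
      by (intro ballI conjI allI impI e3_lim e3_Lp)
    show "\<forall>t. (\<lambda>_. 0 :: real) \<in> borel_measurable M \<and> (\<lambda>_. 0 :: real) \<in> borel_measurable M \<and>
          (\<forall>k. (\<lambda>\<omega>. e3 t \<omega> k) \<in> borel_measurable M)"
      using e3m by simp
    show "\<forall>t\<ge>0. \<forall>\<omega>\<in>space M. \<forall>k\<in>{1..m-1}.
        real (X t \<omega> k) = exp t * \<xi> \<omega> * v1 m k * (1 + 0)
          + 2 * Re (exp (lam2 * of_real t) * W \<omega> * v2 m lam2 k) * (1 + 0) + e3 t \<omega> k"
      by (auto simp: e3_def residual_def)
  qed (use W in auto)
qed

end
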